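(* Let $G$ be a locally compact group having strong Property $(T)$ (with respect to Hilbert spaces). Let $X$ be a uniformly fine hyperbolic graph equipped with an isometric action of $G$. Then every orbit for this action is bounded.
   Context: A length function on a topological group $G$ is a continuous function $l:G\to\mathbb{R}_+$ with $l(g)=l(g^{-1})$ and $l(g_1g_2)\le l(g_1)+l(g_2)$. A locally compact group $G$ has strong Property $(T)$ (with respect to Hilbert spaces) if for every length function $l$ on $G$ there is a sequence of compactly supported symmetric Borel measures $m_n$ on $G$ such that, for every Hilbert space $H$, there is a constant $t>0$ such that: for every strongly continuous representation $\pi$ of $G$ on $H$ satisfying $\|\pi(g)\|_{B(H)}\le L e^{t\,l(g)}$ for all $g \in G$, for some $L\in\mathbb{R}_+$, the operators $\pi(m_n)$ converge in the norm topology of $B(H)$ to a projection on the space of $\pi(G)$-invariant vectors of $H$. A connected graph $X$ (with its path metric) is $\delta$-hyperbolic, $\delta>0$, if in every geodesic triangle each side is contained in the $\delta$-neighbourhood of the union of the other two; it is hyperbolic if it is $\delta$-hyperbolic for some $\delta>0$. A graph is fine if for every edge $e$ and every $L\ge 0$ the set of simple simplicial loops of length at most $L$ containing $e$ is finite; it is uniformly fine if the cardinality of this set is bounded above by a function of $L$ only.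
   Formalization: The isometric action of G is assumed continuous (vertex stabilizers open), as is usual for topological groups; for discontinuous actions the claim fails, e.g. for the compact group (Z/2)^N mapped onto the direct sum of copies of Z/2 acting on its coset tree. *)

theory Defs
  imports "HOL-Analysis.Analysis"
begin

section \<open>Complex Hilbert spaces on an arbitrary carrier\<close>

text \<open>
  Strong Property (T) quantifies over all Hilbert spaces inside a formula, so a Hilbert space
  has to be a value and not a type. Accordingly it is a structure on a carrier set.
\<close>

record 'h hilbert_struct =
  carrier :: "'h set"
  add :: "'h \<Rightarrow> 'h \<Rightarrow> 'h"
  zero :: 'h
  scale :: "complex \<Rightarrow> 'h \<Rightarrow> 'h"
  inner_prod :: "'h \<Rightarrow> 'h \<Rightarrow> complex"

definition diff_in :: "'h hilbert_struct \<Rightarrow> 'h \<Rightarrow> 'h \<Rightarrow> 'h" where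
  "diff_in H x y = add H x (scale H (-1) y)"

definition norm_in :: "'h hilbert_struct \<Rightarrow> 'h \<Rightarrow> real" where
  "norm_in H x = sqrt (Re (inner_prod H x x))"

locale complex_vector_space =
  fixes H :: "'h hilbert_struct"
  assumes zero_closed: "zero H \<in> carrier H"
    and add_closed: "\<lbrakk>x \<in> carrier H; y \<in> carrier H\<rbrakk> \<Longrightarrow> add H x y \<in> carrier H"
    and scale_closed: "x \<in> carrier H \<Longrightarrow> scale H a x \<in> carrier H"
    and add_assoc: "\<lbrakk>x \<in> carrier H; y \<in> carrier H; z \<in> carrier H\<rbrakk>
          \<Longrightarrow> add H (add H x y) z = add H x (add H y z)"
    and add_commute: "\<lbrakk>x \<in> carrier H; y \<in> carrier H\<rbrakk> \<Longrightarrow> add H x y = add H y x"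
    and add_zero: "x \<in> carrier H \<Longrightarrow> add H x (zero H) = x"
    and add_inverse: "x \<in> carrier H \<Longrightarrow> \<exists>y\<in>carrier H. add H x y = zero H"
    and scale_one: "x \<in> carrier H \<Longrightarrow> scale H 1 x = x"
    and scale_scale: "x \<in> carrier H \<Longrightarrow> scale H a (scale H b x) = scale H (a * b) x"
    and scale_add_right: "\<lbrakk>x \<in> carrier H; y \<in> carrier H\<rbrakk>
          \<Longrightarrow> scale H a (add H x y) = add H (scale H a x) (scale H a y)"
    and scale_add_left: "x \<in> carrier H
          \<Longrightarrow> scale H (a + b) x = add H (scale H a x) (scale H b x)"

locale complex_hilbert_space = complex_vector_space H
  for H :: "'h hilbert_struct" +
  assumes inner_add_left: "\<lbrakk>x \<in> carrier H; y \<in> carrier H; z \<in> carrier H\<rbrakk>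
          \<Longrightarrow> inner_prod H (add H x y) z = inner_prod H x z + inner_prod H y z"
    and inner_scale_left: "\<lbrakk>x \<in> carrier H; y \<in> carrier H\<rbrakk>
          \<Longrightarrow> inner_prod H (scale H a x) y = a * inner_prod H x y"
    and inner_commute: "\<lbrakk>x \<in> carrier H; y \<in> carrier H\<rbrakk>
          \<Longrightarrow> inner_prod H y x = cnj (inner_prod H x y)"
    and inner_pos: "\<lbrakk>x \<in> carrier H; x \<noteq> zero H\<rbrakk> \<Longrightarrow> Re (inner_prod H x x) > 0"
    and complete: "\<lbrakk>\<And>n. X n \<in> carrier H;
          \<And>e. e > 0 \<Longrightarrow> \<exists>N::nat. \<forall>m\<ge>N. \<forall>n\<ge>N. norm_in H (diff_in H (X m) (X n)) < e\<rbrakk>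
          \<Longrightarrow> \<exists>x\<in>carrier H. (\<lambda>n. norm_in H (diff_in H (X n) x)) \<longlonglongrightarrow> 0"

definition linear_operator :: "'h hilbert_struct \<Rightarrow> ('h \<Rightarrow> 'h) \<Rightarrow> bool" where
  "linear_operator H T \<longleftrightarrow>
     (\<forall>x\<in>carrier H. T x \<in> carrier H) \<and>
     (\<forall>x\<in>carrier H. \<forall>y\<in>carrier H. T (add H x y) = add H (T x) (T y)) \<and>
     (\<forall>a. \<forall>x\<in>carrier H. T (scale H a x) = scale H a (T x))"

definition op_norm_le :: "'h hilbert_struct \<Rightarrow> ('h \<Rightarrow> 'h) \<Rightarrow> real \<Rightarrow> bool" where
  "op_norm_le H T C \<longleftrightarrow> (\<forall>x\<in>carrier H. norm_in H (T x) \<le> C * norm_in H x)"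

definition bounded_operator :: "'h hilbert_struct \<Rightarrow> ('h \<Rightarrow> 'h) \<Rightarrow> bool" where
  "bounded_operator H T \<longleftrightarrow> linear_operator H T \<and> (\<exists>C. op_norm_le H T C)"

definition norm_convergent_to ::
  "'h hilbert_struct \<Rightarrow> (nat \<Rightarrow> 'h \<Rightarrow> 'h) \<Rightarrow> ('h \<Rightarrow> 'h) \<Rightarrow> bool" where
  "norm_convergent_to H T P \<longleftrightarrow>
     (\<forall>e>0. \<forall>\<^sub>F n in sequentially. op_norm_le H (\<lambda>x. diff_in H (T n x) (P x)) e)"

text \<open>A projection is a bounded idempotent; it need not be orthogonal.\<close>

definition projection_on :: "'h hilbert_struct \<Rightarrow> 'h set \<Rightarrow> ('h \<Rightarrow> 'h) \<Rightarrow> bool" where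
  "projection_on H S P \<longleftrightarrow>
     bounded_operator H P \<and> (\<forall>x\<in>carrier H. P (P x) = P x) \<and> P ` carrier H = S"


section \<open>Strong Property (T)\<close>

text \<open>
  Groups are written additively because the library's class of (not necessarily commutative)
  topological groups is \<open>topological_group_add\<close>.
\<close>

definition length_function :: "('g::topological_group_add \<Rightarrow> real) \<Rightarrow> bool" where
  "length_function l \<longleftrightarrow>
     continuous_on UNIV l \<and> (\<forall>g. 0 \<le> l g) \<and> (\<forall>g. l (- g) = l g) \<and>
     (\<forall>g h. l (g + h) \<le> l g + l h)"

definition compactly_supported_symmetric_measure ::
  "'g::topological_group_add measure \<Rightarrow> bool" where
  "compactly_supported_symmetric_measure m \<longleftrightarrow>
     sets m = sets borel \<and> finite_measure m \<and>
     (\<exists>K. compact K \<and> K \<in> sets borel \<and> emeasure m (UNIV - K) = 0) \<and>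
     (\<forall>A\<in>sets borel. emeasure m (uminus ` A) = emeasure m A)"

definition strongly_continuous_rep ::
  "'h hilbert_struct \<Rightarrow> ('g::topological_group_add \<Rightarrow> 'h \<Rightarrow> 'h) \<Rightarrow> bool" where
  "strongly_continuous_rep H \<pi> \<longleftrightarrow>
     (\<forall>g. bounded_operator H (\<pi> g)) \<and>
     (\<forall>x\<in>carrier H. \<pi> 0 x = x) \<and>
     (\<forall>g h. \<forall>x\<in>carrier H. \<pi> (g + h) x = \<pi> g (\<pi> h x)) \<and>
     (\<forall>x\<in>carrier H. \<forall>g. ((\<lambda>h. norm_in H (diff_in H (\<pi> h x) (\<pi> g x))) \<longlongrightarrow> 0) (nhds g))"

definition invariant_vectors ::
  "'h hilbert_struct \<Rightarrow> ('g \<Rightarrow> 'h \<Rightarrow> 'h) \<Rightarrow> 'h set" where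
  "invariant_vectors H \<pi> = {x \<in> carrier H. \<forall>g. \<pi> g x = x}"

text \<open>
  The operator \<open>\<pi>(m) = \<integral> \<pi>(g) dm(g)\<close>, as a weak integral: \<open>\<pi>(m) x\<close> is the vector that
  represents the functional \<open>y \<mapsto> \<integral> \<langle>\<pi>(g) x, y\<rangle> dm(g)\<close>. For strongly continuous \<open>\<pi>\<close> and finite,
  compactly supported \<open>m\<close> it exists and is unique by the Riesz theorem.
\<close>

definition rep_of_measure ::
  "'h hilbert_struct \<Rightarrow> ('g \<Rightarrow> 'h \<Rightarrow> 'h) \<Rightarrow> 'g measure \<Rightarrow> 'h \<Rightarrow> 'h" where
  "rep_of_measure H \<pi> m x =
     (THE z. z \<in> carrier H \<and>
        (\<forall>y\<in>carrier H. inner_prod H z y = (\<integral>g. inner_prod H (\<pi> g x) y \<partial>m)))"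

text \<open>
  HOL has no quantifier over types, so the Hilbert spaces range over all those whose underlying
  set lies in \<open>'g \<times> nat \<Rightarrow> complex\<close>. Up to isomorphism these include all Hilbert spaces of
  Hilbert dimension at most \<open>max(|G|, \<aleph>\<^sub>0)\<close>, and nothing is lost. Let \<open>t\<close> be the constant given
  for \<open>K = \<ell>\<^sup>2(G \<times> \<nat>)\<close>, and let \<open>\<pi>\<close> be a representation on an arbitrary Hilbert space \<open>H\<close> whose
  norm is at most \<open>L exp (t l(g))\<close>. Every countable subset of \<open>H\<close> lies in a closed invariant
  subspace of dimension at most \<open>max(|G|, \<aleph>\<^sub>0)\<close>, which becomes a representation on \<open>K\<close> after
  adding a trivial summand. Choosing a countable set that nearly attains all the norms
  \<open>\<parallel>\<pi>(m\<^sub>n) - \<pi>(m\<^sub>k)\<parallel>\<close> shows that \<open>\<pi>(m\<^sub>n)\<close> is norm Cauchy, with limit a projection on the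
  invariant vectors of \<open>H\<close>.
\<close>

definition strong_property_T :: "'g::topological_group_add itself \<Rightarrow> bool" where
  "strong_property_T (_ :: 'g itself) \<longleftrightarrow>
     (\<forall>l :: 'g \<Rightarrow> real. length_function l \<longrightarrow>
       (\<exists>m :: nat \<Rightarrow> 'g measure. (\<forall>n. compactly_supported_symmetric_measure (m n)) \<and>
         (\<forall>H :: ('g \<times> nat \<Rightarrow> complex) hilbert_struct. complex_hilbert_space H \<longrightarrow>
           (\<exists>t>0. \<forall>\<pi> :: 'g \<Rightarrow> ('g \<times> nat \<Rightarrow> complex) \<Rightarrow> ('g \<times> nat \<Rightarrow> complex).
             strongly_continuous_rep H \<pi> \<and>
             (\<exists>L\<ge>0. \<forall>g. op_norm_le H (\<pi> g) (L * exp (t * l g))) \<longrightarrow>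
             (\<exists>P. projection_on H (invariant_vectors H \<pi>) P \<and>
                  norm_convergent_to H (\<lambda>n. rep_of_measure H \<pi> (m n)) P)))))"


section \<open>Graphs\<close>

text \<open>
  A graph has the elements of the type \<open>'v\<close> as vertices and a set of two-element sets as edges.
  It is regarded as the metric space of its vertices with the path metric.
\<close>

definition simple_graph :: "'v set set \<Rightarrow> bool" where
  "simple_graph E \<longleftrightarrow> (\<forall>e\<in>E. card e = 2)"

definition edges_of :: "'v list \<Rightarrow> 'v set set" where
  "edges_of p = {{p ! i, p ! Suc i} | i. Suc i < length p}"

definition is_path :: "'v set set \<Rightarrow> 'v list \<Rightarrow> bool" where
  "is_path E p \<longleftrightarrow> p \<noteq> [] \<and> edges_of p \<subseteq> E"

definition path_length :: "'v list \<Rightarrow> nat" where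
  "path_length p = length p - 1"

definition path_from_to :: "'v set set \<Rightarrow> 'v \<Rightarrow> 'v \<Rightarrow> 'v list \<Rightarrow> bool" where
  "path_from_to E x y p \<longleftrightarrow> is_path E p \<and> hd p = x \<and> last p = y"

definition connected_graph :: "'v set set \<Rightarrow> bool" where
  "connected_graph E \<longleftrightarrow> (\<forall>x y. \<exists>p. path_from_to E x y p)"

definition graph_dist :: "'v set set \<Rightarrow> 'v \<Rightarrow> 'v \<Rightarrow> nat" where
  "graph_dist E x y = (LEAST n. \<exists>p. path_from_to E x y p \<and> path_length p = n)"

definition geodesic :: "'v set set \<Rightarrow> 'v \<Rightarrow> 'v \<Rightarrow> 'v list \<Rightarrow> bool" where
  "geodesic E x y p \<longleftrightarrow> path_from_to E x y p \<and> path_length p = graph_dist E x y"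

text \<open>
  All triples of sides are considered, and a reversed or permuted geodesic triangle is again
  one, so it suffices to constrain one side.
\<close>

definition delta_hyperbolic :: "'v set set \<Rightarrow> real \<Rightarrow> bool" where
  "delta_hyperbolic E \<delta> \<longleftrightarrow>
     (\<forall>x y z p q r. geodesic E x y p \<and> geodesic E y z q \<and> geodesic E z x r \<longrightarrow>
        (\<forall>a\<in>set p. \<exists>b\<in>set q \<union> set r. real (graph_dist E a b) \<le> \<delta>))"

definition hyperbolic_graph :: "'v set set \<Rightarrow> bool" where
  "hyperbolic_graph E \<longleftrightarrow> connected_graph E \<and> (\<exists>\<delta>>0. delta_hyperbolic E \<delta>)"

text \<open>
  Simple loops are based and oriented closed vertex lists with the base point repeated at the
  end. A cycle of length \<open>n\<close> thus occurs \<open>2 * n\<close> times, which does not affect (uniform)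
  fineness. The length is at least 3, so traversing an edge back and forth is not a simple loop.
\<close>

definition simple_loop :: "'v set set \<Rightarrow> 'v list \<Rightarrow> bool" where
  "simple_loop E p \<longleftrightarrow> is_path E p \<and> path_length p \<ge> 3 \<and> hd p = last p \<and> distinct (tl p)"

definition loops_through :: "'v set set \<Rightarrow> 'v set \<Rightarrow> nat \<Rightarrow> 'v list set" where
  "loops_through E e L = {p. simple_loop E p \<and> path_length p \<le> L \<and> e \<in> edges_of p}"

definition fine_graph :: "'v set set \<Rightarrow> bool" where
  "fine_graph E \<longleftrightarrow> (\<forall>e\<in>E. \<forall>L. finite (loops_through E e L))"

definition uniformly_fine_graph :: "'v set set \<Rightarrow> bool" where
  "uniformly_fine_graph E \<longleftrightarrow>
     fine_graph E \<and> (\<exists>f :: nat \<Rightarrow> nat. \<forall>e\<in>E. \<forall>L. card (loops_through E e L) \<le> f L)"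

text \<open>
  An action of a topological group on a graph is understood to be continuous, that is, the orbit
  maps into the discrete set of vertices are continuous. This is needed: the compact group
  \<open>\<prod>\<^sub>\<nat> \<int>/2\<close> maps, discontinuously, onto \<open>\<Oplus>\<^sub>\<nat> \<int>/2\<close>, which acts on a tree with unbounded orbits.
\<close>

definition isometric_action ::
  "'v set set \<Rightarrow> ('g::topological_group_add \<Rightarrow> 'v \<Rightarrow> 'v) \<Rightarrow> bool" where
  "isometric_action E act \<longleftrightarrow>
     (\<forall>x. act 0 x = x) \<and>
     (\<forall>g h x. act (g + h) x = act g (act h x)) \<and>
     (\<forall>g x y. graph_dist E (act g x) (act g y) = graph_dist E x y) \<and>
     (\<forall>x y. open {g. act g x = y})"

definition orbit :: "('g \<Rightarrow> 'v \<Rightarrow> 'v) \<Rightarrow> 'v \<Rightarrow> 'v set" where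
  "orbit act x = range (\<lambda>g. act g x)"

definition graph_bounded :: "'v set set \<Rightarrow> 'v set \<Rightarrow> bool" where
  "graph_bounded E A \<longleftrightarrow> (\<exists>C. \<forall>x\<in>A. \<forall>y\<in>A. graph_dist E x y \<le> C)"

end

theory Submission
  imports Defs
begin

text \<open>
  Fix a base point \<open>x\<close>. Two vertices are identified at level \<open>n\<close> if their horofunctions agree on
  the ball of radius \<open>n\<close> about \<open>x\<close>; the classes at level \<open>n\<close> that avoid the open ball of radius \<open>n\<close>
  are the pieces of \<open>x\<close>. The norm of a measure on \<open>X\<close> based at \<open>x\<close> is the \<open>\<ell>\<^sup>2\<close> norm of the family of
  its values on the pieces, with a polynomial weight in the level. The pieces of another base
  point \<open>x'\<close> are signed combinations of pieces of \<open>x\<close>: the classes of a vertex form a decreasing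
  chain, and an indicator function is a telescoping sum over its values at chosen points of these
  classes. A jump of the sum means that geodesics branch at a bounded angle from the geodesics
  joining \<open>x\<close> and \<open>x'\<close> to the piece, which by hyperbolicity yields simple loops of bounded length
  through a given edge; hence by uniform fineness every row and column of the change of base matrix
  has \<open>O(1 + d x x')\<close> entries, all of absolute value at most 1, and by the Schur test the norm of
  \<open>\<pi>(g)\<close> is polynomial in \<open>d x (g x)\<close>. The total mass is an invariant continuous functional, so
  strong Property (T) provides an invariant vector of total mass 1. If an orbit were unbounded, the
  constant function 1 would be a combination of \<open>O(1 + d x (g x))\<close> pieces of \<open>x\<close> and of \<open>g x\<close> at
  levels of order \<open>d x (g x)\<close>, and there an invariant vector is arbitrarily small: its total mass
  would be 0.
\<close>

section \<open>Walks and simple loops\<close>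

text \<open>Vertices may have infinitely many neighbours, so balls and spheres cannot be counted;
  the only finiteness at hand is that boundedly many edges share a short simple loop with a given
  edge. All counts are therefore attached to the edges in which geodesics from the base point cross
  a sphere, and loops come from two such edges joined by short walks on both sides of a cut. Pieces
  may be linearly dependent, and the matrix of a change of base is a choice. The Hilbert space
  therefore consists of the square summable families that respect every linear relation between the
  weighted indicators; there the choice does not matter, and the matrices multiply as the group
  does. Only classes that meet one orbit are used, which indexes the coordinates by group elements
  and levels. The weight is squeezed from both sides: it must outgrow the linear number of pieces in
  a decomposition of 1, yet the norms must stay below every exponential, as the rate
  \<open>t\<close> is fixed only after the space. A square does both. The measures in strong
  Property (T) are not normalised. The trivial representation on the same space shows that their
  masses tend to 1, so total mass 1 survives the limit.\<close>

lemma edges_of_Nil: "edges_of [] = {}" and edges_of_single: "edges_of [a] = {}"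
  by (auto simp: edges_of_def)

lemma edges_of_Cons2: "edges_of (a # b # p) = insert {a, b} (edges_of (b # p))"
proof (intro equalityI subsetI)
  fix e assume "e \<in> edges_of (a # b # p)"
  then obtain i where "e = {(a # b # p) ! i, (a # b # p) ! Suc i}" "Suc i < length (a # b # p)"
    by (auto simp: edges_of_def)
  then show "e \<in> insert {a, b} (edges_of (b # p))"
    by (cases i) (auto simp: edges_of_def)
next
  fix e assume "e \<in> insert {a, b} (edges_of (b # p))"
  then consider "e = {a, b}" | i where "e = {(b # p) ! i, (b # p) ! Suc i}" "Suc i < length (b # p)"
    by (auto simp: edges_of_def)
  then show "e \<in> edges_of (a # b # p)"
  proof cases
    case 1
    then show ?thesis unfolding edges_of_def by (intro CollectI exI[of _ 0]) auto
  next
    case (2 i)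
    then show ?thesis unfolding edges_of_def by (intro CollectI exI[of _ "Suc i"]) auto
  qed
qed

lemma edges_of_append:
  "p \<noteq> [] \<Longrightarrow> q \<noteq> [] \<Longrightarrow> edges_of (p @ q) = insert {last p, hd q} (edges_of p \<union> edges_of q)"
proof (induction p rule: induct_list012)
  case (2 x)
  then show ?case by (cases q) (auto simp: edges_of_Cons2 edges_of_single)
next
  case (3 x y zs)
  then show ?case by (auto simp: edges_of_Cons2)
qed (auto simp: edges_of_Nil)

text \<open>As a relation instead of a vertex list, walks of length at most \<open>L\<close> inside
  \<open>V\<close> can be concatenated, reversed and weakened without care for repeated vertices;
  \<open>conn_distinct_path\<close> extracts a list when a simple loop is built.\<close>

fun conn :: "'v set set \<Rightarrow> 'v set \<Rightarrow> nat \<Rightarrow> 'v \<Rightarrow> 'v \<Rightarrow> bool" where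
  "conn E V 0 a b \<longleftrightarrow> a = b \<and> a \<in> V"
| "conn E V (Suc L) a b \<longleftrightarrow> conn E V L a b \<or> a \<in> V \<and> (\<exists>c. {a, c} \<in> E \<and> conn E V L c b)"

lemma conn_mono:
  assumes "conn E V L a b" "V \<subseteq> V'" "L \<le> L'"
  shows "conn E V' L' a b"
proof -
  have "conn E V' L a b" using assms(1,2) by (induction L arbitrary: a) auto
  then have "conn E V' (L + k) a b" for k by (induction k) auto
  from this[of "L' - L"] show ?thesis using assms(3) by simp
qed

lemma conn_ends: "conn E V L a b \<Longrightarrow> a \<in> V \<and> b \<in> V"
  by (induction L arbitrary: a) auto

lemma conn_refl: "a \<in> V \<Longrightarrow> conn E V L a a"
  by (rule conn_mono[of _ _ 0]) auto

lemma conn_trans: "conn E V L a b \<Longrightarrow> conn E V L' b c \<Longrightarrow> conn E V (L + L') a c"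
proof (induction L arbitrary: a)
  case (Suc L)
  then show ?case by auto
qed auto

lemma conn_edge: "{a, b} \<in> E \<Longrightarrow> a \<in> V \<Longrightarrow> b \<in> V \<Longrightarrow> conn E V 1 a b"
  by auto

lemma conn_sym: "conn E V L a b \<Longrightarrow> conn E V L b a"
proof (induction L arbitrary: a)
  case (Suc L)
  consider "conn E V L a b" | c where "a \<in> V" "{a, c} \<in> E" "conn E V L c b"
    using Suc.prems by auto
  then show ?case
  proof cases
    case (2 c)
    then have "c \<in> V" using conn_ends by metis
    with 2 have "conn E V 1 c a" by (intro conn_edge) (auto simp: insert_commute)
    from conn_trans[OF Suc.IH[OF 2(3)] this] show ?thesis by simp
  qed (use Suc.IH in auto)
qed auto

lemma conn_distinct_path:
  assumes "conn E V L a b"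
  shows "\<exists>p. path_from_to E a b p \<and> path_length p \<le> L \<and> set p \<subseteq> V \<and> distinct p"
  using assms
proof (induction L arbitrary: a)
  case 0
  then show ?case
    by (intro exI[of _ "[a]"]) (auto simp: path_from_to_def is_path_def edges_of_single path_length_def)
next
  case (Suc L)
  consider "conn E V L a b" | c where "a \<in> V" "{a, c} \<in> E" "conn E V L c b"
    using Suc.prems by auto
  then show ?case
  proof cases
    case 1
    then show ?thesis using Suc.IH le_SucI by blast
  next
    case (2 c)
    from Suc.IH[OF 2(3)] obtain p where p: "path_from_to E c b p" "path_length p \<le> L"
      "set p \<subseteq> V" "distinct p" by blast
    show ?thesis
    proof (cases "a \<in> set p")
      \<comment> \<open>If the walk returns to \<open>a\<close>, everything before that visit is
        dropped.\<close>
      case True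
      then obtain q r where qr: "p = q @ a # r" by (meson split_list)
      have "edges_of (a # r) \<subseteq> edges_of p"
        unfolding qr by (cases "q = []") (auto simp: edges_of_append)
      then show ?thesis using p qr
        by (intro exI[of _ "a # r"])
           (auto simp: path_from_to_def is_path_def path_length_def split: if_splits)
    next
      case False
      from p(1) obtain p' where p': "p = c # p'"
        unfolding path_from_to_def is_path_def by (cases p) auto
      then show ?thesis using p False 2
        by (intro exI[of _ "a # p"])
           (auto simp: path_from_to_def is_path_def path_length_def edges_of_Cons2)
    qed
  qed
qed

lemma conn_of_path:
  assumes "path_from_to E a b p"
  shows "conn E (set p) (path_length p) a b"
proof -
  have "p \<noteq> [] \<Longrightarrow> edges_of p \<subseteq> E \<Longrightarrow> conn E (set p) (length p - 1) (hd p) (last p)" for p :: "'a list"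
  proof (induction p rule: induct_list012)
    case (3 x y zs)
    then have "conn E (set (y # zs)) (length zs) y (last (y # zs))" by (simp add: edges_of_Cons2)
    then have "conn E (set (x # y # zs)) (length zs) y (last (y # zs))"
      by (rule conn_mono) auto
    then show ?case using 3 by (auto simp: edges_of_Cons2)
  qed auto
  then show ?thesis using assms unfolding path_from_to_def is_path_def path_length_def by auto
qed

lemma graph_dist_le_iff:
  assumes "connected_graph E"
  shows "graph_dist E a b \<le> L \<longleftrightarrow> conn E UNIV L a b"
proof
  assume le: "graph_dist E a b \<le> L"
  have "\<exists>n p. path_from_to E a b p \<and> path_length p = n"
    using assms unfolding connected_graph_def by blast
  from LeastI_ex[OF this] obtain p where "path_from_to E a b p" "path_length p = graph_dist E a b"
    unfolding graph_dist_def by blast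
  then show "conn E UNIV L a b" using conn_of_path conn_mono le by (metis subset_UNIV)
next
  assume "conn E UNIV L a b"
  from conn_distinct_path[OF this] obtain p where "path_from_to E a b p" "path_length p \<le> L" by blast
  then show "graph_dist E a b \<le> L" unfolding graph_dist_def
    by (metis (mono_tags, lifting) Least_le le_trans)
qed

text \<open>The two walks shorten to simple paths on opposite sides of the cut \<open>S\<close>,
  hence disjoint, and the two edges close them to a loop. All simple loops constructed below come
  from here.\<close>

lemma cut_edges_simple_loop:
  assumes "{c, c1} \<in> E" "{c', c1'} \<in> E" "{c, c1} \<noteq> {c', c1'}"
    and "conn E S L c c'" "conn E (- S) L' c1 c1'"
  shows "\<exists>p. simple_loop E p \<and> path_length p \<le> L + L' + 2 \<and> {c, c1} \<in> edges_of p \<and> {c', c1'} \<in> edges_of p"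
proof -
  from conn_distinct_path[OF assms(4)] obtain p where p: "path_from_to E c c' p" "path_length p \<le> L"
    "set p \<subseteq> S" "distinct p" by blast
  from conn_distinct_path[OF conn_sym[OF assms(5)]] obtain q where q: "path_from_to E c1' c1 q"
    "path_length q \<le> L'" "set q \<subseteq> - S" "distinct q" by blast
  have ne: "p \<noteq> []" "q \<noteq> []" using p(1) q(1) by (auto simp: path_from_to_def is_path_def)
  have ends: "hd p = c" "last p = c'" "hd q = c1'" "last q = c1"
    using p q by (auto simp: path_from_to_def)
  have sub: "edges_of p \<subseteq> E" "edges_of q \<subseteq> E"
    using p q by (auto simp: path_from_to_def is_path_def)
  define r where "r = p @ q @ [c]"
  have er: "edges_of r = insert {c', c1'} (insert {c1, c} (edges_of p \<union> edges_of q))"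
    unfolding r_def using ne ends by (auto simp: edges_of_append edges_of_single)
  \<comment> \<open>Both paths can be single vertices only if the two edges coincide; a simple loop
    must have length at least 3.\<close>
  have "length p + length q \<ge> 3"
  proof (rule ccontr)
    assume "\<not> ?thesis"
    moreover have "length p \<noteq> 0" "length q \<noteq> 0" using ne by auto
    ultimately have "length p = Suc 0" "length q = Suc 0" by linarith+
    then have "c = c'" "c1 = c1'" using ends by (auto simp: length_Suc_conv)
    then show False using assms(3) by simp
  qed
  moreover have "distinct (tl r)"
    unfolding r_def using ne ends p q by (cases p) auto
  moreover have "hd r = last r" "r \<noteq> []" unfolding r_def using ne ends by auto
  moreover have "length r = length p + length q + 1" unfolding r_def by simp
  ultimately have "simple_loop E r"
    using assms(1,2) sub er unfolding simple_loop_def is_path_def path_length_def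
    by (auto simp: insert_commute)
  moreover have "path_length r \<le> L + L' + 2"
    using p(2) q(2) \<open>length r = _\<close> ne unfolding path_length_def by (cases p; cases q) auto
  ultimately show ?thesis using er by (intro exI[of _ r]) (auto simp: insert_commute)
qed

text \<open>Equality is included because an edge may lie on no simple loop at all, and because
  \<open>near_cut\<close> must also cover two equal crossing edges.\<close>

definition near :: "'v set set \<Rightarrow> nat \<Rightarrow> 'v set \<Rightarrow> 'v set \<Rightarrow> bool" where
  "near E L e e' \<longleftrightarrow> e = e' \<or>
     (\<exists>p. simple_loop E p \<and> path_length p \<le> L \<and> e \<in> edges_of p \<and> e' \<in> edges_of p)"

lemma near_sym: "near E L e e' \<Longrightarrow> near E L e' e"
  unfolding near_def by auto

lemma near_cut:
  assumes "{c, c1} \<in> E" "{c', c1'} \<in> E"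
    and "conn E S L c c'" "conn E (- S) L' c1 c1'" "L + L' + 2 \<le> K"
  shows "near E K {c, c1} {c', c1'}"
  using cut_edges_simple_loop[OF assms(1,2) _ assms(3,4)] assms(5) unfolding near_def
  by (meson le_trans)

lemma finite_edges_of: "finite (edges_of p)" and card_edges_of: "card (edges_of p) \<le> path_length p"
proof -
  have "edges_of p = (\<lambda>i. {p ! i, p ! Suc i}) ` {i. Suc i < length p}" (is "_ = _ ` ?I")
    by (auto simp: edges_of_def)
  moreover have "?I = {..<length p - 1}" by auto
  ultimately show "finite (edges_of p)" "card (edges_of p) \<le> path_length p"
    using card_image_le[of "{..<length p - 1}" "\<lambda>i. {p ! i, p ! Suc i}"]
    by (auto simp: path_length_def)
qed

text \<open>The ball of radius \<open>k\<close> in the graph whose vertices are edges and whose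
  adjacency is \<open>near\<close>. Crossing edges are often linked only by a chain of loops, of a
  length depending on \<open>D\<close> alone.\<close>

primrec reach :: "'v set set \<Rightarrow> nat \<Rightarrow> nat \<Rightarrow> 'v set \<Rightarrow> 'v set set" where
  "reach E L 0 e = {e}"
| "reach E L (Suc k) e = (\<Union>e' \<in> {e'. near E L e e'}. reach E L k e')"

lemma UN_bound:
  assumes "finite T" "card T \<le> M" "\<And>e. e \<in> T \<Longrightarrow> finite (f e) \<and> card (f e) \<le> N"
  shows "finite (\<Union>e\<in>T. f e)" "card (\<Union>e\<in>T. f e) \<le> M * N"
proof -
  show "finite (\<Union>e\<in>T. f e)" using assms by blast
  have "card (\<Union>e\<in>T. f e) \<le> (\<Sum>e\<in>T. card (f e))" by (rule card_UN_le[OF assms(1)])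
  also have "\<dots> \<le> (\<Sum>e\<in>T. N)" by (rule sum_mono) (use assms(3) in blast)
  also have "\<dots> \<le> M * N" using assms(2) by simp
  finally show "card (\<Union>e\<in>T. f e) \<le> M * N" .
qed

text \<open>At most \<open>f L\<close> loops pass through \<open>e\<close>, each with at most
  \<open>L\<close> edges; the summand \<open>1\<close> counts \<open>e\<close> itself.\<close>

lemma uniformly_fine_nb_bound:
  assumes "uniformly_fine_graph E"
  shows "\<exists>N::nat. \<forall>e\<in>E. finite {e'. near E L e e'} \<and> card {e'. near E L e e'} \<le> N"
proof -
  from assms obtain f where f: "\<And>e L. e \<in> E \<Longrightarrow> finite (loops_through E e L)"
    "\<And>e L. e \<in> E \<Longrightarrow> card (loops_through E e L) \<le> f L"
    unfolding uniformly_fine_graph_def fine_graph_def by blast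
  show ?thesis
  proof (intro exI[of _ "1 + f L * L"] ballI conjI)
    fix e assume e: "e \<in> E"
    have eq: "{e'. near E L e e'} = insert e (\<Union>p\<in>loops_through E e L. edges_of p)"
      unfolding near_def loops_through_def by auto
    show "finite {e'. near E L e e'}" unfolding eq using f e finite_edges_of by blast
    have "card (\<Union>p\<in>loops_through E e L. edges_of p) \<le> f L * L"
    proof (rule UN_bound(2)[OF f[OF e]])
      fix p assume "p \<in> loops_through E e L"
      then have "path_length p \<le> L" unfolding loops_through_def by simp
      then show "finite (edges_of p) \<and> card (edges_of p) \<le> L"
        using finite_edges_of card_edges_of[of p] by auto
    qed
    then show "card {e'. near E L e e'} \<le> 1 + f L * L"
      unfolding eq using card_insert_le_m1
      by (metis (no_types, lifting) Suc_eq_plus1_left card.infinite card_insert_if finite_insert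
            le_SucI not_less_eq_eq zero_le)
  qed
qed

lemma near_in: "near E L e e' \<Longrightarrow> e \<in> E \<Longrightarrow> e' \<in> E"
  unfolding near_def simple_loop_def is_path_def by auto

lemma reach_bound:
  assumes "uniformly_fine_graph E"
  shows "\<exists>N::nat. \<forall>e\<in>E. finite (reach E L k e) \<and> card (reach E L k e) \<le> N"
proof (induction k)
  case 0
  then show ?case by (intro exI[of _ 1]) auto
next
  case (Suc k)
  then obtain N where N: "\<And>e. e \<in> E \<Longrightarrow> finite (reach E L k e) \<and> card (reach E L k e) \<le> N"
    by blast
  from uniformly_fine_nb_bound[OF assms] obtain M where
    M: "\<And>e. e \<in> E \<Longrightarrow> finite {e'. near E L e e'} \<and> card {e'. near E L e e'} \<le> M" by blast
  have "finite (reach E L (Suc k) e) \<and> card (reach E L (Suc k) e) \<le> M * N" if e: "e \<in> E" for e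
    unfolding reach.simps by (intro conjI UN_bound) (use M[OF e] N e near_in in blast)+
  then show ?case by blast
qed

lemma reach_refl: "e \<in> reach E L k e"
  by (induction k) (auto simp: near_def)

lemma reach_nb: "near E L e e' \<Longrightarrow> e'' \<in> reach E L k e' \<Longrightarrow> e'' \<in> reach E L (Suc k) e"
  by auto

lemma reach_mono: "e' \<in> reach E L k e \<Longrightarrow> k \<le> k' \<Longrightarrow> e' \<in> reach E L k' e"
proof -
  have "e' \<in> reach E L k e \<Longrightarrow> e' \<in> reach E L (Suc k) e" for k
    by (rule reach_nb) (auto simp: near_def)
  then have "e' \<in> reach E L k e \<Longrightarrow> e' \<in> reach E L (k + j) e" for j
    by (induction j) auto
  then show "e' \<in> reach E L k e \<Longrightarrow> k \<le> k' \<Longrightarrow> e' \<in> reach E L k' e"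
    using le_add_diff_inverse by metis
qed

lemma reach_snoc: "e' \<in> reach E L k e \<Longrightarrow> near E L e' e'' \<Longrightarrow> e'' \<in> reach E L (Suc k) e"
proof (induction k arbitrary: e)
  case 0
  then show ?case by simp
next
  case (Suc k)
  from Suc.prems(1) obtain e1 where "near E L e e1" "e' \<in> reach E L k e1" by auto
  with Suc.IH[of e1] Suc.prems(2) show ?case using reach_nb by metis
qed


section \<open>Hyperbolic geometry of a graph\<close>

lemma path_append:
  assumes "path_from_to E a b p" "path_from_to E b c q"
  shows "path_from_to E a c (p @ tl q)" "path_length (p @ tl q) = path_length p + path_length q"
    "set (p @ tl q) = set p \<union> set q"
proof -
  from assms obtain q' where q: "q = b # q'" "p \<noteq> []" "last p = b"
    unfolding path_from_to_def is_path_def by (cases q) auto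
  have "edges_of (p @ q') \<subseteq> E"
  proof (cases "q' = []")
    case False
    then obtain x r where "q' = x # r" by (cases q') auto
    with assms q show ?thesis
      by (auto simp: path_from_to_def is_path_def edges_of_append edges_of_Cons2)
  qed (use assms q in \<open>auto simp: path_from_to_def is_path_def\<close>)
  with assms q show "path_from_to E a c (p @ tl q)"
    by (auto simp: path_from_to_def is_path_def split: if_splits)
  show "path_length (p @ tl q) = path_length p + path_length q"
    using q by (cases p) (auto simp: path_length_def)
  show "set (p @ tl q) = set p \<union> set q" using q by auto
qed

locale fine_hyperbolic =
  fixes E :: "'v set set"
  assumes simple: "simple_graph E"
    and ufine: "uniformly_fine_graph E"
    and hyp: "hyperbolic_graph E"
begin

abbreviation d :: "'v \<Rightarrow> 'v \<Rightarrow> nat" where "d \<equiv> graph_dist E"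

abbreviation btw :: "'v \<Rightarrow> 'v \<Rightarrow> 'v \<Rightarrow> bool" where
  "btw x a y \<equiv> d x a + d a y = d x y"

lemma con: "connected_graph E" using hyp unfolding hyperbolic_graph_def by blast

lemma d_le_iff: "d a b \<le> L \<longleftrightarrow> conn E UNIV L a b"
  using graph_dist_le_iff[OF con] .

lemma d_conn: "conn E V L a b \<Longrightarrow> d a b \<le> L"
  unfolding d_le_iff by (erule conn_mono) auto

lemma d_0 [simp]: "d a b = 0 \<longleftrightarrow> a = b"
  using d_le_iff[of a b 0] by simp

lemma d_self [simp]: "d a a = 0" by simp

lemma d_sym: "d a b = d b a"
  using d_le_iff conn_sym by (metis le_antisym order_refl)

lemma d_tri: "d a c \<le> d a b + d b c"
  using d_le_iff conn_trans by (metis order_refl)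

lemma edge_iff: "{a, b} \<in> E \<longleftrightarrow> d a b = 1"
proof
  assume e: "{a, b} \<in> E"
  then have "card {a, b} = 2" using simple unfolding simple_graph_def by blast
  then have "a \<noteq> b" by auto
  moreover have "d a b \<le> 1" using d_conn[OF conn_edge[OF e, of UNIV]] by simp
  ultimately show "d a b = 1" using d_0[of a b] by linarith
next
  assume *: "d a b = 1"
  then have "conn E UNIV 1 a b" using d_le_iff[of a b 1] by simp
  with * show "{a, b} \<in> E" by auto
qed

lemma d_step: assumes "d a b = Suc k" shows "\<exists>c. d a c = 1 \<and> d c b = k"
proof -
  have "conn E UNIV (Suc k) a b" using d_le_iff[of a b "Suc k"] assms by simp
  moreover have "\<not> conn E UNIV k a b" using d_le_iff[of a b k] assms by simp
  ultimately obtain c where c: "{a, c} \<in> E" "conn E UNIV k c b" by auto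
  have "d a c = 1" "d c b \<le> k" using c edge_iff d_le_iff by auto
  moreover have "d a b \<le> d a c + d c b" by (rule d_tri)
  ultimately show ?thesis using assms by (intro exI[of _ c]) auto
qed

lemma point_at: "k \<le> d a b \<Longrightarrow> \<exists>c. d a c = k \<and> btw a c b"
proof (induction k arbitrary: a)
  case (Suc k)
  then obtain j where j: "d a b = Suc j" by (cases "d a b") auto
  then obtain e where e: "d a e = 1" "d e b = j" using d_step by blast
  with Suc j obtain c where c: "d e c = k" "btw e c b" by fastforce
  have "d a c \<le> d a e + d e c" "d a b \<le> d a c + d c b" by (rule d_tri)+
  then show ?case using c e j by (intro exI[of _ c]) auto
qed auto

lemma next_point: "a \<noteq> b \<Longrightarrow> \<exists>c. d a c = 1 \<and> btw a c b"
  using point_at[of 1 a b] d_0[of a b] by (metis One_nat_def Suc_leI neq0_conv)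

lemma btw_sym: "btw x a y \<longleftrightarrow> btw y a x"
  using d_sym[of x a] d_sym[of a y] d_sym[of x y] by linarith

lemma btw_left: "btw x b y \<Longrightarrow> btw x a b \<Longrightarrow> btw x a y \<and> btw a b y"
  using d_tri[of x y a] d_tri[of a y b] by linarith

lemma btw_right: "btw x b y \<Longrightarrow> btw b a y \<Longrightarrow> btw x a y \<and> btw x b a"
  using d_tri[of x y a] d_tri[of x a b] by linarith

lemma conn_geo:
  assumes "\<And>w. btw a w b \<Longrightarrow> w \<in> V" "d a b \<le> L"
  shows "conn E V L a b"
proof -
  have "conn E {w. btw a w b} (d a b) a b"
  proof (induction "d a b" arbitrary: a)
    case 0
    then show ?case using d_0[of a b] by simp
  next
    case (Suc k)
    then obtain c where c: "d a c = 1" "d c b = k" using d_step by metis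
    have "conn E {w. btw c w b} k c b" using Suc.hyps(1)[of c] c by simp
    moreover have "{w. btw c w b} \<subseteq> {w. btw a w b}"
    proof (intro subsetI CollectI)
      fix w assume "w \<in> {w. btw c w b}"
      then show "btw a w b" using btw_right[of a c b w] c Suc.hyps(2) by simp
    qed
    ultimately have "conn E {w. btw a w b} k c b" by (rule conn_mono) auto
    then show ?case using c Suc.hyps(2)[symmetric] edge_iff[of a c] by auto
  qed
  then show ?thesis by (rule conn_mono) (use assms in auto)
qed

lemma geodesic_through:
  assumes "btw x a y" shows "\<exists>p. geodesic E x y p \<and> a \<in> set p"
proof -
  have "\<exists>p. path_from_to E u v p \<and> path_length p \<le> d u v" for u v
    using conn_distinct_path d_le_iff by (metis order_refl)
  then obtain p q where p: "path_from_to E x a p" "path_length p \<le> d x a"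
    and q: "path_from_to E a y q" "path_length q \<le> d a y" by meson
  note pq = path_append[OF p(1) q(1)]
  have "d x y \<le> path_length (p @ tl q)"
    using d_conn[OF conn_of_path[OF pq(1)]] .
  then have "geodesic E x y (p @ tl q)"
    unfolding geodesic_def using pq p q assms by auto
  moreover have "a \<in> set (p @ tl q)"
    using p unfolding path_from_to_def is_path_def by auto
  ultimately show ?thesis by blast
qed

lemma geodesic_btw:
  assumes "geodesic E y z q" "b \<in> set q" shows "btw y b z"
proof -
  from assms(2) obtain u v where uv: "q = u @ b # v" by (meson split_list)
  have q: "path_from_to E y z q" "path_length q = d y z" using assms by (auto simp: geodesic_def)
  have "edges_of (b # v) \<subseteq> edges_of q"
    unfolding uv by (cases "u = []") (auto simp: edges_of_append)
  moreover have "edges_of (u @ [b]) \<subseteq> edges_of q"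
  proof (cases v)
    case (Cons w v')
    then have "q = (u @ [b]) @ (w # v')" using uv by simp
    then show ?thesis by (auto simp: edges_of_append simp del: append_assoc)
  qed (simp add: uv)
  ultimately have "path_from_to E y b (u @ [b])" "path_from_to E b z (b # v)"
    using q uv by (auto simp: path_from_to_def is_path_def hd_append split: if_splits)
  from d_conn[OF conn_of_path[OF this(1)]] d_conn[OF conn_of_path[OF this(2)]]
  have "d y b \<le> length u" "d b z \<le> length v" by (auto simp: path_length_def)
  moreover have "d y z = length u + length v" using q uv by (simp add: path_length_def)
  ultimately show ?thesis using d_tri[of y z b] by linarith
qed

text \<open>An integral thinness constant, phrased by betweenness so that geodesic paths can be
  forgotten. The integer part of the hyperbolicity constant is a witness, as \<open>thin\<close>
  shows.\<close>

definition D :: nat where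
  "D = (SOME D. \<forall>x y z a. btw x a y \<longrightarrow> (\<exists>b. (btw y b z \<or> btw z b x) \<and> d a b \<le> D))"

lemma thin: "btw x a y \<Longrightarrow> \<exists>b. (btw y b z \<or> btw z b x) \<and> d a b \<le> D"
proof -
  obtain \<delta> where \<delta>: "delta_hyperbolic E \<delta>" using hyp unfolding hyperbolic_graph_def by blast
  have "\<forall>x y z a. btw x a y \<longrightarrow> (\<exists>b. (btw y b z \<or> btw z b x) \<and> d a b \<le> nat \<lfloor>\<delta>\<rfloor>)"
  proof (intro allI impI)
    fix x y z a assume "btw x a y"
    then obtain p where p: "geodesic E x y p" "a \<in> set p" using geodesic_through by blast
    obtain q r where "geodesic E y z q" "geodesic E z x r"
      using geodesic_through[of y y z] geodesic_through[of z z x] by auto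
    with \<delta> p obtain b where "b \<in> set q \<union> set r" "real (d a b) \<le> \<delta>"
      unfolding delta_hyperbolic_def by blast
    moreover from this have "d a b \<le> nat \<lfloor>\<delta>\<rfloor>" by (simp add: le_nat_floor)
    ultimately show "\<exists>b. (btw y b z \<or> btw z b x) \<and> d a b \<le> nat \<lfloor>\<delta>\<rfloor>"
      using \<open>geodesic E y z q\<close> \<open>geodesic E z x r\<close> geodesic_btw by blast
  qed
  then have "\<forall>x y z a. btw x a y \<longrightarrow> (\<exists>b. (btw y b z \<or> btw z b x) \<and> d a b \<le> D)"
    unfolding D_def by (rule someI)
  then show "btw x a y \<Longrightarrow> \<exists>b. (btw y b z \<or> btw z b x) \<and> d a b \<le> D" by blast
qed

text \<open>Descend from \<open>c\<close> by \<open>K + D + 1\<close> towards \<open>x\<close>,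
  cross the thin triangle \<open>x\<close>, \<open>c\<close>, \<open>c'\<close> within distance
  \<open>D\<close>, and climb to \<open>c'\<close>; the depth leaves room for the crossing. If
  \<open>c\<close> is close to \<open>x\<close>, the way through \<open>x\<close> is short
  enough.\<close>

lemma inner_conn:
  assumes "d x c \<le> r" "d x c' \<le> r" "d c c' \<le> K"
  shows "conn E {u. d x u \<le> r} (4 * K + 4 * D + 4) c c'"
proof (cases "d x c \<le> K + D + 1")
  case True
  have "conn E {u. d x u \<le> r} (d c x) c x"
  proof (rule conn_geo)
    fix w assume "btw c w x"
    then show "w \<in> {u. d x u \<le> r}" using assms(1) d_sym[of w x] d_sym[of c x] by simp
  qed simp
  moreover have "conn E {u. d x u \<le> r} (d x c') x c'"
  proof (rule conn_geo)
    fix w assume "btw x w c'"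
    then show "w \<in> {u. d x u \<le> r}" using assms(2) by simp
  qed simp
  ultimately have "conn E {u. d x u \<le> r} (d c x + d x c') c c'" by (rule conn_trans)
  moreover have "d c x + d x c' \<le> 4 * K + 4 * D + 4"
    using True assms(3) d_tri[of x c' c] d_sym[of c x] by linarith
  ultimately show ?thesis by (rule conn_mono[OF _ order_refl])
next
  case False
  then obtain a where a: "d c a = K + D + 1" "btw c a x"
    using point_at[of "K + D + 1" c x] d_sym[of c x] by auto
  from thin[of x a c c'] a obtain b where b: "btw c b c' \<or> btw c' b x" "d a b \<le> D"
    using btw_sym by blast
  have sy: "d x a = d a x" "d x b = d b x" "d x c = d c x" "d x c' = d c' x" "d b a = d a b" "d c' b = d b c'"
    by (rule d_sym)+
  \<comment> \<open>A vertex between \<open>c\<close> and \<open>c'\<close> is at most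
    \<open>K\<close> away from \<open>c\<close>, whereas \<open>a\<close> is
    \<open>K + D + 1\<close> away and \<open>b\<close> is within \<open>D\<close> of
    \<open>a\<close>.\<close>
  have "\<not> btw c b c'"
    using a b(2) assms(3) d_tri[of c a b] sy by linarith
  with b have b': "btw c' b x" by blast
  have "conn E {u. d x u \<le> r} (K + D + 1) c a"
  proof (rule conn_geo)
    fix w assume "btw c w a"
    then have "btw c w x" using btw_left a by blast
    then show "w \<in> {u. d x u \<le> r}" using assms(1) sy d_sym[of w x] by auto
  qed (use a in simp)
  moreover have "conn E {u. d x u \<le> r} D a b"
  proof (rule conn_geo)
    fix w assume "btw a w b"
    then have "d a w \<le> D" using b by linarith
    then show "w \<in> {u. d x u \<le> r}" using d_tri[of x w a] a assms(1) sy by auto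
  qed (use b in simp)
  moreover have "conn E {u. d x u \<le> r} (3 * K + 2 * D + 1) b c'"
  proof (rule conn_geo)
    fix w assume "btw b w c'"
    then have "btw c' w b" using btw_sym by blast
    then have "btw c' w x" using btw_left b' by blast
    then show "w \<in> {u. d x u \<le> r}" using assms(2) sy d_sym[of w x] by auto
  next
    have "d b c' \<le> d b a + d a c + d c c'" using d_tri[of b c' a] d_tri[of a c' c] by linarith
    then show "d b c' \<le> 3 * K + 2 * D + 1" using a b assms sy d_sym[of a c] by linarith
  qed
  ultimately have "conn E {u. d x u \<le> r} (K + D + 1 + D + (3 * K + 2 * D + 1)) c c'"
    by (rule conn_trans[OF conn_trans])
  then show ?thesis by (rule conn_mono) auto
qed

text \<open>A thin triangle puts \<open>b\<close> within \<open>D\<close> of a vertex in line with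
  \<open>x\<close> and \<open>c\<close>, whose distance to \<open>c\<close> is a difference of
  levels. One \<open>D\<close> pays for the jump, the other for the change of level it
  causes.\<close>

lemma level_dist:
  assumes "btw x b y" "btw x c y"
  shows "d b c \<le> (d x b - d x c) + (d x c - d x b) + 2 * D"
proof -
  from thin[of x b y c] assms obtain b' where b': "btw y b' c \<or> btw c b' x" "d b b' \<le> D" by blast
  have "btw x c b' \<or> btw x b' c"
    using b'(1) assms(2) btw_sym btw_left by blast
  then have "d c b' = (d x b' - d x c) + (d x c - d x b')" using d_sym[of c b'] by linarith
  moreover have "d x b' \<le> d x b + D" "d x b \<le> d x b' + D"
    using d_tri[of x b' b] d_tri[of x b b'] b'(2) d_sym[of b b'] by linarith+
  ultimately show ?thesis using d_tri[of b c b'] d_sym[of b' c] b'(2) by linarith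
qed

text \<open>No geodesic from \<open>y\<close> to \<open>v\<close> enters the open ball of radius
  \<open>m\<close> about \<open>x\<close>. Requiring this of all geodesics makes the relation
  symmetric and lets it pass to subsegments.\<close>

definition sees :: "'v \<Rightarrow> nat \<Rightarrow> 'v \<Rightarrow> 'v \<Rightarrow> bool" where
  "sees x m y v \<longleftrightarrow> (\<forall>u. btw y u v \<longrightarrow> m \<le> d x u)"

lemma sees_sym: "sees x m y v \<longleftrightarrow> sees x m v y"
  unfolding sees_def using btw_sym by blast

lemma sees_level: "sees x m y v \<Longrightarrow> m \<le> d x y \<and> m \<le> d x v"
  unfolding sees_def by (metis add.right_neutral add.left_neutral d_self)

lemma sees_refl: "m \<le> d x y \<Longrightarrow> sees x m y y"
  unfolding sees_def
proof (intro allI impI)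
  fix u assume "m \<le> d x y" "btw y u y"
  then have "d y u = 0" by (simp del: d_0)
  then show "m \<le> d x u" using \<open>m \<le> d x y\<close> by simp
qed

lemma sees_sub: "sees x m y v \<Longrightarrow> btw y w v \<Longrightarrow> sees x m w v"
  unfolding sees_def using btw_right by blast

text \<open>At depth \<open>D + 1\<close> below \<open>c\<close>, the thin triangle
  \<open>x\<close>, \<open>y\<close>, \<open>y'\<close> cannot lead to the side from
  \<open>y\<close> to \<open>y'\<close>, which stays outside the ball. So it leads to a geodesic
  from \<open>x\<close> to \<open>y'\<close>, where \<open>level_dist\<close> compares with
  \<open>c'\<close>.\<close>

lemma outer_dist:
  assumes "sees x m y y'" "btw x c y" "d x c = m" "btw x c' y'" "d x c' = m"
  shows "d c c' \<le> 6 * D + 2"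
proof (cases "m \<le> D + 1")
  case True
  then show ?thesis using d_tri[of c c' x] d_sym[of c x] assms by linarith
next
  case False
  then obtain a where a: "d x a = m - D - 1" "btw x a c"
    using point_at[of "m - D - 1" x c] assms(3) by auto
  then have "btw x a y" using btw_left assms(2) by blast
  from thin[OF this, of y'] obtain b where b: "btw y b y' \<or> btw y' b x" "d a b \<le> D" by blast
  have lb: "d x b \<le> m - 1" "m \<le> d x b + 2 * D + 1"
    using d_tri[of x b a] d_tri[of x a b] d_sym[of a b] a b(2) False by linarith+
  have "\<not> btw y b y'" using assms(1) lb False unfolding sees_def by force
  with b have "btw x b y'" using btw_sym by blast
  from level_dist[OF this assms(4)] have "d b c' \<le> 4 * D + 1"
    using lb assms(5) by linarith
  moreover have "d c a = D + 1" using a assms(3) d_sym[of c a] False by linarith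
  ultimately show ?thesis using d_tri[of c c' a] d_tri[of a c' b] b(2) by linarith
qed

text \<open>Climb from \<open>c'\<close> by \<open>D\<close> towards \<open>y'\<close>, or to
  \<open>y'\<close> itself if that is nearer. From this height the crossing of the triangle
  \<open>x\<close>, \<open>y'\<close>, \<open>z\<close> stays outside the ball, and the side it
  meets leads to \<open>z\<close>.\<close>

lemma outer_aux:
  assumes "sees x m z y'" "btw x c' y'" "d x c' = m" "d c' z \<le> K"
  shows "conn E {u. m \<le> d x u} (4 * D + K) c' z"
proof -
  obtain s where s: "d c' s = min D (d c' y')" "btw c' s y'"
    using point_at[of "min D (d c' y')" c' y'] by auto
  have xs: "btw x s y'" "btw x c' s" using btw_right assms(2) s(2) by blast+
  have "conn E {u. m \<le> d x u} D c' s"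
  proof (rule conn_geo)
    fix w assume "btw c' w s"
    from btw_right[OF xs(2) this] show "w \<in> {u. m \<le> d x u}" using assms(3) by simp
  qed (use s in simp)
  moreover have "\<exists>b. conn E {u. m \<le> d x u} D s b \<and> conn E {u. m \<le> d x u} (2 * D + K) b z"
  proof (cases "d c' y' \<le> D")
    case True
    then have "s = y'" using s d_0[of s y'] by simp
    have "m \<le> d x y'" using assms(2,3) by linarith
    moreover have "conn E {u. m \<le> d x u} (2 * D + K) y' z"
    proof (rule conn_geo)
      show "d y' z \<le> 2 * D + K" using d_tri[of y' z c'] True assms(4) d_sym[of y' c'] by linarith
    next
      show "w \<in> {u. m \<le> d x u}" if "btw y' w z" for w
        using assms(1) that btw_sym unfolding sees_def by blast
    qed
    ultimately show ?thesis using \<open>s = y'\<close> conn_refl by (metis mem_Collect_eq)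
  next
    case False
    then have ls: "d x s = m + D" "d c' s = D" using s xs(2) assms(3) by auto
    from thin[OF xs(1), of z] obtain b where b: "btw y' b z \<or> btw z b x" "d s b \<le> D" by blast
    have lb: "m \<le> d x b" using d_tri[of x s b] ls b(2) d_sym[of s b] by linarith
    have "conn E {u. m \<le> d x u} D s b"
    proof (rule conn_geo)
      fix w assume "btw s w b"
      then have "d s w \<le> D" using b(2) by linarith
      then show "w \<in> {u. m \<le> d x u}" using d_tri[of x s w] ls d_sym[of s w] by auto
    qed (rule b)
    moreover have "conn E {u. m \<le> d x u} (2 * D + K) b z"
    proof (rule conn_geo)
      show "d b z \<le> 2 * D + K"
        using d_tri[of b z s] d_tri[of s z c'] b(2) ls assms(4) d_sym[of b s] d_sym[of s c'] by linarith
    next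
      fix w assume w: "btw b w z"
      show "w \<in> {u. m \<le> d x u}"
        using b(1)
      proof
        assume "btw y' b z"
        then have "btw y' w z" using w btw_right by blast
        then show ?thesis using assms(1) btw_sym unfolding sees_def by blast
      next
        assume "btw z b x"
        then have "btw x b z" using btw_sym by blast
        then have "btw x b w" using w btw_right by blast
        then show ?thesis using lb by auto
      qed
    qed
    ultimately show ?thesis by blast
  qed
  ultimately have "conn E {u. m \<le> d x u} (D + D + (2 * D + K)) c' z"
    by (elim exE conjE) (rule conn_trans[OF conn_trans])
  then show ?thesis by (rule conn_mono) auto
qed

text \<open>The length is \<open>D\<close> up from \<open>c\<close>, \<open>D\<close> across to a
  vertex \<open>z\<close> that still sees \<open>y'\<close>, and \<open>4 * D + (8 * D + 2)\<close>
  from \<open>z\<close> to \<open>c'\<close> by \<open>outer_aux\<close>.\<close>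

lemma outer_conn:
  assumes "sees x m y y'" "btw x c y" "d x c = m" "btw x c' y'" "d x c' = m"
  shows "conn E {u. m \<le> d x u} (14 * D + 2) c c'"
proof -
  have K: "d c c' \<le> 6 * D + 2" by (rule outer_dist[OF assms])
  obtain s where s: "d c s = min D (d c y)" "btw c s y"
    using point_at[of "min D (d c y)" c y] by auto
  have xs: "btw x s y" "btw x c s" using btw_right assms(2) s(2) by blast+
  have cs: "conn E {u. m \<le> d x u} D c s"
  proof (rule conn_geo)
    fix w assume "btw c w s"
    from btw_right[OF xs(2) this] show "w \<in> {u. m \<le> d x u}" using assms(3) by simp
  qed (use s in simp)
  have "\<exists>z. conn E {u. m \<le> d x u} D s z \<and> sees x m z y' \<and> d s z \<le> D"
  proof (cases "d c y \<le> D")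
    case True
    then have "s = y" using s d_0[of s y] by simp
    then show ?thesis using assms(1) sees_level[OF assms(1)]
      by (intro exI[of _ y]) (auto intro: conn_refl)
  next
    case False
    then have ls: "d x s = m + D" using s xs(2) assms(3) by auto
    from thin[OF xs(1), of y'] obtain b where b: "btw y b y' \<or> btw y' b x" "d s b \<le> D" by blast
    have lb: "m \<le> d x b" using d_tri[of x s b] ls b(2) d_sym[of s b] by linarith
    have "conn E {u. m \<le> d x u} D s b"
    proof (rule conn_geo)
      fix w assume "btw s w b"
      then have "d s w \<le> D" using b(2) by linarith
      then show "w \<in> {u. m \<le> d x u}" using d_tri[of x s w] ls d_sym[of s w] by auto
    qed (rule b)
    moreover have "sees x m b y'"
      using b(1)
    proof
      assume "btw y b y'" then show ?thesis using assms(1) sees_sub by blast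
    next
      assume "btw y' b x"
      then have *: "btw x b y'" using btw_sym by blast
      show ?thesis unfolding sees_def
      proof (intro allI impI)
        fix u assume "btw b u y'"
        then have "btw x b u" using * btw_right by blast
        then show "m \<le> d x u" using lb by linarith
      qed
    qed
    ultimately show ?thesis using b(2) by blast
  qed
  then obtain z where z: "conn E {u. m \<le> d x u} D s z" "sees x m z y'" "d s z \<le> D" by blast
  have "d c' z \<le> 8 * D + 2"
    using d_tri[of c' z c] d_tri[of c z s] K z(3) s(1) d_sym[of c c'] by linarith
  from conn_sym[OF outer_aux[OF z(2) assms(4,5) this]]
  have "conn E {u. m \<le> d x u} (4 * D + (8 * D + 2)) z c'" .
  from conn_trans[OF conn_trans[OF cs z(1)] this]
  show ?thesis by (rule conn_mono) auto
qed

end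


section \<open>Horofunction classes\<close>

lemma reach_trans:
  "e' \<in> reach E L k e \<Longrightarrow> e'' \<in> reach E L j e' \<Longrightarrow> e'' \<in> reach E L (k + j) e"
proof (induction k arbitrary: e)
  case (Suc k)
  from Suc.prems(1) obtain e1 where "near E L e e1" "e' \<in> reach E L k e1" by auto
  with Suc.IH[of e1] Suc.prems(2) reach_nb show ?case by (metis add_Suc)
qed auto

context fine_hyperbolic
begin

text \<open>The functions \<open>d a - d a x\<close> and \<open>d b - d b x\<close> agree on the ball of radius \<open>m\<close> about \<open>x\<close>; the
  subtractions are moved to the other side because distances are natural numbers.\<close>

definition hclass :: "'v \<Rightarrow> nat \<Rightarrow> 'v \<Rightarrow> 'v set" where
  "hclass x m a = {b. \<forall>u. d x u \<le> m \<longrightarrow> d a u + d b x = d b u + d a x}"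

lemma hclassD: "b \<in> hclass x m a \<Longrightarrow> d x u \<le> m \<Longrightarrow> d a u + d b x = d b u + d a x"
  unfolding hclass_def by blast

lemma hclass_self [simp]: "a \<in> hclass x m a"
  unfolding hclass_def by simp

lemma hclass_sym: "b \<in> hclass x m a \<longleftrightarrow> a \<in> hclass x m b"
  unfolding hclass_def by (auto; metis)

lemma hclass_eqI: assumes "b \<in> hclass x m a" shows "hclass x m b = hclass x m a"
proof -
  have "c \<in> hclass x m a" if "b \<in> hclass x m a" "c \<in> hclass x m b" for a b c
    unfolding hclass_def
  proof (intro CollectI allI impI)
    fix u assume "d x u \<le> m"
    from hclassD[OF that(1) this] hclassD[OF that(2) this]
    show "d a u + d c x = d c u + d a x" by linarith
  qed
  then show ?thesis using assms hclass_sym by blast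
qed

lemma hclass_antimono: "m \<le> m' \<Longrightarrow> hclass x m' a \<subseteq> hclass x m a"
  unfolding hclass_def using le_trans by blast

lemma hclass_0: "hclass x 0 a = UNIV"
  unfolding hclass_def by simp

text \<open>Agreement up to an additive constant does not depend on the normalising point, and the
  ball of radius \<open>n\<close> about \<open>x'\<close> lies in the ball of radius
  \<open>n + d x x'\<close> about \<open>x\<close>.\<close>

lemma hclass_shift: "hclass x (n + d x x') a \<subseteq> hclass x' n a"
proof
  fix b assume b: "b \<in> hclass x (n + d x x') a"
  show "b \<in> hclass x' n a"
    unfolding hclass_def
  proof (intro CollectI allI impI)
    fix u assume "d x' u \<le> n"
    then have "d x u \<le> n + d x x'" using d_tri[of x u x'] by linarith
    from hclassD[OF b this] hclassD[OF b, of x'] show "d a u + d b x' = d b u + d a x'" by simp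
  qed
qed

text \<open>Evaluation at \<open>b\<close> puts \<open>b\<close> between \<open>x\<close> and
  \<open>a\<close>. Evaluation at the point of level \<open>min k (d x a)\<close> on a geodesic from
  \<open>b\<close> to \<open>a\<close> shows that this point is not above \<open>b\<close>. Hence a
  class that meets the open ball is a single vertex.\<close>

lemma hclass_small: assumes "a \<in> hclass x k b" "d x b < k" shows "a = b"
proof -
  have 1: "d b a = d x a - d x b" "d x b \<le> d x a"
    using hclassD[OF assms(1), of b] assms(2) d_sym[of a b] d_sym[of a x] d_sym[of b x] by auto
  then have ba: "btw x b a" by linarith
  obtain u where u: "d x u = min k (d x a)" "btw b u a" "d x u = d x b + d b u"
  proof -
    obtain u where "d b u = min k (d x a) - d x b" "btw b u a"
      using point_at[of "min k (d x a) - d x b" b a] 1 by (metis diff_le_mono min.cobounded2)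
    with btw_right[OF ba, of u] 1 assms(2) that[of u] show ?thesis by (auto simp: min_def split: if_splits)
  qed
  have "d b u + d a x = d a u + d b x" using hclassD[OF assms(1), of u] u by simp
  then have "d x u = d x b"
    using u 1 ba d_sym[of a x] d_sym[of b x] d_sym[of a u] by linarith
  with u(1) assms(2) have "d x a = d x b" by (auto simp: min_def split: if_splits)
  with ba show ?thesis by simp
qed

lemma hclass_level: assumes "b \<in> hclass x m a" "d x a = m" "d x b = m" shows "b = a"
  using hclassD[OF assms(1), of a] assms(2,3) d_sym[of a x] d_sym[of b x] by simp

section \<open>Edges in which geodesics cross a sphere\<close>

definition cross :: "'v \<Rightarrow> nat \<Rightarrow> 'v \<Rightarrow> 'v \<Rightarrow> 'v \<Rightarrow> bool" where
  "cross x m c c1 y \<longleftrightarrow> d x c + 1 = m \<and> d x c1 = m \<and> d c c1 = 1 \<and> btw x c1 y"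

lemma crossD:
  assumes "cross x m c c1 y"
  shows "d x c + 1 = m" "d x c1 = m" "d c c1 = 1" "btw x c1 y" "{c, c1} \<in> E" "btw x c y" "1 \<le> m" "m \<le> d x y"
  using assms edge_iff[of c c1] btw_left[of x c1 y c] unfolding cross_def by auto

lemma cross_extend: assumes "btw x c y" "d x c + 1 = m" "m \<le> d x y" shows "\<exists>c1. cross x m c c1 y"
proof -
  from assms have "c \<noteq> y" by auto
  then obtain c1 where "d c c1 = 1" "btw c c1 y" using next_point by blast
  with btw_right[OF assms(1), of c1] assms show ?thesis unfolding cross_def by (intro exI[of _ c1]) auto
qed

lemma cross_exists: assumes "1 \<le> m" "m \<le> d x y" shows "\<exists>c c1. cross x m c c1 y"
proof -
  have "m - 1 \<le> d x y" using assms by linarith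
  from point_at[OF this] obtain c where "d x c = m - 1" "btw x c y" by blast
  then show ?thesis using cross_extend[of x c y m] assms by auto
qed

text \<open>A generous bound for all loops; the longest one, in the inductive step of
  \<open>chain\<close>, needs \<open>918 * D + 191\<close>.\<close>

definition Lb :: nat where "Lb = 1000 * D + 1000"

abbreviation nbE :: "'v set \<Rightarrow> 'v set \<Rightarrow> bool" where "nbE \<equiv> near E Lb"
abbreviation R :: "nat \<Rightarrow> 'v set \<Rightarrow> 'v set set" where "R \<equiv> reach E Lb"

text \<open>The cut is the ball of radius \<open>m - 1\<close>: \<open>inner_conn\<close> joins the
  lower ends of the two edges inside it, \<open>outer_conn\<close> the upper ends outside.\<close>

lemma sees_nb:
  assumes "sees x m y y'" "cross x m c c1 y" "cross x m c' c1' y'"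
  shows "nbE {c, c1} {c', c1'}"
proof -
  note e = crossD[OF assms(2)] note e' = crossD[OF assms(3)]
  have "d c c' \<le> 6 * D + 4"
    using outer_dist[OF assms(1) e(4,2) e'(4,2)] d_tri[of c c' c1] d_tri[of c1 c' c1'] e(3) e'(3)
      d_sym[of c' c1'] by linarith
  then have "conn E {u. d x u \<le> m - 1} (4 * (6 * D + 4) + 4 * D + 4) c c'"
    by (intro inner_conn) (use e(1) e'(1) in auto)
  moreover have "- {u. d x u \<le> m - 1} = {u. m \<le> d x u}" using e(7) by auto
  with outer_conn[OF assms(1) e(4,2) e'(4,2)]
  have "conn E (- {u. d x u \<le> m - 1}) (14 * D + 2) c1 c1'" by simp
  ultimately show ?thesis by (rule near_cut[OF e(5) e'(5)]) (simp add: Lb_def)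
qed

text \<open>A point in which a geodesic from \<open>y\<close> can first meet the ball. By
  \<open>entry_exists\<close>, the distances from \<open>y\<close> to its entry points determine its
  distances to the whole ball.\<close>

definition entry :: "'v \<Rightarrow> nat \<Rightarrow> 'v \<Rightarrow> 'v \<Rightarrow> bool" where
  "entry x m y w \<longleftrightarrow> d x w = m \<and> (\<forall>t. btw y t w \<and> d x t \<le> m \<longrightarrow> t = w)"

text \<open>Among the points of the ball between \<open>y\<close> and \<open>u\<close>, take one
  closest to \<open>y\<close>. If it were below the sphere, the next vertex towards \<open>y\<close>
  would still be in the ball.\<close>

lemma entry_exists:
  assumes "m \<le> d x y" "d x u \<le> m"
  shows "\<exists>w. entry x m y w \<and> btw y w u"
proof -
  have "d x u \<le> m \<and> btw y u u" using assms(2) by simp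
  from ex_has_least_nat[of "\<lambda>w. d x w \<le> m \<and> btw y w u", OF this, of "d y"]
  obtain w where w: "d x w \<le> m \<and> btw y w u"
    and mi: "\<And>t. d x t \<le> m \<and> btw y t u \<Longrightarrow> d y w \<le> d y t" by blast
  have uniq: "t = w" if "btw y t w" "d x t \<le> m" for t
  proof -
    have "btw y t u" using btw_left w that(1) by blast
    with mi[of t] that show ?thesis using d_0[of t w] by linarith
  qed
  have "d x w = m"
  proof (rule ccontr)
    assume "d x w \<noteq> m"
    then have "d x w < m" using w by simp
    with assms(1) have "w \<noteq> y" by auto
    then obtain t where t: "d w t = 1" "btw w t y" using next_point by blast
    then have "d x t \<le> m" using d_tri[of x t w] \<open>d x w < m\<close> by linarith
    moreover have "btw y t w" using t btw_sym by blast
    ultimately have "t = w" using uniq by blast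
    with t show False by simp
  qed
  with uniq w show ?thesis unfolding entry_def by blast
qed

lemma entry_sees: "entry x m y w \<Longrightarrow> sees x m y w"
  unfolding entry_def sees_def by (metis nle_le)

text \<open>The horofunction of \<open>y\<close> on the ball is determined by its values at the
  entry points of \<open>y\<close>. These are ends of edges near \<open>e\<close>, within
  \<open>6 * D + 2\<close> of the upper end of \<open>e\<close>, so both the candidates and the
  possible values at them are bounded in number.\<close>

lemma class_count:
  "\<exists>N. \<forall>x m e. finite {hclass x m y | y. \<exists>c c1. e = {c, c1} \<and> cross x m c c1 y} \<and>
     card {hclass x m y | y. \<exists>c c1. e = {c, c1} \<and> cross x m c c1 y} \<le> N"
proof -
  from uniformly_fine_nb_bound[OF ufine, of Lb] obtain M where
    M: "\<And>e. e \<in> E \<Longrightarrow> finite {e'. nbE e e'} \<and> card {e'. nbE e e'} \<le> M" by blast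
  define K where "K = 6 * D + 2"
  have "finite {hclass x m y | y. \<exists>c c1. e = {c, c1} \<and> cross x m c c1 y} \<and>
     card {hclass x m y | y. \<exists>c c1. e = {c, c1} \<and> cross x m c c1 y} \<le> (2 * K + 1) ^ (2 * M)"
    (is "finite ?C \<and> card ?C \<le> _") for x m e
  proof (cases "?C = {}")
    case False
    then obtain y0 c c1 where e: "e = {c, c1}" and y0: "cross x m c c1 y0" by blast
    define Y where "Y = {y. cross x m c c1 y}"
    have uniq: "c' = c \<and> c1' = c1" if "e = {c', c1'}" "cross x m c' c1' y" for c' c1' y
    proof -
      have "c \<noteq> c1'" using crossD(1)[OF y0] crossD(2)[OF that(2)] by auto
      then show ?thesis using that(1) e by (auto simp: doubleton_eq_iff)
    qed
    have C: "?C = hclass x m ` Y"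
    proof (intro equalityI subsetI)
      fix B assume "B \<in> ?C"
      then obtain y c' c1' where "B = hclass x m y" "e = {c', c1'}" "cross x m c' c1' y" by blast
      with uniq show "B \<in> hclass x m ` Y" unfolding Y_def by blast
    next
      fix B assume "B \<in> hclass x m ` Y"
      then show "B \<in> ?C" unfolding Y_def using e by blast
    qed
    define W where "W = {w \<in> \<Union>{e'. nbE e e'}. d c1 w \<le> K}"
    have eE: "e \<in> E" using e crossD[OF y0] by simp
    have fin: "finite f \<and> card f \<le> 2" if "f \<in> {e'. nbE e e'}" for f
      using that near_in[of E Lb e f] eE simple unfolding simple_graph_def
      by (metis card.infinite mem_Collect_eq order_refl zero_neq_numeral)
    have finU: "finite (\<Union>{e'. nbE e e'})" using fin M[OF eE] by blast
    have "card (\<Union>f\<in>{e'. nbE e e'}. f) \<le> M * 2" by (rule UN_bound(2)) (use M[OF eE] fin in blast)+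
    then have cU: "card (\<Union>{e'. nbE e e'}) \<le> 2 * M" by (simp add: mult.commute)
    have WU: "W \<subseteq> \<Union>{e'. nbE e e'}" unfolding W_def by blast
    have finW: "finite W" "card W \<le> 2 * M"
      using finite_subset[OF WU finU] card_mono[OF finU WU] cU by auto
    \<comment> \<open>Normalised at \<open>c1\<close> instead of \<open>x\<close>, a horofunction
      takes values between \<open>- K\<close> and \<open>K\<close> on \<open>W\<close>.\<close>
    define G where "G y = restrict (\<lambda>w. int (d y w) - int (d y c1)) W" for y
    have entW: "w \<in> W" if "y \<in> Y" "entry x m y w" for y w
    proof -
      have y: "cross x m c c1 y" using that Y_def by simp
      have w: "sees x m y w" "d x w = m" using that entry_sees entry_def by auto
      then obtain c' c1' where c': "cross x m c' c1' w" using cross_exists crossD(7)[OF y] by blast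
      then have "c1' = w" unfolding cross_def using w by auto
      with sees_nb[OF w(1) y c'] e have "nbE e {c', w}" by simp
      moreover have "d c1 w \<le> K"
        using outer_dist[OF w(1) crossD(4,2)[OF y], of w] w(2) unfolding K_def by simp
      ultimately show ?thesis unfolding W_def by blast
    qed
    \<comment> \<open>At an entry point of \<open>y\<close> on the way to \<open>u\<close>, the
      distances from \<open>y\<close> and from \<open>y'\<close> differ as they do at
      \<open>c1\<close>; the triangle inequality extends this to \<open>u\<close> in one direction,
      and exchanging \<open>y\<close> and \<open>y'\<close> gives the other.\<close>
    have half: "d y' u + d y c1 \<le> d y u + d y' c1" if h: "y \<in> Y" "y' \<in> Y" "G y = G y'" "d x u \<le> m" for y y' u
    proof -
      have "m \<le> d x y" using h crossD(8) Y_def by blast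
      then obtain w where w: "entry x m y w" "btw y w u" using entry_exists h(4) by blast
      then have "w \<in> W" using entW h(1) by blast
      with fun_cong[OF h(3), of w] have "int (d y w) - int (d y c1) = int (d y' w) - int (d y' c1)"
        unfolding G_def by simp
      then have "d y w + d y' c1 = d y' w + d y c1" by linarith
      with w(2) d_tri[of y' u w] show ?thesis by linarith
    qed
    have eq: "hclass x m y = hclass x m y'" if "y \<in> Y" "y' \<in> Y" "G y = G y'" for y y'
    proof -
      have *: "d y' u + d y c1 = d y u + d y' c1" if "d x u \<le> m" for u
        using half[OF \<open>y \<in> Y\<close> \<open>y' \<in> Y\<close> \<open>G y = G y'\<close> that] half[OF \<open>y' \<in> Y\<close> \<open>y \<in> Y\<close> \<open>G y = G y'\<close>[symmetric] that]
        by (rule antisym)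
      have "y \<in> hclass x m y'"
        unfolding hclass_def
      proof (intro CollectI allI impI)
        fix u assume "d x u \<le> m"
        from *[OF this] *[of x] show "d y' u + d y x = d y u + d y' x" by simp
      qed
      then show ?thesis by (rule hclass_eqI)
    qed
    have "G ` Y \<subseteq> PiE W (\<lambda>_. {- int K..int K})"
    proof
      fix h assume "h \<in> G ` Y"
      then obtain y where y: "h = G y" by blast
      have "\<bar>int (d y w) - int (d y c1)\<bar> \<le> int K" if "w \<in> W" for w
        using that d_tri[of y w c1] d_tri[of y c1 w] d_sym[of w c1] unfolding W_def by auto
      then show "h \<in> PiE W (\<lambda>_. {- int K..int K})" unfolding y G_def by (force simp: abs_le_iff)
    qed
    moreover have finP: "finite (PiE W (\<lambda>_. {- int K..int K}))" using finW by (intro finite_PiE) auto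
    ultimately have "finite (G ` Y)" "card (G ` Y) \<le> card (PiE W (\<lambda>_. {- int K..int K}))"
      using finite_subset card_mono by blast+
    moreover have "card (PiE W (\<lambda>_. {- int K..int K})) = (2 * K + 1) ^ card W"
      using finW by (simp add: card_PiE nat_add_distrib nat_mult_distrib algebra_simps)
    moreover have "(2 * K + 1) ^ card W \<le> (2 * K + 1) ^ (2 * M)" using finW by (intro power_increasing) auto
    moreover have "hclass x m ` Y = (\<lambda>h. hclass x m (SOME y. y \<in> Y \<and> G y = h)) ` (G ` Y)"
    proof -
      have "hclass x m (SOME y'. y' \<in> Y \<and> G y' = G y) = hclass x m y" if "y \<in> Y" for y
        using someI[of "\<lambda>y'. y' \<in> Y \<and> G y' = G y" y] that eq by blast
      then show ?thesis unfolding image_image by (intro image_cong) auto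
    qed
    ultimately show ?thesis unfolding C by (metis (no_types, lifting) card_image_le finite_imageI le_trans)
  qed (metis card.empty finite.emptyI zero_le)
  then show ?thesis by blast
qed

section \<open>Walks through entry points that avoid a given vertex\<close>

lemma entry_next:
  assumes "entry x (m - 1) y w" "1 \<le> m" "m \<le> d x y"
  shows "\<exists>w'. d w w' = 1 \<and> d x w' = m \<and> sees x m y w'"
proof -
  have w: "d x w = m - 1" and uniq: "\<And>t. btw y t w \<Longrightarrow> d x t \<le> m - 1 \<Longrightarrow> t = w"
    using assms(1) unfolding entry_def by auto
  have "w \<noteq> y" using w assms(2,3) by auto
  then obtain w' where w': "d w w' = 1" "btw w w' y" using next_point by blast
  then have yw: "btw y w' w" using btw_sym by blast
  have "w' \<noteq> w" using w' by auto
  then have "\<not> d x w' \<le> m - 1" using uniq yw by blast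
  moreover have "d x w' \<le> m" using d_tri[of x w' w] w w' assms(2) by linarith
  moreover have "sees x m y w'" unfolding sees_def
  proof (intro allI impI)
    fix t assume t: "btw y t w'"
    show "m \<le> d x t"
    proof (rule ccontr)
      assume "\<not> m \<le> d x t"
      moreover have "btw y t w" using btw_left yw t by blast
      ultimately have "t = w" using uniq by auto
      with t yw w'(1) d_sym[of w w'] show False by auto
    qed
  qed
  ultimately show ?thesis using w' by (intro exI[of _ w']) auto
qed

text \<open>The walk stays outside the open ball of radius \<open>m\<close> until its last step,
  from \<open>w'\<close> to \<open>w\<close>, so the vertex \<open>w\<close> is the only one of that
  ball that it can meet.\<close>

lemma entry_conn:
  assumes "entry x (m - 1) y w" "cross x m c c1 y" "d x s < m" "s \<noteq> w"
  shows "conn E (- {s}) (14 * D + 3) c1 w"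
proof -
  note e = crossD[OF assms(2)]
  from entry_next[OF assms(1) e(7,8)] obtain w' where w': "d w w' = 1" "d x w' = m" "sees x m y w'"
    by blast
  have "conn E {u. m \<le> d x u} (14 * D + 2) c1 w'"
    using outer_conn[OF w'(3) e(4,2), of w'] w'(2) by simp
  then have "conn E (- {s}) (14 * D + 2) c1 w'" by (rule conn_mono) (use assms(3) in auto)
  moreover have "conn E (- {s}) 1 w' w"
    using assms(3,4) w' by (intro conn_edge) (auto simp: edge_iff d_sym[of w' w])
  ultimately have "conn E (- {s}) (14 * D + 2 + 1) c1 w" by (rule conn_trans)
  then show ?thesis by (simp add: eval_nat_numeral)
qed

lemma entry_cls: assumes "entry x m y w" "q \<in> hclass x m y" shows "entry x m q w"
  unfolding entry_def
proof (intro conjI allI impI)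
  show w: "d x w = m" using assms unfolding entry_def by blast
  fix t assume t: "btw q t w \<and> d x t \<le> m"
  with hclassD[OF assms(2), of t] hclassD[OF assms(2), of w] w have "btw y t w" by linarith
  with t assms(1) show "t = w" unfolding entry_def by blast
qed

lemma cross_ent: assumes "cross x m c c1 y" shows "entry x (m - 1) y c"
  unfolding entry_def
proof (intro conjI allI impI)
  note e = crossD[OF assms]
  show "d x c = m - 1" using e by linarith
  fix t assume t: "btw y t c \<and> d x t \<le> m - 1"
  then have "btw c t y" using btw_sym by blast
  with btw_right[OF e(6)] have "btw x c t" by blast
  with t e(1) have "d c t = 0" by linarith
  then show "t = c" by simp
qed

text \<open>If a class contains no point of the sphere itself, then its points enter the ball
  through at least two points, so that no single point of the ball separates them.\<close>

lemma split_conn: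
  assumes "q \<in> hclass x (m - 1) y" "\<forall>b\<in>hclass x (m - 1) y. d x b \<noteq> m - 1"
    and "cross x m c c1 y" "cross x m c' c1' q" "d x s < m"
  shows "conn E (- {s}) (28 * D + 6) c1 c1'"
proof -
  note e = crossD[OF assms(3)]
  \<comment> \<open>\<open>c\<close> is on the sphere of radius \<open>m - 1\<close> and therefore
    not in the class. A vertex \<open>u\<close> at which its horofunction differs from that of
    \<open>y\<close> leads to an entry point \<open>w\<close> other than \<open>c\<close>.\<close>
  have "c \<notin> hclass x (m - 1) y" using assms(2) e(1) by auto
  then obtain u where u: "d x u \<le> m - 1" "d y u + d c x \<noteq> d c u + d y x"
    unfolding hclass_def by blast
  have ne: "\<not> btw y c u" using u(2) e(6) d_sym[of x c] d_sym[of c y] d_sym[of y x] by linarith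
  obtain w where w: "entry x (m - 1) y w" "btw y w u"
    using entry_exists[of "m - 1" x y u] e u by auto
  have "w \<noteq> c" using ne w by auto
  have ec: "entry x (m - 1) y c" by (rule cross_ent[OF assms(3)])
  \<comment> \<open>Of two different entry points, at least one is not \<open>s\<close>.\<close>
  obtain t where t: "entry x (m - 1) y t" "s \<noteq> t" using ec w \<open>w \<noteq> c\<close> by metis
  have "conn E (- {s}) (14 * D + 3) c1 t" by (rule entry_conn[OF t(1) assms(3,5) t(2)])
  moreover have "conn E (- {s}) (14 * D + 3) t c1'"
    by (rule conn_sym[OF entry_conn[OF entry_cls[OF t(1) assms(1)] assms(4,5) t(2)]])
  ultimately have "conn E (- {s}) (14 * D + 3 + (14 * D + 3)) c1 c1'" by (rule conn_trans)
  then show ?thesis by (rule conn_mono) auto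
qed

text \<open>\<open>c\<close> also lies between \<open>x\<close> and \<open>q\<close>, because the
  horofunctions of \<open>y\<close> and \<open>q\<close> agree there. The cut \<open>{c}\<close>
  gives a loop through the edges from \<open>c\<close> towards \<open>y\<close> and towards
  \<open>q\<close>, with \<open>split_conn\<close> for the walk that avoids \<open>c\<close>; a
  second loop leads to the given crossing edge of \<open>q\<close>.\<close>

lemma split_reach:
  assumes "q \<in> hclass x (m - 1) y" "\<forall>b\<in>hclass x (m - 1) y. d x b \<noteq> m - 1"
    and "cross x m c c1 y" "cross x m c' c1' q"
  shows "{c', c1'} \<in> R 2 {c, c1}"
proof -
  note e = crossD[OF assms(3)] note e' = crossD[OF assms(4)]
  have "d y c + d q x = d q c + d y x" using hclassD[OF assms(1), of c] e(1) by linarith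
  then have "btw x c q" using e(6) d_sym[of x q] d_sym[of x y] d_sym[of c q] d_sym[of c y] by linarith
  from cross_extend[OF this e(1) e'(8)] obtain q1 where q1: "cross x m c q1 q" by blast
  have "conn E {c} 0 c c" by simp
  moreover have "conn E (- {c}) (28 * D + 6) c1 q1"
    by (rule split_conn[OF assms(1-3) q1]) (use e(1) in linarith)
  ultimately have "nbE {c, c1} {c, q1}"
    by (rule near_cut[OF e(5) crossD(5)[OF q1]]) (simp add: Lb_def)
  moreover have "nbE {c, q1} {c', c1'}"
    by (rule sees_nb[OF sees_refl q1 assms(4)]) (rule e'(8))
  ultimately show ?thesis by (auto simp: eval_nat_numeral)
qed


section \<open>Branching of classes\<close>


text \<open>Take a vertex of the open ball between \<open>a\<close> and \<open>b\<close> that is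
  closest to \<open>b\<close>. The target in \<open>cross x m w w' w'\<close> is \<open>w'\<close>
  itself, because the edge need not lie on a geodesic from \<open>x\<close> to
  \<open>b\<close>.\<close>

lemma last_exit:
  assumes "\<not> sees x m a b" "m \<le> d x b"
  shows "\<exists>w w'. btw a w b \<and> w \<noteq> b \<and> cross x m w w' w' \<and> sees x m w' b"
proof -
  from assms(1) obtain u where "btw a u b \<and> d x u < m" unfolding sees_def by (auto simp: not_le)
  from ex_has_least_nat[of "\<lambda>w. btw a w b \<and> d x w < m", OF this, of "\<lambda>w. d w b"]
  obtain w where w: "btw a w b" "d x w < m"
    and mi: "\<And>t. btw a t b \<and> d x t < m \<Longrightarrow> d w b \<le> d t b" by blast
  have "w \<noteq> b" using w assms(2) by auto
  then obtain w' where w': "d w w' = 1" "btw w w' b" using next_point by blast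
  have far: "m \<le> d x t" if "btw w' t b" for t
  proof (rule ccontr)
    assume "\<not> m \<le> d x t"
    moreover have "btw w t b" "btw w w' t" using btw_right[OF w'(2) that] by auto
    moreover from this have "btw a t b" using btw_right[OF w(1)] by blast
    ultimately have "d w b \<le> d t b" using mi by auto
    with \<open>btw w t b\<close> \<open>btw w w' t\<close> w'(1) show False by linarith
  qed
  have "m \<le> d x w'" by (rule far) simp
  then have "cross x m w w' w'" unfolding cross_def
    using w(2) w'(1) d_tri[of x w' w] by auto
  moreover have "sees x m w' b" unfolding sees_def using far by blast
  ultimately show ?thesis using w \<open>w \<noteq> b\<close> by blast
qed

text \<open>Every vertex \<open>g\<close> of the geodesic towards \<open>w1\<close> is bypassed by a path of bounded length
  that leaves the ball about \<open>x\<close> through \<open>w\<close> and returns towards \<open>x'\<close>.\<close>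

lemma chain:
  assumes S: "d x w1 < m" "d x w < m" "m \<le> d x w1'" "m \<le> d x w'"
    and adj: "d w1 w1' = 1" "d w w' = 1"
    and n: "d x' w < n"
    and cn: "\<And>s. d x s < m \<Longrightarrow> conn E (- {s}) (70 * D + 12) w1' w'"
    and g: "d x' w1 = d x' g + d g w1" "n \<le> d x' g" "d g' g = 1" "d x' g' + 1 = d x' g"
  shows "{w1, w1'} \<in> R (Suc (d g w1)) {g', g}"
  using g
proof (induction "d g w1" arbitrary: g g')
  \<comment> \<open>The loop passes through \<open>w1\<close> by the edges to \<open>g'\<close> and
    to \<open>w1'\<close>; it returns from \<open>w1'\<close> by \<open>w'\<close> and
    \<open>w\<close>, and then inside a ball about \<open>x'\<close> that does not contain
    \<open>w1\<close>.\<close>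
  case (0 g g')
  define L where "L = 70 * D + 12"
  then have [simp]: "g = w1" using 0 by simp
  have ww: "d w1 w \<le> L + 2"
    using d_conn[OF cn[OF S(1)]] d_tri[of w1 w w1'] d_tri[of w1' w w'] adj d_sym[of w' w] unfolding L_def by linarith
  have "conn E {u. d x' u \<le> d x' g - 1} (4 * (L + 3) + 4 * D + 4) w g'"
  proof (rule inner_conn)
    show "d w g' \<le> L + 3" using ww d_tri[of w g' w1] 0 d_sym[of w1 w] d_sym[of g' w1] by simp
  qed (use n 0 in auto)
  then have C: "conn E (- {w1}) (4 * (L + 3) + 4 * D + 4) w g'"
    by (rule conn_mono) (use 0 in auto)
  have B: "conn E (- {w1}) 1 w' w"
    using 0 n S by (intro conn_edge) (auto simp: edge_iff d_sym[of w' w] adj)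
  have A: "conn E (- {w1}) L w1' w'" unfolding L_def by (rule cn[OF S(1)])
  have "conn E (- {w1}) (L + 1 + (4 * (L + 3) + 4 * D + 4)) w1' g'"
    by (rule conn_trans[OF conn_trans[OF A B] C])
  then have "conn E (- {w1}) (L + 1 + (4 * (L + 3) + 4 * D + 4)) g' w1'" by (rule conn_sym)
  then have "nbE {w1, g'} {w1, w1'}"
    by (intro near_cut[where S = "{w1}" and L = 0])
       (use 0 adj in \<open>auto simp: edge_iff d_sym[of g' w1] Lb_def L_def\<close>)
  then show ?case by (auto simp: insert_commute)
next
  case (Suc k g g')
  define L where "L = 70 * D + 12"
  have ww: "d w1 w \<le> L + 2"
    using d_conn[OF cn[OF S(1)]] d_tri[of w1 w w1'] d_tri[of w1' w w'] adj d_sym[of w' w] unfolding L_def by linarith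
  \<comment> \<open>\<open>w\<close> is closer to \<open>x'\<close> than \<open>g\<close>, and
    \<open>w1\<close> is near \<open>w\<close>; this bounds the part of the geodesic beyond
    \<open>g\<close>.\<close>
  have gw: "d g w1 \<le> L + 1"
    using Suc(3,4) d_tri[of x' w1 w] n ww d_sym[of w w1] by linarith
  from d_step[of g w1 k] Suc(2) obtain h where h: "d g h = 1" "d h w1 = k" by metis
  have hx: "d x' h = d x' g + 1"
    using h Suc(2,3) d_tri[of x' h g] d_tri[of x' w1 h] by linarith
  have "{w1, w1'} \<in> R (Suc (d h w1)) {g, h}"
    by (rule Suc(1)) (use h hx Suc(2-6) in auto)
  \<comment> \<open>The cut is the single vertex \<open>g\<close>. The bypass follows the geodesic
    from \<open>h\<close> to \<open>w1\<close>, changes over to \<open>w\<close>, and returns to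
    \<open>g'\<close> in the ball of radius \<open>d x' g - 1\<close> about
    \<open>x'\<close>.\<close>
  moreover have "nbE {g', g} {g, h}"
  proof -
    have A: "conn E (- {g}) (L + 1) h w1"
    proof (rule conn_geo)
      fix u assume "btw h u w1"
      then have "d u w1 \<le> k" using h by linarith
      then show "u \<in> - {g}" using Suc(2) by auto
    qed (use gw h Suc(2) in linarith)
    \<comment> \<open>A vertex \<open>g\<close> of the open ball about \<open>x\<close> is avoided
      by the detour through \<open>w1'\<close> and \<open>w'\<close>, any other \<open>g\<close> by
      a walk inside that ball.\<close>
    have B: "conn E (- {g}) (4 * (L + 2) + 4 * D + 4) w1 w"
    proof (cases "d x g < m")
      case True
      have "conn E (- {g}) 1 w1 w1'"
        using Suc(2) S True by (intro conn_edge) (auto simp: edge_iff adj)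
      moreover have "conn E (- {g}) L w1' w'" unfolding L_def by (rule cn[OF True])
      moreover have "conn E (- {g}) 1 w' w"
        using Suc(4) n S True by (intro conn_edge) (auto simp: edge_iff d_sym[of w' w] adj)
      ultimately have "conn E (- {g}) (1 + L + 1) w1 w"
        by (rule conn_trans[OF conn_trans])
      then show ?thesis by (rule conn_mono) auto
    next
      case False
      have "conn E {u. d x u \<le> m - 1} (4 * (L + 2) + 4 * D + 4) w1 w"
        by (rule inner_conn) (use S ww in auto)
      then show ?thesis by (rule conn_mono) (use False S in auto)
    qed
    have "conn E {u. d x' u \<le> d x' g - 1} (4 * (2 * L + 4) + 4 * D + 4) w g'"
    proof (rule inner_conn)
      show "d w g' \<le> 2 * L + 4"
        using ww gw d_tri[of w g' w1] d_tri[of w1 g' g] Suc(5) d_sym[of w w1] d_sym[of w1 g] d_sym[of g g']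
        by linarith
    qed (use n Suc(4,6) in auto)
    then have C: "conn E (- {g}) (4 * (2 * L + 4) + 4 * D + 4) w g'"
      by (rule conn_mono) (use Suc(6) in auto)
    have "conn E (- {g}) (L + 1 + (4 * (L + 2) + 4 * D + 4) + (4 * (2 * L + 4) + 4 * D + 4)) h g'"
      by (rule conn_trans[OF conn_trans[OF A B] C])
    then have "nbE {g, h} {g, g'}"
      by (intro near_cut[where S = "{g}" and L = 0])
         (use h Suc(5) in \<open>auto simp: edge_iff d_sym[of g g'] Lb_def L_def\<close>)
    then show ?thesis using near_sym by (simp add: insert_commute)
  qed
  ultimately show ?case using reach_nb h(2) Suc(2) by metis
qed

text \<open>\<open>y\<close> and \<open>q\<close> stand for the points chosen in a class of level
  \<open>m\<close> and in its parent, separated by a class of \<open>x'\<close>. Then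
  \<open>y\<close> or \<open>q\<close> sees some \<open>v\<close> near \<open>x'\<close>, which ties
  the crossing edge of \<open>y\<close> to that of \<open>v\<close>. Following \<open>v\<close> back
  to \<open>x'\<close>, and the separating class back through \<open>r\<close>, ties it to one of
  three edges that do not depend on \<open>y\<close>.\<close>

lemma edge_of_branching:
  assumes m: "1 \<le> m" "m \<le> d x y"
    and q: "q \<in> hclass x (m - 1) y"
      "d x q = m - 1 \<or> (\<forall>b\<in>hclass x (m - 1) y. d x b \<noteq> m - 1)"
    and n: "1 \<le> n" "d x' r = n" "d r' r = 1" "d x' r' + 1 = n"
    and r: "\<And>a. a \<in> hclass x' n a0 \<Longrightarrow> btw x' r a"
    and br: "(y \<in> hclass x' n a0) \<noteq> (q \<in> hclass x' n a0)"
    and e1: "m \<le> d x x' \<Longrightarrow> \<exists>c c1. e1 = {c, c1} \<and> cross x m c c1 x'"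
    and e2: "m \<le> d x r \<Longrightarrow> \<exists>c c1. e2 = {c, c1} \<and> cross x m c c1 r"
  shows "\<exists>c c1. cross x m c c1 y \<and> {c, c1} \<in> (\<Union>e\<in>{e1, e2, {r', r}}. R (70 * D + 20) e)"
proof -
  have lq: "m - 1 \<le> d x q"
    using hclass_small[of y x "m - 1" q] q(1) hclass_sym m by (metis le_diff_conv2 le_less_linear le_trans diff_le_self)
  have nl: "\<forall>b\<in>hclass x (m - 1) y. d x b \<noteq> m - 1" if "m \<le> d x q" using q(2) that m by linarith
  \<comment> \<open>Otherwise, for each vertex of the ball about \<open>x'\<close>, geodesics from
    \<open>y\<close> and from \<open>q\<close> to it pass the ball about \<open>x\<close> on which
    their horofunctions agree. They would then agree on the ball about \<open>x'\<close>, and no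
    class of \<open>x'\<close> of level \<open>n\<close> would separate \<open>y\<close> and
    \<open>q\<close>.\<close>
  obtain v where v: "d x' v \<le> n" "sees x m y v \<or> sees x m q v"
  proof (rule ccontr)
    assume "\<not> thesis"
    then have ns: "\<not> sees x m y v" "\<not> sees x m q v" if "d x' v \<le> n" for v
      using that \<open>\<And>v. \<lbrakk>d x' v \<le> n; sees x m y v \<or> sees x m q v\<rbrakk> \<Longrightarrow> thesis\<close> by blast+
    have *: "d y v + d q x = d q v + d y x" if v: "d x' v \<le> n" for v
    proof -
      from ns[OF v] obtain s t where s: "btw y s v" "d x s < m" and t: "btw q t v" "d x t < m"
        unfolding sees_def by (auto simp: not_le)
      have "d y s + d q x = d q s + d y x" "d y t + d q x = d q t + d y x"
        using hclassD[OF q(1)] s t by auto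
      with s t d_tri[of q v s] d_tri[of y v t] show ?thesis by linarith
    qed
    have "q \<in> hclass x' n y" unfolding hclass_def
    proof (intro CollectI allI impI)
      fix u assume "d x' u \<le> n"
      with *[OF this] *[of x'] show "d y u + d q x' = d q u + d y x'" by simp
    qed
    then show False using br hclass_eqI hclass_sym by metis
  qed
  have lv: "m \<le> d x v" using v(2) sees_level by blast
  obtain cv cv1 where cv: "cross x m cv cv1 v" using cross_exists m(1) lv by blast
  have qy: "y \<in> hclass x (m - 1) q" using q(1) hclass_sym by blast
  have eqc: "hclass x (m - 1) q = hclass x (m - 1) y" using hclass_eqI[OF q(1)] .
  \<comment> \<open>Both \<open>y\<close> and \<open>q\<close> are tied to \<open>v\<close>, not
    only the one that sees it. The other one is reached by \<open>split_conn\<close> and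
    \<open>split_reach\<close>, as the parent class then has no vertex on the sphere.\<close>
  have sv: "(\<forall>s. d x s < m \<longrightarrow> conn E (- {s}) (42 * D + 8) ca1 cv1) \<and> {ca, ca1} \<in> R 3 {cv, cv1}"
    if a: "a \<in> {y, q}" "cross x m ca ca1 a" for a ca ca1
  proof -
    have out: "conn E (- {s}) (14 * D + 2) c1 cv1" if "sees x m z v" "cross x m c c1 z" "d x s < m" for z c c1 s
      by (rule conn_mono[OF outer_conn[OF that(1) crossD(4,2)[OF that(2)] crossD(4,2)[OF cv]]])
         (use that(3) in auto)
    have nbv: "nbE {cv, cv1} {c, c1}" if "sees x m z v" "cross x m c c1 z" for z c c1
      using sees_nb[OF that cv] near_sym by blast
    obtain z where z: "z \<in> {y, q}" "sees x m z v" using v(2) by blast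
    show ?thesis
    proof (cases "z = a")
      case True
      have "conn E (- {s}) (42 * D + 8) ca1 cv1" if "d x s < m" for s
        by (rule conn_mono[OF out[of a]]) (use True z a that in auto)
      moreover have "{ca, ca1} \<in> R (Suc 2) {cv, cv1}"
        by (rule reach_nb[OF nbv[of a] reach_refl]) (use z True a in auto)
      ultimately show ?thesis by (simp add: numeral_3_eq_3 numeral_2_eq_2)
    next
      case False
      then have "m \<le> d x q" using z a sees_level[OF z(2)] crossD(8)[OF a(2)] by auto
      note nl = nl[OF this]
      obtain cz cz1 where cz: "cross x m cz cz1 z" using cross_exists m(1) sees_level[OF z(2)] by blast
      have az: "a \<in> hclass x (m - 1) z" "\<forall>b\<in>hclass x (m - 1) z. d x b \<noteq> m - 1"
        using z(1) a(1) q(1) qy nl False eqc by auto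
      have za: "z \<in> hclass x (m - 1) a" "\<forall>b\<in>hclass x (m - 1) a. d x b \<noteq> m - 1"
        using z(1) a(1) q(1) qy nl False eqc by auto
      have "conn E (- {s}) (42 * D + 8) ca1 cv1" if "d x s < m" for s
        using conn_trans[OF split_conn[OF za a(2) cz that] out[OF z(2) cz that]]
        by (rule conn_mono) auto
      moreover have "{ca, ca1} \<in> R (Suc 2) {cv, cv1}"
        by (rule reach_nb[OF nbv[OF z(2) cz] split_reach[OF az cz a(2)]])
      ultimately show ?thesis by (simp add: numeral_3_eq_3 numeral_2_eq_2)
    qed
  qed
  obtain c c1 where c: "cross x m c c1 y" using cross_exists m by blast
  show ?thesis
  proof (cases "sees x m x' v")
    case True
    then have "m \<le> d x x'" using sees_level by blast
    from e1[OF this] obtain b b1 where b: "e1 = {b, b1}" "cross x m b b1 x'" by blast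
    have "nbE e1 {cv, cv1}" using sees_nb[OF True b(2) cv] b(1) by simp
    moreover have "{c, c1} \<in> R 3 {cv, cv1}" using sv[of y] c by blast
    ultimately have "{c, c1} \<in> R (Suc 3) e1" by (rule reach_nb)
    then have "{c, c1} \<in> R (70 * D + 20) e1" by (rule reach_mono) simp
    with c show ?thesis by blast
  next
    case False
    \<comment> \<open>Here geodesics from \<open>x'\<close> to \<open>v\<close> may pass through the
      ball about \<open>x\<close>. The last vertex \<open>w\<close> of the ball is not
      \<open>v\<close>, so it is closer to \<open>x'\<close> than \<open>n\<close>, as
      \<open>chain\<close> demands.\<close>
    from last_exit[OF False lv] obtain w w' where w: "btw x' w v" "w \<noteq> v" "cross x m w w' w'" "sees x m w' v"
      by blast
    have "d w v \<noteq> 0" using w(2) by simp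
    then have wn: "d x' w < n" using w(1) v(1) by linarith
    have vw: "sees x m v w'" using w(4) sees_sym by blast
    have oc: "conn E (- {s}) (56 * D + 10) ca1 w'"
      if a: "a \<in> {y, q}" "cross x m ca ca1 a" "d x s < m" for a ca ca1 s
    proof -
      have "conn E (- {s}) (42 * D + 8) ca1 cv1" using sv[OF a(1,2)] a(3) by blast
      moreover have "conn E (- {s}) (14 * D + 2) cv1 w'"
        by (rule conn_mono[OF outer_conn[OF vw crossD(4,2)[OF cv] crossD(4,2)[OF w(3)]]])
           (use a(3) in auto)
      ultimately have "conn E (- {s}) (42 * D + 8 + (14 * D + 2)) ca1 w'" by (rule conn_trans)
      then show ?thesis by (rule conn_mono) auto
    qed
    have ch: "{w1, w1'} \<in> R (70 * D + 15) {r', r}"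
      if "d x w1 < m" "m \<le> d x w1'" "d w1 w1' = 1"
        "\<And>s. d x s < m \<Longrightarrow> conn E (- {s}) (70 * D + 12) w1' w'" "btw x' r w1" for w1 w1'
    proof -
      have "{w1, w1'} \<in> R (Suc (d r w1)) {r', r}"
        by (rule chain[OF that(1) _ that(2) _ that(3) _ wn that(4)])
           (use that(5) n crossD[OF w(3)] in auto)
      moreover have "d r w1 \<le> 70 * D + 14"
        using d_conn[OF that(4)[OF that(1)]] that(3,5) n(2) wn crossD(3)[OF w(3)]
          d_tri[of x' w1 w] d_tri[of w w1 w'] d_tri[of w' w1 w1'] d_sym[of w' w1'] d_sym[of w1' w1]
        by linarith
      ultimately show ?thesis using reach_mono by (metis Suc_le_mono add_Suc_right eval_nat_numeral(3) semiring_norm(26,27,28))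
    qed
    \<comment> \<open>Exactly one of \<open>y\<close> and \<open>q\<close> is in the class of
      \<open>x'\<close>, and \<open>r\<close> lies between \<open>x'\<close> and that one.\<close>
    obtain a where a: "a \<in> {y, q}" "a \<in> hclass x' n a0" using br by blast
    note ra = r[OF a(2)]
    show ?thesis
    proof (cases "m \<le> d x a")
      case True
      obtain ca ca1 where ca: "cross x m ca ca1 a" using cross_exists m(1) True by blast
      have "{ca, ca1} \<in> (\<Union>e\<in>{e1, e2, {r', r}}. R (70 * D + 16) e)"
      proof (cases "sees x m r a")
        case True
        from e2 sees_level[OF True] obtain b b1 where b: "e2 = {b, b1}" "cross x m b b1 r" by blast
        have "nbE e2 {ca, ca1}" using sees_nb[OF True b(2) ca] b(1) by simp
        then have "{ca, ca1} \<in> R (Suc 0) e2" by (rule reach_nb) simp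
        then have "{ca, ca1} \<in> R (70 * D + 16) e2" by (rule reach_mono) simp
        then show ?thesis by blast
      next
        case False
        from last_exit[OF False True] obtain w1 w1' where w1: "btw r w1 a" "cross x m w1 w1' w1'" "sees x m w1' a"
          by blast
        have rw: "btw x' r w1" using btw_right[OF ra w1(1)] by blast
        have "conn E (- {s}) (70 * D + 12) w1' w'" if s: "d x s < m" for s
        proof -
          have "conn E (- {s}) (14 * D + 2) w1' ca1"
            by (rule conn_mono[OF outer_conn[OF w1(3) crossD(4,2)[OF w1(2)] crossD(4,2)[OF ca]]])
               (use s in auto)
          from conn_trans[OF this oc[OF a(1) ca s]] show ?thesis by (rule conn_mono) auto
        qed
        then have "{w1, w1'} \<in> R (70 * D + 15) {r', r}"
          by (intro ch) (use rw crossD[OF w1(2)] in auto)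
        moreover have "nbE {w1, w1'} {ca, ca1}" by (rule sees_nb[OF w1(3) w1(2) ca])
        ultimately have "{ca, ca1} \<in> R (Suc (70 * D + 15)) {r', r}" by (rule reach_snoc)
        then have "{ca, ca1} \<in> R (70 * D + 16) {r', r}" by (rule reach_mono) simp
        then show ?thesis by blast
      qed
      then obtain e where e: "e \<in> {e1, e2, {r', r}}" "{ca, ca1} \<in> R (70 * D + 16) e" by blast
      show ?thesis
      proof (cases "a = y")
        case True
        have "{ca, ca1} \<in> R (70 * D + 20) e" by (rule reach_mono[OF e(2)]) simp
        with True ca e show ?thesis by blast
      next
        case False
        then have [simp]: "a = q" using a by simp
        have "{c, c1} \<in> R 2 {ca, ca1}"
          by (rule split_reach[OF qy _ _ c]) (use ca nl True eqc in auto)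
        with e(2) have "{c, c1} \<in> R (70 * D + 16 + 2) e" by (rule reach_trans)
        then have "{c, c1} \<in> R (70 * D + 20) e" by (rule reach_mono) simp
        with c e show ?thesis by blast
      qed
    next
      \<comment> \<open>Now \<open>q\<close> is on the sphere and its class may have infinitely many
        children. What ties \<open>y\<close> down is an edge at \<open>q\<close> itself, with
        \<open>q\<close> in the role of \<open>w1\<close>.\<close>
      case False
      then have [simp]: "a = q" using a m by auto
      have qm: "d x q = m - 1" using False lq by simp
      then have "d y q + d q x = d q q + d y x" using hclassD[OF q(1), of q] by simp
      then have "btw x q y" using d_sym[of y q] d_sym[of q x] d_sym[of y x] by simp
      then obtain q1 where q1: "cross x m q q1 y" using cross_extend[of x q y m] qm m by auto
      have "{q, q1} \<in> R (70 * D + 15) {r', r}"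
      proof (rule ch)
        show "conn E (- {s}) (70 * D + 12) q1 w'" if "d x s < m" for s
          by (rule conn_mono[OF oc[OF _ q1 that]]) auto
      qed (use ra crossD[OF q1] in auto)
      then have "{q, q1} \<in> R (70 * D + 20) {r', r}" by (rule reach_mono) simp
      with q1 show ?thesis by blast
    qed
  qed
qed


section \<open>Change of base point\<close>


text \<open>The representative of a class in the telescoping sums. Choosing it closest to
  \<open>x\<close> gives \<open>lowest_level\<close>, by which these sums end at the right
  value.\<close>

definition lowest :: "'v \<Rightarrow> 'v set \<Rightarrow> 'v" where
  "lowest x B = (SOME b. b \<in> B \<and> (\<forall>b'\<in>B. d x b \<le> d x b'))"

lemma lowest: assumes "a \<in> B" shows "lowest x B \<in> B" "b \<in> B \<Longrightarrow> d x (lowest x B) \<le> d x b"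
proof -
  from ex_has_least_nat[of "\<lambda>b. b \<in> B", OF assms, of "d x"]
  have "\<exists>b. b \<in> B \<and> (\<forall>b'\<in>B. d x b \<le> d x b')" by blast
  from someI_ex[OF this] show "lowest x B \<in> B" "b \<in> B \<Longrightarrow> d x (lowest x B) \<le> d x b"
    unfolding lowest_def by blast+
qed

lemma lowest_cls [simp]: "hclass x m (lowest x (hclass x m a)) = hclass x m a"
  by (rule hclass_eqI[OF lowest(1)[OF hclass_self]])

lemma lowest_level: "lowest x (hclass x (d x a) a) = a"
proof (rule hclass_level)
  show 1: "lowest x (hclass x (d x a) a) \<in> hclass x (d x a) a" by (rule lowest(1)[OF hclass_self])
  have "d x (lowest x (hclass x (d x a) a)) \<le> d x a" by (rule lowest(2)[of a]) simp_all
  moreover have "\<not> d x (lowest x (hclass x (d x a) a)) < d x a"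
    using hclass_small 1 hclass_sym by (metis less_irrefl)
  ultimately show "d x (lowest x (hclass x (d x a) a)) = d x a" by simp
qed simp

lemma hclass_far: assumes "b \<in> hclass x m a" "m \<le> d x a" shows "m \<le> d x b"
proof (rule ccontr)
  assume "\<not> m \<le> d x b"
  then have "a = b" using hclass_small[of a x m b] assms hclass_sym by auto
  with \<open>\<not> m \<le> d x b\<close> assms(2) show False by simp
qed

text \<open>The point chosen in the parent of \<open>B\<close>; a telescoping coefficient compares
  it with the point chosen in \<open>B\<close>.\<close>

definition plowest :: "'v \<Rightarrow> nat \<Rightarrow> 'v set \<Rightarrow> 'v" where
  "plowest x m B = lowest x (hclass x (m - 1) (lowest x B))"

section \<open>Counting the classes at which an indicator jumps\<close>

definition reached :: "nat \<Rightarrow> 'v set set \<Rightarrow> 'v \<Rightarrow> nat \<Rightarrow> 'v set \<Rightarrow> bool" where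
  "reached k F x m B \<longleftrightarrow> (\<exists>y c c1. B = hclass x m y \<and> cross x m c c1 y \<and> {c, c1} \<in> (\<Union>e\<in>F. R k e))"

text \<open>Boundedly many edges by \<open>reach_bound\<close>, and boundedly many classes for each
  edge by \<open>class_count\<close>. The number 3 is that of the edges in
  \<open>edge_of_branching\<close>.\<close>

lemma reached_count:
  "\<exists>Q. \<forall>x m F S. finite F \<and> card F \<le> 3 \<and> F \<subseteq> E \<and> (\<forall>B\<in>S. reached k F x m B) \<longrightarrow>
     finite S \<and> card S \<le> Q"
proof -
  obtain N where N: "\<And>x m e. finite {hclass x m y | y. \<exists>c c1. e = {c, c1} \<and> cross x m c c1 y} \<and>
     card {hclass x m y | y. \<exists>c c1. e = {c, c1} \<and> cross x m c c1 y} \<le> N"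
    using class_count by blast
  obtain M where M: "\<And>e. e \<in> E \<Longrightarrow> finite (R k e) \<and> card (R k e) \<le> M"
    using reach_bound[OF ufine] by blast
  show ?thesis
  proof (intro exI[of _ "3 * M * N"] allI impI)
    fix x m F S
    assume "finite F \<and> card F \<le> 3 \<and> F \<subseteq> E \<and> (\<forall>B\<in>S. reached k F x m B)"
    then have F: "finite F" "card F \<le> 3" "F \<subseteq> E" and S: "\<forall>B\<in>S. reached k F x m B" by auto
    have T: "finite (\<Union>e\<in>F. R k e)" "card (\<Union>e\<in>F. R k e) \<le> 3 * M"
      by (rule UN_bound[OF F(1,2)]; use M F(3) in blast)+
    let ?U = "\<Union>e\<in>(\<Union>e\<in>F. R k e). {hclass x m y | y. \<exists>c c1. e = {c, c1} \<and> cross x m c c1 y}"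
    have U: "finite ?U" "card ?U \<le> 3 * M * N" by (rule UN_bound[OF T N])+
    have sub: "S \<subseteq> ?U"
    proof
      fix B assume "B \<in> S"
      with S have "reached k F x m B" by (rule bspec)
      then obtain y c c1 where y: "B = hclass x m y" "cross x m c c1 y" "{c, c1} \<in> (\<Union>e\<in>F. R k e)"
        unfolding reached_def by (elim exE conjE)
      then show "B \<in> ?U" by (intro UN_I[OF y(3)]) blast
    qed
    show "finite S \<and> card S \<le> 3 * M * N"
      using finite_subset[OF sub U(1)] card_mono[OF U(1) sub] U(2) by linarith
  qed
qed

lemma branching_count:
  "\<exists>Q. \<forall>x x' n a0 m. 1 \<le> n \<and> n \<le> d x' a0 \<and> 1 \<le> m \<longrightarrow>
     finite {B. \<exists>y. m \<le> d x y \<and> B = hclass x m y \<and> (lowest x B \<in> hclass x' n a0) \<noteq> (plowest x m B \<in> hclass x' n a0)} \<and>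
     card {B. \<exists>y. m \<le> d x y \<and> B = hclass x m y \<and> (lowest x B \<in> hclass x' n a0) \<noteq> (plowest x m B \<in> hclass x' n a0)} \<le> Q"
proof -
  define k where "k = 70 * D + 20"
  obtain Q where Q: "\<forall>x m F S. finite F \<and> card F \<le> 3 \<and> F \<subseteq> E \<and> (\<forall>B\<in>S. reached k F x m B) \<longrightarrow>
     finite S \<and> card S \<le> Q"
    using reached_count[of k] by (rule exE)
  have "finite S \<and> card S \<le> Q"
    if h: "1 \<le> n" "n \<le> d x' a0" "1 \<le> m"
      and S: "S = {B. \<exists>y. m \<le> d x y \<and> B = hclass x m y \<and> (lowest x B \<in> hclass x' n a0) \<noteq> (plowest x m B \<in> hclass x' n a0)}"
    for x x' n a0 m S
  proof -
    obtain r where r: "d x' r = n" "btw x' r a0" using point_at h(2) by blast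
    then have "n - 1 \<le> d x' r" by simp
    from point_at[OF this] obtain r' where r': "d x' r' = n - 1" "btw x' r' r" by blast
    have rr: "d r' r = 1" "d x' r' + 1 = n" using r' r h(1) by auto
    have ra: "btw x' r a" if "a \<in> hclass x' n a0" for a
      using hclassD[OF that, of r] r d_sym[of a x'] d_sym[of a0 x'] d_sym[of a r] d_sym[of a0 r] by linarith
    \<comment> \<open>If no geodesic from \<open>x\<close> to \<open>x'\<close> or to
      \<open>r\<close> crosses level \<open>m\<close>, the edge \<open>{r', r}\<close> fills the
      place, so that \<open>F\<close> always consists of edges.\<close>
    define e1 where "e1 = (if m \<le> d x x' then SOME e. \<exists>c c1. e = {c, c1} \<and> cross x m c c1 x' else {r', r})"
    define e2 where "e2 = (if m \<le> d x r then SOME e. \<exists>c c1. e = {c, c1} \<and> cross x m c c1 r else {r', r})"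
    have some: "\<exists>c c1. (SOME e. \<exists>c c1. e = {c, c1} \<and> cross x m c c1 z) = {c, c1} \<and> cross x m c c1 z"
      if z: "m \<le> d x z" for z
      by (rule someI_ex[of "\<lambda>e. \<exists>c c1. e = {c, c1} \<and> cross x m c c1 z"]) (use cross_exists[OF h(3) z] in blast)
    have e1: "\<exists>c c1. e1 = {c, c1} \<and> cross x m c c1 x'" if "m \<le> d x x'"
      using some[OF that] that unfolding e1_def by simp
    have e2: "\<exists>c c1. e2 = {c, c1} \<and> cross x m c c1 r" if "m \<le> d x r"
      using some[OF that] that unfolding e2_def by simp
    define F where "F = {e1, e2, {r', r}}"
    have rE: "{r', r} \<in> E" using rr by (simp add: edge_iff)
    have "e1 \<in> E"
    proof (cases "m \<le> d x x'")
      case True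
      with e1 crossD(5) show ?thesis by blast
    qed (use rE in \<open>simp add: e1_def\<close>)
    moreover have "e2 \<in> E"
    proof (cases "m \<le> d x r")
      case True
      with e2 crossD(5) show ?thesis by blast
    qed (use rE in \<open>simp add: e2_def\<close>)
    ultimately have FE: "F \<subseteq> E" using rE F_def by blast
    have cF: "finite F" "card F \<le> 3" unfolding F_def by (auto simp: card_insert_if)
    show ?thesis
    proof (rule Q[rule_format, of F], intro conjI cF FE ballI)
      fix B assume "B \<in> S"
      then obtain y0 where y0: "m \<le> d x y0" "B = hclass x m y0"
        "(lowest x B \<in> hclass x' n a0) \<noteq> (plowest x m B \<in> hclass x' n a0)" unfolding S by blast
      define y where "y = lowest x B"
      define q where "q = plowest x m B"
      have yB: "y \<in> hclass x m y0" unfolding y_def y0(2) by (rule lowest(1)[OF hclass_self])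
      have my: "m \<le> d x y" by (rule hclass_far[OF yB y0(1)])
      have q1: "q \<in> hclass x (m - 1) y"
        unfolding q_def plowest_def y_def by (rule lowest(1)[OF hclass_self])
      \<comment> \<open>\<open>lowest\<close> minimises the distance to \<open>x\<close>, so the
        chosen point is on the sphere as soon as its class meets the sphere.\<close>
      have q2: "d x q = m - 1 \<or> (\<forall>b\<in>hclass x (m - 1) y. d x b \<noteq> m - 1)"
      proof (rule disjCI)
        assume "\<not> (\<forall>b\<in>hclass x (m - 1) y. d x b \<noteq> m - 1)"
        then obtain b where b: "b \<in> hclass x (m - 1) y" "d x b = m - 1" by blast
        have "d x q \<le> d x b" unfolding q_def plowest_def y_def[symmetric] by (rule lowest(2)[OF b(1) b(1)])
        moreover have "m - 1 \<le> d x q" by (rule hclass_far[OF q1]) (use my in simp)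
        ultimately show "d x q = m - 1" using b by simp
      qed
      have "\<exists>c c1. cross x m c c1 y \<and> {c, c1} \<in> (\<Union>e\<in>{e1, e2, {r', r}}. R (70 * D + 20) e)"
        by (rule edge_of_branching[OF h(3) my q1 q2 h(1) r(1) rr ra _ e1 e2])
           (use y0(3) in \<open>simp_all add: y_def q_def\<close>)
      then obtain c c1 where "cross x m c c1 y" "{c, c1} \<in> (\<Union>e\<in>F. R k e)" unfolding F_def k_def by blast
      moreover have "B = hclass x m y" unfolding y0(2) using hclass_eqI[OF yB] by simp
      ultimately show "reached k F x m B" unfolding reached_def by blast
    qed
  qed
  then show ?thesis by blast
qed

text \<open>The parent class has level at least \<open>n + d x x'\<close> and thus lies in a single
  class of \<open>x'\<close> of level \<open>n\<close>, by \<open>hclass_shift\<close>: its point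
  and that of the child cannot be separated.\<close>

lemma level_bound:
  assumes "1 \<le> m" "n + d x x' < m"
  shows "(lowest x (hclass x m y) \<in> hclass x' n a0) = (plowest x m (hclass x m y) \<in> hclass x' n a0)"
proof -
  define p where "p = lowest x (hclass x m y)"
  have "plowest x m (hclass x m y) \<in> hclass x (m - 1) p"
    unfolding plowest_def p_def by (rule lowest(1)[OF hclass_self])
  also have "\<dots> \<subseteq> hclass x (n + d x x') p" by (rule hclass_antimono) (use assms in simp)
  also have "\<dots> \<subseteq> hclass x' n p" by (rule hclass_shift)
  finally show ?thesis unfolding p_def[symmetric] using hclass_eqI hclass_sym by metis
qed

text \<open>The condition \<open>n < m + d x x'\<close> discards the levels up to the start of the
  telescoping sum. With \<open>level_bound\<close> only \<open>2 * d x x'\<close> levels remain,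
  whence the linear count.\<close>

definition branchings :: "'v \<Rightarrow> 'v \<Rightarrow> nat \<Rightarrow> 'v set \<Rightarrow> (nat \<times> 'v set) set" where
  "branchings x x' n A = {(m, hclass x m y) | m y. 1 \<le> m \<and> m \<le> d x y \<and> n < m + d x x' \<and>
     (lowest x (hclass x m y) \<in> A) \<noteq> (plowest x m (hclass x m y) \<in> A)}"

lemma branchings_bound:
  "\<exists>Q. \<forall>x x' n a0. n \<le> d x' a0 \<longrightarrow> finite (branchings x x' n (hclass x' n a0)) \<and>
     card (branchings x x' n (hclass x' n a0)) \<le> Q * (2 * d x x')"
proof -
  obtain Q where Q: "\<And>x x' n a0 m. 1 \<le> n \<and> n \<le> d x' a0 \<and> 1 \<le> m \<Longrightarrow>
     finite {B. \<exists>y. m \<le> d x y \<and> B = hclass x m y \<and> (lowest x B \<in> hclass x' n a0) \<noteq> (plowest x m B \<in> hclass x' n a0)} \<and>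
     card {B. \<exists>y. m \<le> d x y \<and> B = hclass x m y \<and> (lowest x B \<in> hclass x' n a0) \<noteq> (plowest x m B \<in> hclass x' n a0)} \<le> Q"
    using branching_count by blast
  have "finite (branchings x x' n (hclass x' n a0)) \<and> card (branchings x x' n (hclass x' n a0)) \<le> Q * (2 * d x x')"
    if n: "n \<le> d x' a0" for x x' n a0
  proof (cases "n = 0")
    case True
    then have "branchings x x' n (hclass x' n a0) = {}" unfolding branchings_def by (simp add: hclass_0)
    then show ?thesis by simp
  next
    case False
    define S where "S m = {B. \<exists>y. m \<le> d x y \<and> B = hclass x m y \<and>
      (lowest x B \<in> hclass x' n a0) \<noteq> (plowest x m B \<in> hclass x' n a0)}" for m
    define I where "I = {max 1 (n + 1 - d x x')..n + d x x'}"
    have S: "finite (S m) \<and> card (S m) \<le> Q" if "m \<in> I" for m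
      unfolding S_def by (rule Q) (use False n that in \<open>auto simp: I_def\<close>)
    have sub: "branchings x x' n (hclass x' n a0) \<subseteq> Sigma I S"
    proof
      fix p assume "p \<in> branchings x x' n (hclass x' n a0)"
      then obtain m y where p: "p = (m, hclass x m y)" "1 \<le> m" "m \<le> d x y" "n < m + d x x'"
        "(lowest x (hclass x m y) \<in> hclass x' n a0) \<noteq> (plowest x m (hclass x m y) \<in> hclass x' n a0)"
        unfolding branchings_def by blast
      have "m \<le> n + d x x'" using level_bound[OF p(2)] p(5) not_le by blast
      then have "m \<in> I" unfolding I_def using p by auto
      then show "p \<in> Sigma I S" unfolding S_def p(1) using p by blast
    qed
    have fin: "finite (Sigma I S)" using S by (intro finite_SigmaI) (auto simp: I_def)
    have "card (Sigma I S) = (\<Sum>m\<in>I. card (S m))" using S by (simp add: I_def)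
    also have "\<dots> \<le> (\<Sum>m\<in>I. Q)" by (rule sum_mono) (use S in blast)
    also have "\<dots> = card I * Q" by simp
    also have "\<dots> \<le> Q * (2 * d x x')"
    proof -
      have "card I \<le> 2 * d x x'" unfolding I_def by (auto simp: max_def)
      then show ?thesis by (metis mult.commute mult_le_mono1)
    qed
    finally show ?thesis using finite_subset[OF sub fin] card_mono[OF fin sub] by auto
  qed
  then show ?thesis by blast
qed

text \<open>The level is part of a piece because one set can be a class at several levels, which
  carry different coefficients and weights.\<close>

definition pieces :: "'v \<Rightarrow> (nat \<times> 'v set) set" where
  "pieces x = {(m, hclass x m a) | m a. m \<le> d x a}"

text \<open>The coefficients of the telescoping sum along the chain of classes of a point, started at
  level \<open>M\<close>, with \<open>h\<close> evaluated at the chosen point of each class.\<close>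

definition tcoeff :: "'v \<Rightarrow> nat \<Rightarrow> ('v \<Rightarrow> real) \<Rightarrow> nat \<times> 'v set \<Rightarrow> real" where
  "tcoeff x M h B = (if fst B < M then 0 else if fst B = M then h (lowest x (snd B))
     else h (lowest x (snd B)) - h (plowest x (fst B) (snd B)))"

lemma pieces_mem: "(m, B) \<in> pieces x \<Longrightarrow> a \<in> B \<Longrightarrow> m \<le> d x a \<and> B = hclass x m a"
  unfolding pieces_def using hclass_far hclass_eqI by blast

text \<open>The pieces that contain \<open>a\<close> are its classes at the levels up to
  \<open>d x a\<close>, one per level, and \<open>plowest\<close> of each is \<open>lowest\<close>
  of the one before. The sum collapses to \<open>h\<close> at the point chosen at level
  \<open>d x a\<close>, which is \<open>a\<close>.\<close>

lemma telescoping: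
  assumes J: "finite J" "J \<subseteq> pieces x" "\<And>B. B \<in> pieces x \<Longrightarrow> tcoeff x M h B \<noteq> 0 \<Longrightarrow> B \<in> J"
  shows "(\<Sum>B\<in>J. tcoeff x M h B * indicator (snd B) a) = (if M \<le> d x a then h a else 0)"
proof -
  define g where "g m = (m, hclass x m a)" for m
  have inj: "inj_on g {..d x a}" unfolding g_def by (auto intro: inj_onI)
  have gp: "g ` {..d x a} \<subseteq> pieces x" unfolding g_def pieces_def by blast
  have "(\<Sum>B\<in>J. tcoeff x M h B * indicator (snd B) a)
      = (\<Sum>B\<in>J \<union> g ` {..d x a}. tcoeff x M h B * indicator (snd B) a)"
  proof (rule sum.mono_neutral_left)
    show "\<forall>B\<in>(J \<union> g ` {..d x a}) - J. tcoeff x M h B * indicator (snd B) a = 0"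
    proof
      fix B assume "B \<in> (J \<union> g ` {..d x a}) - J"
      then have "tcoeff x M h B = 0" using J(3)[of B] gp by blast
      then show "tcoeff x M h B * indicator (snd B) a = 0" by simp
    qed
  qed (use J in auto)
  also have "\<dots> = (\<Sum>B\<in>g ` {..d x a}. tcoeff x M h B * indicator (snd B) a)"
  proof (rule sum.mono_neutral_right)
    show "\<forall>B\<in>(J \<union> g ` {..d x a}) - g ` {..d x a}. tcoeff x M h B * indicator (snd B) a = 0"
    proof
      fix B assume B: "B \<in> (J \<union> g ` {..d x a}) - g ` {..d x a}"
      then have "(fst B, snd B) \<in> pieces x" using J(2) by auto
      have "a \<notin> snd B"
      proof
        assume "a \<in> snd B"
        with pieces_mem[OF \<open>(fst B, snd B) \<in> pieces x\<close>] have "B = g (fst B)" "fst B \<in> {..d x a}"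
          unfolding g_def by (auto simp: prod_eq_iff)
        then show False using B by blast
      qed
      then show "tcoeff x M h B * indicator (snd B) a = 0" by simp
    qed
  qed (use J in auto)
  also have "\<dots> = (\<Sum>m\<le>d x a. tcoeff x M h (g m))"
    by (subst sum.reindex[OF inj]) (simp add: g_def)
  also have "\<dots> = (if M \<le> d x a then h (lowest x (hclass x (d x a) a)) else 0)"
  proof -
    have "(\<Sum>m\<le>N. tcoeff x M h (g m)) = (if M \<le> N then h (lowest x (hclass x N a)) else 0)" for N
    proof (induction N)
      case 0
      then show ?case by (simp add: tcoeff_def g_def)
    next
      case (Suc N)
      have "plowest x (Suc N) (hclass x (Suc N) a) = lowest x (hclass x N a)"
      proof -
        have "lowest x (hclass x (Suc N) a) \<in> hclass x (Suc N) a" by (rule lowest(1)[OF hclass_self])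
        then have "lowest x (hclass x (Suc N) a) \<in> hclass x N a" using hclass_antimono[of N "Suc N"] by auto
        from hclass_eqI[OF this] show ?thesis unfolding plowest_def by simp
      qed
      then show ?case using Suc by (auto simp: tcoeff_def g_def)
    qed
    then show ?thesis .
  qed
  finally show ?thesis by (simp add: lowest_level)
qed

lemma tcoeff_indicator_nonzero:
  assumes "B \<in> pieces x" "tcoeff x M (indicator A) B \<noteq> 0" "n \<le> M + d x x'"
  shows "fst B = M \<and> lowest x (snd B) \<in> A \<or> B \<in> branchings x x' n A"
proof -
  obtain m y where B: "B = (m, hclass x m y)" "m \<le> d x y" using assms(1) unfolding pieces_def by blast
  have "m = M \<or> M < m" using assms(2) B unfolding tcoeff_def by (auto split: if_splits)
  then show ?thesis
  proof
    assume "M < m"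
    then have "(lowest x (hclass x m y) \<in> A) \<noteq> (plowest x m (hclass x m y) \<in> A)"
      using assms(2) B unfolding tcoeff_def by (auto simp: indicator_def split: if_splits)
    then show ?thesis unfolding branchings_def using B \<open>M < m\<close> assms(3) by auto
  qed (use assms(2) B in \<open>auto simp: tcoeff_def indicator_def split: if_splits\<close>)
qed

text \<open>The counts are at most 1 if \<open>x = x'\<close>; this later keeps the stabiliser of
  the base point from increasing norms. The comparison of levels controls the quotients of
  weights.\<close>

definition base_change_coeffs ::
  "nat \<Rightarrow> 'v \<Rightarrow> 'v \<Rightarrow> (nat \<times> 'v set \<Rightarrow> nat \<times> 'v set \<Rightarrow> real) \<Rightarrow> bool" where
  "base_change_coeffs Q x x' c \<longleftrightarrow>
     (\<forall>A\<in>pieces x'. finite {B\<in>pieces x. c A B \<noteq> 0} \<and> card {B\<in>pieces x. c A B \<noteq> 0} \<le> 1 + Q * d x x' \<and>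
        (\<forall>a. indicator (snd A) a = (\<Sum>B\<in>{B\<in>pieces x. c A B \<noteq> 0}. c A B * indicator (snd B) a :: real))) \<and>
     (\<forall>B\<in>pieces x. finite {A\<in>pieces x'. c A B \<noteq> 0} \<and> card {A\<in>pieces x'. c A B \<noteq> 0} \<le> 1 + Q * d x x') \<and>
     (\<forall>A\<in>pieces x'. \<forall>B\<in>pieces x. \<bar>c A B\<bar> \<le> 1 \<and> (c A B \<noteq> 0 \<longrightarrow> fst A \<le> fst B + d x x'))"

theorem base_change: "\<exists>Q. \<forall>x x'. \<exists>c. base_change_coeffs Q x x' c"
proof -
  obtain Q where Q: "\<And>x x' n a0. n \<le> d x' a0 \<Longrightarrow> finite (branchings x x' n (hclass x' n a0)) \<and>
     card (branchings x x' n (hclass x' n a0)) \<le> Q * (2 * d x x')"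
    using branchings_bound by blast
  define Q' where "Q' = 2 * Q + 6"
  show ?thesis
  proof (intro exI[of _ Q'] allI)
    fix x x'
    \<comment> \<open>All of \<open>A\<close> is at distance at least \<open>fst A - d x x'\<close>
      from \<open>x\<close> and in one class of that level; hence the sum can start there, with a
      single starting term.\<close>
    define c where "c A B = tcoeff x (fst A - d x x') (indicator (snd A)) B" for A B :: "nat \<times> 'v set"
    have low: "fst A \<le> fst B + d x x'" if "c A B \<noteq> 0" for A B
      using that unfolding c_def tcoeff_def by (auto split: if_splits)
    have bd: "\<bar>c A B\<bar> \<le> 1" for A B
      unfolding c_def tcoeff_def by (auto simp: indicator_def)
    have row: "finite {B\<in>pieces x. c A B \<noteq> 0} \<and> card {B\<in>pieces x. c A B \<noteq> 0} \<le> 1 + Q' * d x x' \<and>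
        (\<forall>a. indicator (snd A) a = (\<Sum>B\<in>{B\<in>pieces x. c A B \<noteq> 0}. c A B * indicator (snd B) a :: real))"
      if A: "A \<in> pieces x'" for A
    proof -
      from A obtain n a0 where n: "A = (n, hclass x' n a0)" "n \<le> d x' a0" unfolding pieces_def by blast
      define M where "M = n - d x x'"
      have sub: "{B\<in>pieces x. c A B \<noteq> 0} \<subseteq> insert (M, hclass x M a0) (branchings x x' n (hclass x' n a0))"
      proof
        fix B assume B: "B \<in> {B\<in>pieces x. c A B \<noteq> 0}"
        then have "fst B = M \<and> lowest x (snd B) \<in> hclass x' n a0 \<or> B \<in> branchings x x' n (hclass x' n a0)"
          using tcoeff_indicator_nonzero[of B x M "hclass x' n a0" n x'] unfolding c_def n(1) M_def by auto
        then show "B \<in> insert (M, hclass x M a0) (branchings x x' n (hclass x' n a0))"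
        proof
          assume *: "fst B = M \<and> lowest x (snd B) \<in> hclass x' n a0"
          obtain y where y: "B = (M, hclass x M y)" using B * unfolding pieces_def by auto
          have "hclass x' n a0 \<subseteq> hclass x M a0"
          proof (cases "M = 0")
            case False
            then have "n = M + d x' x" unfolding M_def using d_sym[of x x'] by simp
            then show ?thesis using hclass_shift[of x' M x a0] by simp
          qed (simp add: hclass_0)
          with * y have "lowest x (hclass x M y) \<in> hclass x M a0" by auto
          from hclass_eqI[OF this] y show ?thesis by simp
        qed simp
      qed
      have fin: "finite (insert (M, hclass x M a0) (branchings x x' n (hclass x' n a0)))"
        using Q[OF n(2)] by simp
      have "card {B\<in>pieces x. c A B \<noteq> 0} \<le> 1 + Q * (2 * d x x')"
        using card_mono[OF fin sub] card_insert_le_m1[of _ _ "(M, hclass x M a0)"] Q[OF n(2), of x]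
        by (auto simp: card_insert_if split: if_splits)
      then have card: "card {B\<in>pieces x. c A B \<noteq> 0} \<le> 1 + Q' * d x x'"
        unfolding Q'_def by (simp add: algebra_simps)
      have fin': "finite {B\<in>pieces x. c A B \<noteq> 0}" using finite_subset[OF sub fin] .
      have "indicator (snd A) a = (\<Sum>B\<in>{B\<in>pieces x. c A B \<noteq> 0}. c A B * indicator (snd B) a :: real)" for a
      proof -
        have "(\<Sum>B\<in>{B\<in>pieces x. c A B \<noteq> 0}. c A B * indicator (snd B) a) =
            (if M \<le> d x a then indicator (snd A) a else 0)"
          unfolding c_def n(1) fst_conv M_def[symmetric]
          by (rule telescoping) (use fin' in \<open>auto simp: c_def n(1) M_def\<close>)
        moreover have "M \<le> d x a" if "a \<in> snd A"
        proof -
          have "n \<le> d x' a" using that n hclass_far by simp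
          then show ?thesis unfolding M_def using d_tri[of x' a x] d_sym[of x x'] by linarith
        qed
        ultimately show ?thesis by (auto simp: indicator_def)
      qed
      with card fin' show ?thesis by blast
    qed
    have col: "finite {A\<in>pieces x'. c A B \<noteq> 0} \<and> card {A\<in>pieces x'. c A B \<noteq> 0} \<le> 1 + Q' * d x x'"
      if B: "B \<in> pieces x" for B
    proof -
      from B obtain m y where m: "B = (m, hclass x m y)" "m \<le> d x y" unfolding pieces_def by blast
      define I where "I = {m - d x x'..m + d x x'}"
      define p where "p = lowest x (snd B)"
      define q where "q = plowest x m (snd B)"
      define f where "f z n = (n, hclass x' n z)" for z n
      \<comment> \<open>A nonzero entry forces \<open>A\<close> to contain one of the two points
        chosen for \<open>B\<close>, and a piece of \<open>x'\<close> is determined by its level and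
        any of its points.\<close>
      have main: "A \<in> f p ` I \<or> (A \<in> f q ` I \<and> d x x' \<noteq> 0)" if A: "A \<in> pieces x'" "c A B \<noteq> 0" for A
      proof -
        from A obtain n a0 where n: "A = (n, hclass x' n a0)" "n \<le> d x' a0" unfolding pieces_def by blast
        have 1: "n \<le> m + d x x'" using low[OF A(2)] n m by simp
        have 2: "m \<le> n + d x x'"
        proof (rule ccontr)
          assume "\<not> ?thesis"
          then have "1 \<le> m" "n + d x x' < m" by auto
          from level_bound[OF this] A(2) \<open>n + d x x' < m\<close> show False
            unfolding c_def tcoeff_def n m by (auto simp: indicator_def split: if_splits)
        qed
        have "p \<in> hclass x' n a0 \<or> q \<in> hclass x' n a0 \<and> d x x' \<noteq> 0"
          using A(2) 1 2 unfolding c_def tcoeff_def n p_def q_def m by (auto simp: indicator_def split: if_splits)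
        moreover have "n \<in> I" unfolding I_def using 1 2 by auto
        moreover have "A = f z n" if "z \<in> hclass x' n a0" for z unfolding f_def n using hclass_eqI[OF that] by simp
        ultimately show ?thesis by blast
      qed
      have fI: "finite I" unfolding I_def by simp
      have cI: "card I \<le> 2 * d x x' + 1" unfolding I_def by simp
      show ?thesis
      \<comment> \<open>At distance 0 the bound must be exactly 1, so the parent point must not
        contribute. Otherwise \<open>4 * d x x' + 2\<close> is absorbed by the summand
        \<open>6\<close> in \<open>Q'\<close>.\<close>
      proof (cases "d x x' = 0")
        case True
        then have sub: "{A\<in>pieces x'. c A B \<noteq> 0} \<subseteq> f p ` I" using main by blast
        then show ?thesis
          using finite_subset[OF sub] card_mono[OF _ sub] card_image_le[OF fI, of "f p"] cI True fI by force
      next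
        case False
        have sub: "{A\<in>pieces x'. c A B \<noteq> 0} \<subseteq> f p ` I \<union> f q ` I" using main by blast
        have "card (f p ` I \<union> f q ` I) \<le> card (f p ` I) + card (f q ` I)" by (rule card_Un_le)
        also have "\<dots> \<le> card I + card I" by (intro add_mono card_image_le fI)
        also have "\<dots> \<le> (2 * d x x' + 1) + (2 * d x x' + 1)" by (rule add_mono[OF cI cI])
        also have "\<dots> = 4 * d x x' + 2" by simp
        also have "\<dots> \<le> 1 + 6 * d x x'" using False by linarith
        also have "\<dots> \<le> 1 + Q' * d x x'" unfolding Q'_def by simp
        finally have "card (f p ` I \<union> f q ` I) \<le> 1 + Q' * d x x'" .
        moreover have "finite (f p ` I \<union> f q ` I)" using fI by simp
        ultimately show ?thesis using finite_subset[OF sub] card_mono[OF _ sub] le_trans by blast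
      qed
    qed
    show "\<exists>c. base_change_coeffs Q' x x' c"
      unfolding base_change_coeffs_def
      using row col bd low by (intro exI[of _ c]) blast
  qed
qed

section \<open>Decomposing the constant function 1 between two base points\<close>

lemma seen_classes:
  "\<exists>Q. \<forall>x x' m. 1 \<le> m \<longrightarrow> finite {hclass x m y | y. sees x m y x'} \<and> card {hclass x m y | y. sees x m y x'} \<le> Q"
proof -
  obtain Q where Q: "\<forall>x m F S. finite F \<and> card F \<le> 3 \<and> F \<subseteq> E \<and> (\<forall>B\<in>S. reached 1 F x m B) \<longrightarrow>
     finite S \<and> card S \<le> Q"
    using reached_count[of 1] by (rule exE)
  have "finite S \<and> card S \<le> Q" if m: "1 \<le> m" and S: "S = {hclass x m y | y. sees x m y x'}" for x x' m S
  proof (cases "S = {}")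
    case False
    then have "m \<le> d x x'" using S sees_level by blast
    then obtain c c1 where c: "cross x m c c1 x'" using cross_exists m by blast
    show ?thesis
    proof (rule Q[rule_format, of "{{c, c1}}"], intro conjI ballI)
      show "{{c, c1}} \<subseteq> E" using crossD(5)[OF c] by simp
    next
      fix B assume "B \<in> S"
      then obtain y where y: "B = hclass x m y" "sees x m y x'" using S by blast
      obtain b b1 where b: "cross x m b b1 y" using cross_exists m sees_level[OF y(2)] by blast
      have "{b, b1} \<in> R 1 {c, c1}" using near_sym[OF sees_nb[OF y(2) b c]] by simp
      then show "reached 1 {{c, c1}} x m B" unfolding reached_def using y b by blast
    qed simp_all
  qed simp
  then show ?thesis by blast
qed

text \<open>A geodesic from \<open>y\<close> to \<open>x'\<close> passes a vertex \<open>w\<close>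
  close to \<open>x\<close>. With respect to \<open>x'\<close>, \<open>y\<close> sees
  \<open>w\<close> and \<open>w\<close> sees \<open>x\<close>, so two loops lead from a crossing
  edge towards \<open>x\<close> to one towards \<open>y\<close>.\<close>

lemma hidden_classes:
  "\<exists>Q. \<forall>x x' m k. 1 \<le> k \<and> k + m < d x x' \<longrightarrow>
     finite {hclass x' k y | y. \<not> sees x m y x'} \<and> card {hclass x' k y | y. \<not> sees x m y x'} \<le> Q"
proof -
  obtain Q where Q: "\<forall>x m F S. finite F \<and> card F \<le> 3 \<and> F \<subseteq> E \<and> (\<forall>B\<in>S. reached 2 F x m B) \<longrightarrow>
     finite S \<and> card S \<le> Q"
    using reached_count[of 2] by (rule exE)
  have "finite S \<and> card S \<le> Q"
    if k: "1 \<le> k" "k + m < d x x'" and S: "S = {hclass x' k y | y. \<not> sees x m y x'}" for x x' m k S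
  proof -
    have "k \<le> d x' x" using k d_sym[of x x'] by simp
    then obtain c c1 where c: "cross x' k c c1 x" using cross_exists k by blast
    show ?thesis
    proof (rule Q[rule_format, of "{{c, c1}}"], intro conjI ballI)
      show "{{c, c1}} \<subseteq> E" using crossD(5)[OF c] by simp
    next
      fix B assume "B \<in> S"
      then obtain y where y: "B = hclass x' k y" "\<not> sees x m y x'" using S by blast
      then obtain w where w: "btw y w x'" "d x w < m" unfolding sees_def by (auto simp: not_le)
      have wx: "k \<le> d x' w" using w k d_tri[of x x' w] d_sym[of w x'] by linarith
      have s1: "sees x' k y w" unfolding sees_def
      proof (intro allI impI)
        fix t assume t: "btw y t w"
        have "btw t w x'" using btw_left[OF w(1) t] t w(1) d_sym d_tri[of t x' w] d_tri[of y x' t] by linarith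
        then show "k \<le> d x' t" using wx d_sym[of x' t] d_sym[of x' w] by linarith
      qed
      have s2: "sees x' k w x" unfolding sees_def
      proof (intro allI impI)
        fix t assume t: "btw w t x"
        then show "k \<le> d x' t" using w(2) k d_tri[of x x' t] d_sym[of t x'] d_sym[of t x] d_sym[of w x] by linarith
      qed
      obtain b b1 where b: "cross x' k b b1 y" using cross_exists k(1) sees_level[OF s1] by blast
      obtain e e1 where e: "cross x' k e e1 w" using cross_exists k(1) wx by blast
      have "nbE {c, c1} {e, e1}" by (rule near_sym[OF sees_nb[OF s2 e c]])
      moreover have "nbE {e, e1} {b, b1}" by (rule near_sym[OF sees_nb[OF s1 b e]])
      ultimately have "{b, b1} \<in> R 2 {c, c1}" by (auto simp: eval_nat_numeral)
      then show "reached 2 {{c, c1}} x' k B" unfolding reached_def using y b by blast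
    qed simp_all
  qed
  then show ?thesis by blast
qed

text \<open>\<open>T\<close> covers the vertices that lie behind the ball about \<open>x\<close>
  when viewed from \<open>x'\<close>. The rest is expanded at \<open>x\<close>: level
  \<open>k\<close> gives boundedly many classes, all seeing \<open>x'\<close>, and higher levels
  give only branchings of the boundedly many classes in \<open>T\<close>.\<close>

theorem two_sided:
  "\<exists>Q::nat. \<forall>x x' k. 1 \<le> k \<and> 2 * k < d x x' \<longrightarrow> (\<exists>S T \<alpha>.
     finite S \<and> S \<subseteq> {B\<in>pieces x. k \<le> fst B} \<and> finite T \<and> T \<subseteq> {A\<in>pieces x'. k \<le> fst A} \<and>
     card S + card T \<le> Q * (1 + d x x') \<and> (\<forall>B. \<bar>\<alpha> B\<bar> \<le> (1::real)) \<and>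
     (\<forall>a. 1 = (\<Sum>B\<in>S. \<alpha> B * indicator (snd B) a) + (\<Sum>A\<in>T. indicator (snd A) a)))"
proof -
  obtain Q where Q: "\<And>x x' n a0. n \<le> d x' a0 \<Longrightarrow> finite (branchings x x' n (hclass x' n a0)) \<and>
     card (branchings x x' n (hclass x' n a0)) \<le> Q * (2 * d x x')"
    using branchings_bound by blast
  obtain Q1 where Q1: "\<And>x x' m. 1 \<le> m \<Longrightarrow> finite {hclass x m y | y. sees x m y x'} \<and>
      card {hclass x m y | y. sees x m y x'} \<le> Q1"
    using seen_classes by blast
  obtain Q2 where Q2: "\<And>x x' m k. 1 \<le> k \<and> k + m < d x x' \<Longrightarrow>
     finite {hclass x' k y | y. \<not> sees x m y x'} \<and> card {hclass x' k y | y. \<not> sees x m y x'} \<le> Q2"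
    using hidden_classes by blast
  show ?thesis
  proof (intro exI[of _ "Q1 + Q2 + 2 * Q * Q2"] allI impI)
    fix x x' :: 'v and k :: nat assume k: "1 \<le> k \<and> 2 * k < d x x'"
    define T where "T = (\<lambda>A. (k, A)) ` {hclass x' k y | y. \<not> sees x k y x'}"
    have fT: "finite T" "card T \<le> Q2"
      using Q2[of k k x x'] k card_image_le[of "{hclass x' k y | y. \<not> sees x k y x'}" "\<lambda>A. (k, A)"]
      unfolding T_def by auto
    have Tp: "A \<in> pieces x' \<and> fst A = k" if "A \<in> T" for A
    proof -
      from that obtain y where y: "A = (k, hclass x' k y)" "\<not> sees x k y x'" unfolding T_def by blast
      from y(2) obtain w where w: "btw y w x'" "d x w < k" unfolding sees_def by (auto simp: not_le)
      then have "k \<le> d x' y" using k d_tri[of x x' w] d_sym[of y x'] by linarith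
      then show ?thesis unfolding y pieces_def by auto
    qed
    \<comment> \<open>Classes of one level are disjoint, so \<open>h\<close> is the indicator of the
      complement of the classes in \<open>T\<close>.\<close>
    define h :: "'v \<Rightarrow> real" where "h a = (if (k, hclass x' k a) \<in> T then 0 else 1)" for a
    have hT: "(\<Sum>A\<in>T. indicator (snd A) a) = 1 - h a" for a
    proof -
      have "indicator (snd A) a = (if A = (k, hclass x' k a) then 1 else 0 :: real)" if A: "A \<in> T" for A
      proof -
        obtain y where y: "A = (k, hclass x' k y)" using A unfolding T_def by blast
        have "a \<in> hclass x' k y \<longleftrightarrow> hclass x' k y = hclass x' k a"
        proof
          assume "a \<in> hclass x' k y"
          then show "hclass x' k y = hclass x' k a" by (rule hclass_eqI[symmetric])
        next
          assume "hclass x' k y = hclass x' k a"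
          then show "a \<in> hclass x' k y" by simp
        qed
        then show ?thesis unfolding y indicator_def prod.inject snd_conv by simp
      qed
      then have "(\<Sum>A\<in>T. indicator (snd A) a) = (\<Sum>A\<in>T. if A = (k, hclass x' k a) then 1 else 0 :: real)"
        by (rule sum.cong[OF refl])
      then show ?thesis using fT(1) by (simp add: h_def)
    qed
    have hs: "sees x k a x'" if "h a \<noteq> 0" for a
      using that unfolding h_def T_def by (auto split: if_splits)
    define S where "S = {B\<in>pieces x. tcoeff x k h B \<noteq> 0}"
    define V where "V = (\<lambda>B. (k, B)) ` {hclass x k y | y. sees x k y x'}"
    have fV: "finite V" "card V \<le> Q1"
      using Q1[of k x x'] k card_image_le[of "{hclass x k y | y. sees x k y x'}" "\<lambda>A. (k, A)"]
      unfolding V_def by auto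
    define U where "U = (\<Union>A\<in>T. branchings x x' k (snd A))"
    have br: "finite (branchings x x' k (snd A)) \<and> card (branchings x x' k (snd A)) \<le> Q * (2 * d x x')"
      if "A \<in> T" for A
    proof -
      from Tp[OF that] obtain a where "A = (k, hclass x' k a)" "k \<le> d x' a"
        unfolding pieces_def mem_Collect_eq by (metis fst_conv)
      then show ?thesis using Q[of k x' a x] by simp
    qed
    have fU: "finite U" unfolding U_def using fT br by blast
    have "card U \<le> (\<Sum>A\<in>T. card (branchings x x' k (snd A)))" unfolding U_def by (rule card_UN_le[OF fT(1)])
    also have "\<dots> \<le> (\<Sum>A\<in>T. Q * (2 * d x x'))" by (rule sum_mono) (use br in blast)
    also have "\<dots> \<le> Q2 * (Q * (2 * d x x'))" using fT(2) by simp
    finally have cU: "card U \<le> Q2 * (Q * (2 * d x x'))" .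
    have sub: "S \<subseteq> V \<union> U"
    proof
      fix B assume "B \<in> S"
      then have B: "B \<in> pieces x" "tcoeff x k h B \<noteq> 0" unfolding S_def by auto
      then obtain m y where m: "B = (m, hclass x m y)" "m \<le> d x y" unfolding pieces_def by blast
      show "B \<in> V \<union> U"
      proof (cases "m = k")
        case True
        then have "h (lowest x (hclass x k y)) \<noteq> 0" using B(2) m unfolding tcoeff_def by simp
        then have "sees x k (lowest x (hclass x k y)) x'" by (rule hs)
        moreover have "B = (k, hclass x k (lowest x (hclass x k y)))" using m True by simp
        ultimately show ?thesis unfolding V_def by blast
      next
        case False
        then have km: "k < m" using B(2) m unfolding tcoeff_def by (auto split: if_splits)
        then have ne: "h (lowest x (hclass x m y)) \<noteq> h (plowest x m (hclass x m y))"
          using B(2) m unfolding tcoeff_def by (auto split: if_splits)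
        define p where "p = lowest x (hclass x m y)"
        define q where "q = plowest x m (hclass x m y)"
        \<comment> \<open>A jump of \<open>h\<close> is a jump of the indicator of some class in
          \<open>T\<close>.\<close>
        have "\<exists>A\<in>T. (p \<in> snd A) \<noteq> (q \<in> snd A)"
        proof -
          have *: "\<exists>A\<in>T. (a \<in> snd A) \<noteq> (b \<in> snd A)" if "h a = 0" "h b \<noteq> 0" for a b
          proof -
            have aT: "(k, hclass x' k a) \<in> T" using that unfolding h_def by (auto split: if_splits)
            have "b \<notin> hclass x' k a" using that hclass_eqI[of b x' k a] aT unfolding h_def by auto
            then show ?thesis using aT by (intro bexI[OF _ aT]) simp
          qed
          have "h p = 0 \<or> h q = 0" using ne unfolding h_def p_def q_def by (auto split: if_splits)
          then show ?thesis using *[of p q] *[of q p] ne unfolding p_def q_def by metis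
        qed
        then obtain A where "A \<in> T" "(p \<in> snd A) \<noteq> (q \<in> snd A)" by blast
        then have "B \<in> U" unfolding U_def branchings_def p_def q_def using m km k by auto
        then show ?thesis by blast
      qed
    qed
    have fS: "finite S" using finite_subset[OF sub] fV fU by blast
    have cS: "card S \<le> Q1 + Q2 * (Q * (2 * d x x'))"
      using card_mono[OF _ sub] fV fU cU card_Un_le[of V U] by fastforce
    have kb: "\<bar>tcoeff x k h B\<bar> \<le> 1" for B unfolding tcoeff_def h_def by auto
    have "1 = (\<Sum>B\<in>S. tcoeff x k h B * indicator (snd B) a) + (\<Sum>A\<in>T. indicator (snd A) a)" for a
    proof -
      have "(\<Sum>B\<in>S. tcoeff x k h B * indicator (snd B) a) = (if k \<le> d x a then h a else 0)"
        by (rule telescoping) (use fS in \<open>auto simp: S_def\<close>)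
      \<comment> \<open>A vertex closer than \<open>k\<close> to \<open>x\<close> cannot see
        \<open>x'\<close>, so nothing is lost by starting at level \<open>k\<close>.\<close>
      moreover have "h a = 0" if "\<not> k \<le> d x a" using that hs sees_level by blast
      ultimately show ?thesis using hT by auto
    qed
    moreover have "S \<subseteq> {B\<in>pieces x. k \<le> fst B}" unfolding S_def tcoeff_def by (auto split: if_splits)
    moreover have "T \<subseteq> {A\<in>pieces x'. k \<le> fst A}" using Tp by fastforce
    moreover have "card S + card T \<le> (Q1 + Q2 + 2 * Q * Q2) * (1 + d x x')"
    proof -
      have "card S + card T \<le> Q1 + Q2 * (Q * (2 * d x x')) + Q2" using cS fT(2) by linarith
      also have "\<dots> \<le> (Q1 + Q2 + 2 * Q * Q2) * (1 + d x x')" by (simp add: algebra_simps)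
      finally show ?thesis .
    qed
    ultimately show "\<exists>S T \<alpha>. finite S \<and> S \<subseteq> {B\<in>pieces x. k \<le> fst B} \<and> finite T \<and> T \<subseteq> {A\<in>pieces x'. k \<le> fst A} \<and>
      card S + card T \<le> (Q1 + Q2 + 2 * Q * Q2) * (1 + d x x') \<and> (\<forall>B. \<bar>\<alpha> B\<bar> \<le> (1::real)) \<and>
      (\<forall>a. 1 = (\<Sum>B\<in>S. \<alpha> B * indicator (snd B) a) + (\<Sum>A\<in>T. indicator (snd A) a))"
      using fS fT kb by (intro exI[of _ S] exI[of _ T] exI[of _ "tcoeff x k h"]) blast
  qed
qed

end


section \<open>Square summable families\<close>

definition l2 :: "('i \<Rightarrow> complex) \<Rightarrow> bool" where
  "l2 \<phi> \<longleftrightarrow> (\<lambda>i. (cmod (\<phi> i))\<^sup>2) summable_on UNIV"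

definition nrm :: "('i \<Rightarrow> complex) \<Rightarrow> real" where
  "nrm \<phi> = sqrt (\<Sum>\<^sub>\<infinity>i. (cmod (\<phi> i))\<^sup>2)"

definition inn :: "('i \<Rightarrow> complex) \<Rightarrow> ('i \<Rightarrow> complex) \<Rightarrow> complex" where
  "inn \<phi> \<psi> = (\<Sum>\<^sub>\<infinity>i. \<phi> i * cnj (\<psi> i))"

abbreviation fnrm :: "('i \<Rightarrow> complex) \<Rightarrow> 'i set \<Rightarrow> real" where
  "fnrm \<phi> F \<equiv> L2_set (\<lambda>i. cmod (\<phi> i)) F"

lemma nrm_nonneg [simp]: "0 \<le> nrm \<phi>"
  unfolding nrm_def by (simp add: infsum_nonneg)

lemma nrm_sq: "(nrm \<phi>)\<^sup>2 = (\<Sum>\<^sub>\<infinity>i. (cmod (\<phi> i))\<^sup>2)"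
  unfolding nrm_def by (simp add: infsum_nonneg)

lemma fnrm_sq: "(fnrm \<phi> F)\<^sup>2 = (\<Sum>i\<in>F. (cmod (\<phi> i))\<^sup>2)"
  unfolding L2_set_def by (simp add: sum_nonneg)

lemma fnrm_le_nrm: assumes "l2 \<phi>" "finite F" shows "fnrm \<phi> F \<le> nrm \<phi>"
  unfolding nrm_def L2_set_def
  by (rule real_sqrt_le_mono, rule finite_sum_le_infsum) (use assms in \<open>auto simp: l2_def\<close>)

text \<open>Summability and norm are both read off from finite sections, so that estimates need only
  finite sums.\<close>

lemma nrm_leI:
  assumes "\<And>F. finite F \<Longrightarrow> fnrm \<phi> F \<le> C"
  shows "l2 \<phi>" "nrm \<phi> \<le> C"
proof -
  have C: "0 \<le> C" using assms[of "{}"] by simp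
  have le: "(\<Sum>i\<in>F. (cmod (\<phi> i))\<^sup>2) \<le> C\<^sup>2" if "finite F" for F
    unfolding fnrm_sq[symmetric] using assms[OF that] by (intro power_mono) auto
  show "l2 \<phi>" unfolding l2_def
    by (rule nonneg_bdd_above_summable_on) (auto intro!: bdd_aboveI2[where M = "C\<^sup>2"] le)
  then have "(\<Sum>\<^sub>\<infinity>i. (cmod (\<phi> i))\<^sup>2) \<le> C\<^sup>2"
    unfolding l2_def by (rule infsum_le_finite_sums) (use le in auto)
  then show "nrm \<phi> \<le> C" unfolding nrm_def using C real_le_lsqrt by (simp add: real_le_lsqrt infsum_nonneg)
qed

lemma comp_le_nrm: "l2 \<phi> \<Longrightarrow> cmod (\<phi> i) \<le> nrm \<phi>"
  using fnrm_le_nrm[of \<phi> "{i}"] by simp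

lemma l2_add: assumes "l2 \<phi>" "l2 \<psi>" shows "l2 (\<lambda>i. \<phi> i + \<psi> i)" "nrm (\<lambda>i. \<phi> i + \<psi> i) \<le> nrm \<phi> + nrm \<psi>"
proof -
  have le: "fnrm (\<lambda>i. \<phi> i + \<psi> i) F \<le> nrm \<phi> + nrm \<psi>" if F: "finite F" for F
  proof -
    have "fnrm (\<lambda>i. \<phi> i + \<psi> i) F \<le> L2_set (\<lambda>i. cmod (\<phi> i) + cmod (\<psi> i)) F"
      by (rule L2_set_mono) (auto intro: norm_triangle_ineq)
    also have "\<dots> \<le> fnrm \<phi> F + fnrm \<psi> F" by (rule L2_set_triangle_ineq)
    also have "\<dots> \<le> nrm \<phi> + nrm \<psi>" by (intro add_mono fnrm_le_nrm assms F)
    finally show ?thesis .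
  qed
  show "l2 (\<lambda>i. \<phi> i + \<psi> i)" by (rule nrm_leI(1)[OF le])
  show "nrm (\<lambda>i. \<phi> i + \<psi> i) \<le> nrm \<phi> + nrm \<psi>" by (rule nrm_leI(2)[OF le])
qed

lemma l2_scale: assumes "l2 \<phi>" shows "l2 (\<lambda>i. a * \<phi> i)" "nrm (\<lambda>i. a * \<phi> i) \<le> cmod a * nrm \<phi>"
proof -
  have le: "fnrm (\<lambda>i. a * \<phi> i) F \<le> cmod a * nrm \<phi>" if F: "finite F" for F
    using fnrm_le_nrm[OF assms F] by (simp add: norm_mult L2_set_right_distrib[symmetric] mult_left_mono)
  show "l2 (\<lambda>i. a * \<phi> i)" by (rule nrm_leI(1)[OF le])
  show "nrm (\<lambda>i. a * \<phi> i) \<le> cmod a * nrm \<phi>" by (rule nrm_leI(2)[OF le])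
qed

lemma l2_diff: assumes "l2 \<phi>" "l2 \<psi>" shows "l2 (\<lambda>i. \<phi> i - \<psi> i)"
  using l2_add(1)[OF assms(1) l2_scale(1)[OF assms(2), of "-1"]] by simp

lemma l2_zero: "l2 (\<lambda>_. 0)" "nrm (\<lambda>_. 0) = 0"
  unfolding l2_def nrm_def by auto

lemma l2_mono: assumes "l2 \<phi>" "\<And>i. cmod (\<psi> i) \<le> cmod (\<phi> i)" shows "l2 \<psi>" "nrm \<psi> \<le> nrm \<phi>"
proof -
  have le: "fnrm \<psi> F \<le> nrm \<phi>" if "finite F" for F
    by (rule order_trans[OF L2_set_mono fnrm_le_nrm[OF assms(1) that]]) (use assms in auto)
  show "l2 \<psi>" by (rule nrm_leI(1)[OF le])
  show "nrm \<psi> \<le> nrm \<phi>" by (rule nrm_leI(2)[OF le])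
qed

lemma inn_finite_bound:
  assumes "l2 \<phi>" "l2 \<psi>" "finite F"
  shows "(\<Sum>i\<in>F. cmod (\<phi> i * cnj (\<psi> i))) \<le> nrm \<phi> * nrm \<psi>"
proof -
  have "(\<Sum>i\<in>F. cmod (\<phi> i * cnj (\<psi> i))) = (\<Sum>i\<in>F. \<bar>cmod (\<phi> i)\<bar> * \<bar>cmod (\<psi> i)\<bar>)"
    by (simp add: norm_mult)
  also have "\<dots> \<le> fnrm \<phi> F * fnrm \<psi> F" by (rule L2_set_mult_ineq)
  also have "\<dots> \<le> nrm \<phi> * nrm \<psi>"
    by (intro mult_mono fnrm_le_nrm assms) auto
  finally show ?thesis .
qed

lemma inn_summable:
  assumes "l2 \<phi>" "l2 \<psi>"
  shows "(\<lambda>i. cmod (\<phi> i * cnj (\<psi> i))) summable_on UNIV" "(\<lambda>i. \<phi> i * cnj (\<psi> i)) summable_on UNIV"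
proof -
  show "(\<lambda>i. cmod (\<phi> i * cnj (\<psi> i))) summable_on UNIV"
    unfolding abs_summable_iff_bdd_above
    by (rule bdd_aboveI2[where M = "nrm \<phi> * nrm \<psi>"]) (use inn_finite_bound[OF assms] in auto)
  then show "(\<lambda>i. \<phi> i * cnj (\<psi> i)) summable_on UNIV" by (rule abs_summable_summable)
qed

lemma inn_bound: assumes "l2 \<phi>" "l2 \<psi>" shows "cmod (inn \<phi> \<psi>) \<le> nrm \<phi> * nrm \<psi>"
proof -
  have "cmod (inn \<phi> \<psi>) \<le> (\<Sum>\<^sub>\<infinity>i. cmod (\<phi> i * cnj (\<psi> i)))"
    unfolding inn_def by (rule norm_infsum_bound) (rule inn_summable[OF assms])
  also have "\<dots> \<le> nrm \<phi> * nrm \<psi>"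
    by (rule infsum_le_finite_sums[OF inn_summable(1)[OF assms]]) (use inn_finite_bound[OF assms] in auto)
  finally show ?thesis .
qed

lemma inn_add: "l2 \<phi> \<Longrightarrow> l2 \<psi> \<Longrightarrow> l2 \<theta> \<Longrightarrow> inn (\<lambda>i. \<phi> i + \<psi> i) \<theta> = inn \<phi> \<theta> + inn \<psi> \<theta>"
  unfolding inn_def distrib_right by (rule infsum_add) (auto intro: inn_summable)

lemma inn_scale: "inn (\<lambda>i. a * \<phi> i) \<theta> = a * inn \<phi> \<theta>"
  unfolding inn_def mult.assoc by (rule infsum_cmult_right')

lemma inn_commute: "inn \<psi> \<phi> = cnj (inn \<phi> \<psi>)"
proof -
  have "(\<lambda>i. \<psi> i * cnj (\<phi> i)) = (\<lambda>i. cnj (\<phi> i * cnj (\<psi> i)))" by (auto simp: mult.commute)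
  then show ?thesis unfolding inn_def by (simp only: infsum_cnj)
qed

lemma inn_add_right: "l2 \<phi> \<Longrightarrow> l2 \<psi> \<Longrightarrow> l2 \<theta> \<Longrightarrow> inn \<theta> (\<lambda>i. \<phi> i + \<psi> i) = inn \<theta> \<phi> + inn \<theta> \<psi>"
  unfolding inn_commute[of \<theta>] by (simp add: inn_add)

lemma inn_diff: "l2 \<phi> \<Longrightarrow> l2 \<psi> \<Longrightarrow> l2 \<theta> \<Longrightarrow> inn (\<lambda>i. \<phi> i - \<psi> i) \<theta> = inn \<phi> \<theta> - inn \<psi> \<theta>"
  using inn_add[of \<phi> "\<lambda>i. -1 * \<psi> i" \<theta>] l2_scale(1)[of \<psi> "-1"] inn_scale[of "-1" \<psi> \<theta>] by simp

lemma inn_self: assumes "l2 \<phi>" shows "inn \<phi> \<phi> = complex_of_real ((nrm \<phi>)\<^sup>2)"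
proof -
  have "(\<lambda>i. \<phi> i * cnj (\<phi> i)) = (\<lambda>i. complex_of_real ((cmod (\<phi> i))\<^sup>2))"
    by (intro ext) (metis complex_norm_square of_real_power)
  moreover have "((\<lambda>i. complex_of_real ((cmod (\<phi> i))\<^sup>2)) has_sum complex_of_real (\<Sum>\<^sub>\<infinity>i. (cmod (\<phi> i))\<^sup>2)) UNIV"
    by (rule has_sum_of_real) (use assms has_sum_infsum l2_def in blast)
  ultimately show ?thesis unfolding inn_def nrm_sq by (simp add: infsumI)
qed

lemma nrm_eq_0: "l2 \<phi> \<Longrightarrow> nrm \<phi> = 0 \<Longrightarrow> \<phi> i = 0"
  using comp_le_nrm[of \<phi> i] by simp

section \<open>Restriction to sets of coordinates\<close>

definition restr :: "'i set \<Rightarrow> ('i \<Rightarrow> complex) \<Rightarrow> 'i \<Rightarrow> complex" where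
  "restr F \<phi> i = (if i \<in> F then \<phi> i else 0)"

lemma l2_restr: assumes "l2 \<phi>" shows "l2 (restr F \<phi>)" "nrm (restr F \<phi>) \<le> nrm \<phi>"
  using l2_mono[OF assms, of "restr F \<phi>"] by (auto simp: restr_def)

lemma restr_decomp: "\<phi> = (\<lambda>i. restr F \<phi> i + restr (- F) \<phi> i)"
  by (auto simp: restr_def)

lemma inn_restr: assumes "finite F" shows "inn \<theta> (restr F \<phi>) = (\<Sum>i\<in>F. \<theta> i * cnj (\<phi> i))"
proof -
  have "inn \<theta> (restr F \<phi>) = (\<Sum>\<^sub>\<infinity>i\<in>F. \<theta> i * cnj (\<phi> i))"
    unfolding inn_def by (rule infsum_cong_neutral) (auto simp: restr_def)
  then show ?thesis using assms by simp
qed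

lemma nrm_restr: assumes "l2 \<phi>" "finite F"
  shows "(nrm (restr F \<phi>))\<^sup>2 = (fnrm \<phi> F)\<^sup>2" "(nrm (restr (- F) \<phi>))\<^sup>2 = (nrm \<phi>)\<^sup>2 - (fnrm \<phi> F)\<^sup>2"
proof -
  have "(\<Sum>\<^sub>\<infinity>i. (cmod (restr F \<phi> i))\<^sup>2) = (\<Sum>\<^sub>\<infinity>i\<in>F. (cmod (\<phi> i))\<^sup>2)"
    by (rule infsum_cong_neutral) (auto simp: restr_def)
  then show 1: "(nrm (restr F \<phi>))\<^sup>2 = (fnrm \<phi> F)\<^sup>2" unfolding nrm_sq fnrm_sq using assms by simp
  have "(\<Sum>\<^sub>\<infinity>i. (cmod (\<phi> i))\<^sup>2) = (\<Sum>\<^sub>\<infinity>i. (cmod (restr F \<phi> i))\<^sup>2 + (cmod (restr (- F) \<phi> i))\<^sup>2)"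
    by (rule infsum_cong) (auto simp: restr_def)
  also have "\<dots> = (\<Sum>\<^sub>\<infinity>i. (cmod (restr F \<phi> i))\<^sup>2) + (\<Sum>\<^sub>\<infinity>i. (cmod (restr (- F) \<phi> i))\<^sup>2)"
    by (rule infsum_add) (use l2_restr(1)[OF assms(1)] in \<open>auto simp: l2_def\<close>)
  finally show "(nrm (restr (- F) \<phi>))\<^sup>2 = (nrm \<phi>)\<^sup>2 - (fnrm \<phi> F)\<^sup>2"
    using 1 unfolding nrm_sq by simp
qed

lemma tail_small: assumes "l2 \<phi>" "e > 0" shows "\<exists>F. finite F \<and> nrm (restr (- F) \<phi>) \<le> e"
proof -
  from infsum_finite_approximation[OF assms(1)[unfolded l2_def], of "e\<^sup>2"] assms(2)
  obtain F where F: "finite F" "dist (\<Sum>i\<in>F. (cmod (\<phi> i))\<^sup>2) (\<Sum>\<^sub>\<infinity>i. (cmod (\<phi> i))\<^sup>2) \<le> e\<^sup>2" by auto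
  then have "\<bar>(fnrm \<phi> F)\<^sup>2 - (nrm \<phi>)\<^sup>2\<bar> \<le> e\<^sup>2"
    unfolding nrm_sq fnrm_sq dist_real_def by simp
  then have "(nrm (restr (- F) \<phi>))\<^sup>2 \<le> e\<^sup>2"
    unfolding nrm_restr(2)[OF assms(1) F(1)] by linarith
  then have "nrm (restr (- F) \<phi>) \<le> e" using assms(2) by (simp add: power2_le_iff_abs_le)
  then show ?thesis using F by blast
qed

text \<open>Convergence of each coordinate is part of the conclusion because linear relations pass
  to the limit coordinatewise, in \<open>rel_limit\<close>.\<close>

lemma l2_complete:
  fixes X :: "nat \<Rightarrow> 'i \<Rightarrow> complex"
  assumes "\<And>n. l2 (X n)" "\<And>e. e > 0 \<Longrightarrow> \<exists>N. \<forall>m\<ge>N. \<forall>n\<ge>N. nrm (\<lambda>i. X m i - X n i) < e"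
  shows "\<exists>x. l2 x \<and> (\<forall>i. (\<lambda>n. X n i) \<longlonglongrightarrow> x i) \<and> (\<lambda>n. nrm (\<lambda>i. X n i - x i)) \<longlonglongrightarrow> 0"
proof -
  have comp: "cmod (X m i - X n i) \<le> nrm (\<lambda>i. X m i - X n i)" for m n i
    using comp_le_nrm[OF l2_diff[OF assms(1) assms(1), of m n], of i] .
  have "Cauchy (\<lambda>n. X n i)" for i
  proof (rule CauchyI)
    fix e :: real assume "0 < e"
    from assms(2)[OF this] obtain N where N: "\<forall>m\<ge>N. \<forall>n\<ge>N. nrm (\<lambda>i. X m i - X n i) < e" by blast
    then show "\<exists>M. \<forall>m\<ge>M. \<forall>n\<ge>M. norm (X m i - X n i) < e"
      using comp le_less_trans by blast
  qed
  then have "\<forall>i. \<exists>y. (\<lambda>n. X n i) \<longlonglongrightarrow> y" using Cauchy_convergent unfolding convergent_def by blast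
  then obtain x where x: "\<And>i. (\<lambda>n. X n i) \<longlonglongrightarrow> x i" by metis
  have tail: "l2 (\<lambda>i. X n i - x i) \<and> nrm (\<lambda>i. X n i - x i) \<le> e"
    if N: "\<forall>m\<ge>N. \<forall>n\<ge>N. nrm (\<lambda>i. X m i - X n i) < e" "n \<ge> N" for e N n
  proof -
    have le: "fnrm (\<lambda>i. X n i - x i) F \<le> e" if F: "finite F" for F
    proof (rule tendsto_upperbound)
      show "(\<lambda>m. fnrm (\<lambda>i. X n i - X m i) F) \<longlonglongrightarrow> fnrm (\<lambda>i. X n i - x i) F"
        unfolding L2_set_def by (intro tendsto_intros x)
      show "\<forall>\<^sub>F m in sequentially. fnrm (\<lambda>i. X n i - X m i) F \<le> e"
      proof (rule eventually_sequentiallyI[of N])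
        fix m assume "N \<le> m"
        with N have "nrm (\<lambda>i. X n i - X m i) < e" by blast
        with fnrm_le_nrm[OF l2_diff[OF assms(1) assms(1), of n m] F]
        show "fnrm (\<lambda>i. X n i - X m i) F \<le> e" by linarith
      qed
    qed simp
    show ?thesis by (intro conjI nrm_leI[OF le])
  qed
  obtain N1 where "\<forall>m\<ge>N1. \<forall>n\<ge>N1. nrm (\<lambda>i. X m i - X n i) < 1" using assms(2)[of 1] by auto
  from tail[OF this, of N1] have "l2 (\<lambda>i. X N1 i - x i)" by simp
  from l2_diff[OF assms(1)[of N1] this] have "l2 x" by simp
  moreover have "(\<lambda>n. nrm (\<lambda>i. X n i - x i)) \<longlonglongrightarrow> 0"
  proof (rule LIMSEQ_I)
    fix r :: real assume "0 < r"
    then obtain N where N: "\<forall>m\<ge>N. \<forall>n\<ge>N. nrm (\<lambda>i. X m i - X n i) < r / 2" using assms(2)[of "r / 2"] by auto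
    have "norm (nrm (\<lambda>i. X n i - x i) - 0) < r" if "n \<ge> N" for n
      using tail[OF N that] \<open>0 < r\<close> by simp
    then show "\<exists>no. \<forall>n\<ge>no. norm (nrm (\<lambda>i. X n i - x i) - 0) < r" by blast
  qed
  ultimately show ?thesis using x by blast
qed


section \<open>The Hilbert space of consistent families\<close>

text \<open>\<open>ev I u \<phi> F z\<close>: the linear functional with \<open>u i \<mapsto> \<phi> i\<close> takes the value \<open>z\<close> at \<open>F\<close>. It is a
  relation because \<open>\<phi>\<close> may violate a linear relation between the functions \<open>u i\<close>.\<close>

inductive ev :: "'i set \<Rightarrow> ('i \<Rightarrow> 'g \<Rightarrow> real) \<Rightarrow> ('i \<Rightarrow> complex) \<Rightarrow> ('g \<Rightarrow> real) \<Rightarrow> complex \<Rightarrow> bool"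
  for I u \<phi> where
  zero: "ev I u \<phi> (\<lambda>_. 0) 0"
| step: "ev I u \<phi> F z \<Longrightarrow> i \<in> I \<Longrightarrow> ev I u \<phi> (\<lambda>k. a * u i k + F k) (complex_of_real a * \<phi> i + z)"

lemma ev_single: "i \<in> I \<Longrightarrow> ev I u \<phi> (u i) (\<phi> i)"
  using ev.step[OF ev.zero, of i I u \<phi> 1] by simp

lemma ev_add: "ev I u \<phi> F z \<Longrightarrow> ev I u \<phi> G w \<Longrightarrow> ev I u \<phi> (\<lambda>k. F k + G k) (z + w)"
proof (induction rule: ev.induct)
  case (step F z i a)
  from ev.step[OF step.IH[OF step.prems] step.hyps(2), of a] show ?case by (simp add: add.assoc)
qed simp

lemma ev_scale: "ev I u \<phi> F z \<Longrightarrow> ev I u \<phi> (\<lambda>k. b * F k) (complex_of_real b * z)"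
proof (induction rule: ev.induct)
  case zero
  then show ?case by (simp add: ev.zero)
next
  case (step F z i a)
  from ev.step[OF step.IH step.hyps(2), of "b * a"] show ?case by (simp add: algebra_simps)
qed

lemma ev_sum:
  assumes "finite J" "\<And>j. j \<in> J \<Longrightarrow> ev I u \<phi> (F j) (z j)"
  shows "ev I u \<phi> (\<lambda>k. \<Sum>j\<in>J. \<alpha> j * F j k) (\<Sum>j\<in>J. complex_of_real (\<alpha> j) * z j)"
  using assms
proof (induction J rule: finite_induct)
  case empty
  then show ?case by (simp add: ev.zero)
next
  case (insert j J)
  have "ev I u \<phi> (\<lambda>k. \<alpha> j * F j k) (complex_of_real (\<alpha> j) * z j)"
    by (rule ev_scale) (use insert in blast)
  from ev_add[OF this insert.IH] insert show ?case by simp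
qed

text \<open>By subtraction this is the same as \<open>ev\<close> being single-valued
  (\<open>ev_unique\<close>): \<open>\<phi>\<close> then is a linear functional on the span of the
  \<open>u i\<close>.\<close>

definition rel :: "'i set \<Rightarrow> ('i \<Rightarrow> 'g \<Rightarrow> real) \<Rightarrow> ('i \<Rightarrow> complex) \<Rightarrow> bool" where
  "rel I u \<phi> \<longleftrightarrow> (\<forall>z. ev I u \<phi> (\<lambda>_. 0) z \<longrightarrow> z = 0)"

lemma ev_unique: assumes "rel I u \<phi>" "ev I u \<phi> F z" "ev I u \<phi> F w" shows "z = w"
proof -
  from ev_add[OF assms(2) ev_scale[OF assms(3), of "-1"]] have "ev I u \<phi> (\<lambda>_. 0) (z - w)" by simp
  then show ?thesis using assms(1) unfolding rel_def by auto
qed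

lemma ev_lin:
  "ev I u (\<lambda>i. a * \<phi> i + \<psi> i) F z \<Longrightarrow> \<exists>z1 z2. ev I u \<phi> F z1 \<and> ev I u \<psi> F z2 \<and> z = a * z1 + z2"
proof (induction rule: ev.induct)
  case zero
  then show ?case by (intro exI[of _ 0]) (simp add: ev.zero)
next
  case (step F z i b)
  then obtain z1 z2 where z: "ev I u \<phi> F z1" "ev I u \<psi> F z2" "z = a * z1 + z2" by blast
  from ev.step[OF z(1) step.hyps(2), of b] ev.step[OF z(2) step.hyps(2), of b] z(3) show ?case
    by (intro exI conjI) (assumption | simp add: algebra_simps)+
qed

lemma rel_lin: assumes "rel I u \<phi>" "rel I u \<psi>" shows "rel I u (\<lambda>i. a * \<phi> i + \<psi> i)"
  using assms ev_lin[of I u a \<phi> \<psi>] unfolding rel_def by fastforce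

lemma rel_zero: "rel I u (\<lambda>_. 0)"
proof -
  have "ev I u (\<lambda>_. 0) F z \<Longrightarrow> z = 0" for F z by (induction rule: ev.induct) auto
  then show ?thesis unfolding rel_def by blast
qed

text \<open>One derivation of \<open>ev\<close> is carried out for all \<open>X n\<close>
  simultaneously, and its values converge.\<close>

lemma rel_limit:
  fixes X :: "nat \<Rightarrow> 'i \<Rightarrow> complex"
  assumes "\<And>n. rel I u (X n)" "\<And>i. (\<lambda>n. X n i) \<longlonglongrightarrow> x i" shows "rel I u x"
proof -
  have "ev I u x F z \<Longrightarrow> \<exists>zn. (\<forall>n. ev I u (X n) F (zn n)) \<and> zn \<longlonglongrightarrow> z" for F z
  proof (induction rule: ev.induct)
    case zero
    then show ?case by (intro exI[of _ "\<lambda>_. 0"]) (simp add: ev.zero)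
  next
    case (step F z i a)
    then obtain zn where "\<forall>n. ev I u (X n) F (zn n)" "zn \<longlonglongrightarrow> z" by blast
    then show ?case using step.hyps(2)
      by (intro exI[of _ "\<lambda>n. complex_of_real a * X n i + zn n"]) (auto intro!: ev.step tendsto_intros assms(2))
  qed
  show ?thesis unfolding rel_def
  proof (intro allI impI)
    fix z assume "ev I u x (\<lambda>_. 0) z"
    then obtain zn where "\<forall>n. ev I u (X n) (\<lambda>_. 0) (zn n)" "zn \<longlonglongrightarrow> z"
      using \<open>\<And>F z. ev I u x F z \<Longrightarrow> _\<close> by blast
    moreover from this have "zn = (\<lambda>_. 0)" using assms(1) unfolding rel_def by auto
    ultimately show "z = 0" using LIMSEQ_unique tendsto_const by metis
  qed
qed

lemma rel_integral:
  fixes X :: "'x \<Rightarrow> 'i \<Rightarrow> complex"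
  assumes "\<And>g. rel I u (X g)" "\<And>i. i \<in> I \<Longrightarrow> integrable m (\<lambda>g. X g i)"
    and "\<And>i. i \<in> I \<Longrightarrow> x i = (\<integral>g. X g i \<partial>m)"
  shows "rel I u x"
proof -
  have *: "ev I u x F z \<Longrightarrow> \<exists>\<zeta>. (\<forall>g. ev I u (X g) F (\<zeta> g)) \<and> integrable m \<zeta> \<and> z = (\<integral>g. \<zeta> g \<partial>m)" for F z
  proof (induction rule: ev.induct)
    case zero
    then show ?case by (intro exI[of _ "\<lambda>_. 0"]) (simp add: ev.zero)
  next
    case (step F z i a)
    then obtain \<zeta> where "\<forall>g. ev I u (X g) F (\<zeta> g)" "integrable m \<zeta>" "z = (\<integral>g. \<zeta> g \<partial>m)" by blast
    then show ?case using step.hyps(2) assms(2,3)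
      by (intro exI[of _ "\<lambda>g. complex_of_real a * X g i + \<zeta> g"]) (auto intro!: ev.step)
  qed
  show ?thesis unfolding rel_def
  proof (intro allI impI)
    fix z assume "ev I u x (\<lambda>_. 0) z"
    then obtain \<zeta> where z: "\<forall>g. ev I u (X g) (\<lambda>_. 0) (\<zeta> g)" "z = (\<integral>g. \<zeta> g \<partial>m)"
      using * by blast
    then have "\<zeta> = (\<lambda>_. 0)" using assms(1) unfolding rel_def by auto
    with z(2) show "z = 0" by simp
  qed
qed

text \<open>A vector is a linear functional, for instance a measure, recorded by its values on the
  functions \<open>u i\<close>; coordinates outside \<open>I\<close> are set to 0 to make the record
  unique.\<close>

definition hvectors :: "'i set \<Rightarrow> ('i \<Rightarrow> 'g \<Rightarrow> real) \<Rightarrow> ('i \<Rightarrow> complex) set" where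
  "hvectors I u = {\<phi>. (\<forall>i. i \<notin> I \<longrightarrow> \<phi> i = 0) \<and> l2 \<phi> \<and> rel I u \<phi>}"

definition hspace :: "'i set \<Rightarrow> ('i \<Rightarrow> 'g \<Rightarrow> real) \<Rightarrow> ('i \<Rightarrow> complex) hilbert_struct" where
  "hspace I u = \<lparr>carrier = hvectors I u, add = (\<lambda>\<phi> \<psi> i. \<phi> i + \<psi> i), zero = (\<lambda>_. 0),
     scale = (\<lambda>a \<phi> i. a * \<phi> i), inner_prod = inn\<rparr>"

lemma hspace_simps [simp]:
  "carrier (hspace I u) = hvectors I u" "add (hspace I u) \<phi> \<psi> = (\<lambda>i. \<phi> i + \<psi> i)" "zero (hspace I u) = (\<lambda>_. 0)"
  "scale (hspace I u) a \<phi> = (\<lambda>i. a * \<phi> i)" "inner_prod (hspace I u) = inn"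
  "diff_in (hspace I u) \<phi> \<psi> = (\<lambda>i. \<phi> i - \<psi> i)"
  by (auto simp: hspace_def diff_in_def)

lemma hvectorsD: "\<phi> \<in> hvectors I u \<Longrightarrow> l2 \<phi>" "\<phi> \<in> hvectors I u \<Longrightarrow> rel I u \<phi>" "\<phi> \<in> hvectors I u \<Longrightarrow> i \<notin> I \<Longrightarrow> \<phi> i = 0"
  by (auto simp: hvectors_def)

lemma norm_in_hsp: "l2 \<phi> \<Longrightarrow> norm_in (hspace I u) \<phi> = nrm \<phi>"
  unfolding norm_in_def by (simp add: inn_self)

lemma hvectors_lin: "\<phi> \<in> hvectors I u \<Longrightarrow> \<psi> \<in> hvectors I u \<Longrightarrow> (\<lambda>i. a * \<phi> i + \<psi> i) \<in> hvectors I u"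
  unfolding hvectors_def by (auto intro: l2_add l2_scale rel_lin)

lemma hvectors_0: "(\<lambda>_. 0) \<in> hvectors I u"
  unfolding hvectors_def by (simp add: l2_zero rel_zero)

lemma hvectors_closed:
  assumes "\<phi> \<in> hvectors I u"
  shows "\<psi> \<in> hvectors I u \<Longrightarrow> (\<lambda>i. \<phi> i + \<psi> i) \<in> hvectors I u" "(\<lambda>i. a * \<phi> i) \<in> hvectors I u"
    "\<psi> \<in> hvectors I u \<Longrightarrow> (\<lambda>i. \<phi> i - \<psi> i) \<in> hvectors I u"
proof -
  show "(\<lambda>i. a * \<phi> i) \<in> hvectors I u" using hvectors_lin[OF assms hvectors_0, of a] by simp
  assume p: "\<psi> \<in> hvectors I u"
  show "(\<lambda>i. \<phi> i + \<psi> i) \<in> hvectors I u" using hvectors_lin[OF assms p, of 1] by simp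
  show "(\<lambda>i. \<phi> i - \<psi> i) \<in> hvectors I u" using hvectors_lin[OF p assms, of "-1"] by simp
qed

lemma hspace_hilbert: "complex_hilbert_space (hspace I u)"
proof unfold_locales
  fix x assume x: "x \<in> carrier (hspace I u)"
  show "\<exists>y\<in>carrier (hspace I u). add (hspace I u) x y = zero (hspace I u)"
    using hvectors_closed(2)[of x I u "-1"] x by (intro bexI[of _ "\<lambda>i. - 1 * x i"]) auto
next
  fix x assume "x \<in> carrier (hspace I u)" "x \<noteq> zero (hspace I u)"
  then have x: "l2 x" "x \<noteq> (\<lambda>_. 0)" using hvectorsD by auto
  have "nrm x \<noteq> 0"
  proof
    assume "nrm x = 0"
    then have "x = (\<lambda>_. 0)" by (intro ext nrm_eq_0[OF x(1)])
    with x(2) show False by simp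
  qed
  then show "0 < Re (inner_prod (hspace I u) x x)" using inn_self[OF x(1)] by simp
next
  fix X :: "nat \<Rightarrow> 'a \<Rightarrow> complex"
  assume X: "\<And>n. X n \<in> carrier (hspace I u)"
    and C: "\<And>e. e > 0 \<Longrightarrow> \<exists>N::nat. \<forall>m\<ge>N. \<forall>n\<ge>N. norm_in (hspace I u) (diff_in (hspace I u) (X m) (X n)) < e"
  have l: "l2 (X n)" for n using X hvectorsD by auto
  have "\<exists>N. \<forall>m\<ge>N. \<forall>n\<ge>N. nrm (\<lambda>i. X m i - X n i) < e" if "e > 0" for e
    using C[OF that] norm_in_hsp[OF l2_diff[OF l l], of I u] by simp
  from l2_complete[OF l this] obtain x where x: "l2 x" "\<forall>i. (\<lambda>n. X n i) \<longlonglongrightarrow> x i"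
    "(\<lambda>n. nrm (\<lambda>i. X n i - x i)) \<longlonglongrightarrow> 0" by blast
  have "x i = 0" if "i \<notin> I" for i
  proof -
    have "(\<lambda>n. X n i) = (\<lambda>_. 0)" using X that hvectorsD(3) by fastforce
    then show ?thesis using x(2) LIMSEQ_unique tendsto_const by metis
  qed
  moreover have "rel I u (X n)" for n using hvectorsD(2)[of "X n" I u] X[of n] by simp
  with x(2) have "rel I u x" by (intro rel_limit[of I u X x]) auto
  ultimately have "x \<in> hvectors I u" using x(1) unfolding hvectors_def by blast
  moreover have "(\<lambda>n. norm_in (hspace I u) (diff_in (hspace I u) (X n) x)) \<longlonglongrightarrow> 0"
    using x(3) norm_in_hsp[OF l2_diff[OF l x(1)], of I u] by simp
  ultimately show "\<exists>x\<in>carrier (hspace I u). (\<lambda>n. norm_in (hspace I u) (diff_in (hspace I u) (X n) x)) \<longlonglongrightarrow> 0"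
    by auto
next
  fix x y z assume "x \<in> carrier (hspace I u)" "y \<in> carrier (hspace I u)" "z \<in> carrier (hspace I u)"
  then show "inner_prod (hspace I u) (add (hspace I u) x y) z = inner_prod (hspace I u) x z + inner_prod (hspace I u) y z"
    by (simp add: inn_add hvectorsD(1))
next
  fix x y assume "x \<in> carrier (hspace I u)" "y \<in> carrier (hspace I u)"
  show "inner_prod (hspace I u) y x = cnj (inner_prod (hspace I u) x y)"
    unfolding hspace_simps by (rule inn_commute)
qed (auto simp: hvectors_0 hvectors_closed algebra_simps inn_scale)


section \<open>Weak integrals\<close>

lemma nrm_diff_bound: assumes "l2 \<phi>" "l2 \<psi>" shows "\<bar>nrm \<phi> - nrm \<psi>\<bar> \<le> nrm (\<lambda>i. \<phi> i - \<psi> i)"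
proof -
  have "nrm \<phi> \<le> nrm (\<lambda>i. \<phi> i - \<psi> i) + nrm \<psi>" if "l2 \<phi>" "l2 \<psi>" for \<phi> \<psi> :: "'a \<Rightarrow> complex"
    using l2_add(2)[OF l2_diff[OF that] that(2)] by simp
  from this[OF assms] this[OF assms(2,1)]
  show ?thesis using l2_scale(2)[OF l2_diff[OF assms], of "-1"] by (simp add: minus_diff_commute)
qed

text \<open>Limits are taken along \<open>nhds\<close> and not along sequences, since the group may
  fail to be first countable.\<close>

lemma continuous_of_null:
  fixes f :: "'g::topological_space \<Rightarrow> 'b::real_normed_vector"
  assumes "\<And>g. ((\<lambda>h. e h g) \<longlongrightarrow> 0) (nhds g)" "\<And>h g. norm (f h - f g) \<le> C * e h g"
  shows "continuous_on UNIV f"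
  unfolding continuous_on_def
proof
  fix g
  have "((\<lambda>h. C * e h g) \<longlongrightarrow> 0) (nhds g)" using tendsto_mult_right_zero[OF assms(1)] .
  then have "((\<lambda>h. f h - f g) \<longlongrightarrow> 0) (nhds g)"
    by (rule Lim_null_comparison[rotated]) (use assms(2) in auto)
  then have "(f \<longlongrightarrow> f g) (nhds g)" by (rule LIM_zero_cancel)
  then show "(f \<longlongrightarrow> f g) (at g within UNIV)" by (rule tendsto_mono[OF at_within_le_nhds])
qed

lemma (in finite_measure) integral_const_bound:
  fixes f :: "'a \<Rightarrow> complex"
  assumes "f \<in> borel_measurable M" "AE x in M. norm (f x) \<le> B"
  shows "integrable M f" "norm (\<integral>x. f x \<partial>M) \<le> measure M (space M) * B"
proof -
  show i: "integrable M f" using assms(2,1) by (rule integrable_const_bound)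
  have "norm (\<integral>x. f x \<partial>M) \<le> (\<integral>x. norm (f x) \<partial>M)" by (rule integral_norm_bound)
  also have "\<dots> \<le> (\<integral>x. B \<partial>M)"
    by (rule integral_mono_AE) (use i assms in auto)
  finally show "norm (\<integral>x. f x \<partial>M) \<le> measure M (space M) * B" by simp
qed

text \<open>The coordinatewise integral is the vector sought: it is square summable, inherits the
  relations and commutes with inner products. Testing against the difference of two candidates gives
  uniqueness.\<close>

lemma weak_integral:
  fixes X :: "'g::topological_group_add \<Rightarrow> 'i \<Rightarrow> complex"
  assumes X: "\<And>g. X g \<in> hvectors I u"
    and cont: "\<And>g. ((\<lambda>h. nrm (\<lambda>i. X h i - X g i)) \<longlongrightarrow> 0) (nhds g)"
    and m: "compactly_supported_symmetric_measure m"
  shows "(THE z. z \<in> carrier (hspace I u) \<and> (\<forall>y\<in>carrier (hspace I u).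
           inner_prod (hspace I u) z y = (\<integral>g. inner_prod (hspace I u) (X g) y \<partial>m))) = (\<lambda>i. \<integral>g. X g i \<partial>m)"
    and weak_integral_hvec: "(\<lambda>i. \<integral>g. X g i \<partial>m) \<in> hvectors I u"
proof -
  from m obtain K where K: "compact K" "K \<in> sets borel" "emeasure m (UNIV - K) = 0"
    and sb: "sets m = sets borel" and fm: "finite_measure m"
    unfolding compactly_supported_symmetric_measure_def by blast
  interpret finite_measure m by (rule fm)
  have sp: "space m = UNIV" using sets_eq_imp_space_eq[OF sb] by simp
  have l: "l2 (X g)" for g using X hvectorsD(1) by blast
  have ld: "l2 (\<lambda>i. X h i - X g i)" for h g by (rule l2_diff[OF l l])
  have meas: "f \<in> borel_measurable m" if "continuous_on UNIV f" for f :: "'g \<Rightarrow> complex"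
    using borel_measurable_continuous_onI[OF that] measurable_cong_sets[OF sb refl] by blast
  have "continuous_on UNIV (\<lambda>g. nrm (X g))"
    by (rule continuous_of_null[OF cont, of _ 1]) (use nrm_diff_bound[OF l l] in simp)
  then have "bounded ((\<lambda>g. nrm (X g)) ` K)"
    using K(1) compact_continuous_image compact_imp_bounded continuous_on_subset subset_UNIV by metis
  then obtain M0 where M0: "\<And>g. g \<in> K \<Longrightarrow> nrm (X g) \<le> M0" unfolding bounded_iff by force
  define M where "M = max M0 0"
  have M: "nrm (X g) \<le> M" if "g \<in> K" for g using M0[OF that] unfolding M_def by simp
  have M_nonneg: "0 \<le> M" unfolding M_def by simp
  have ae: "AE g in m. g \<in> K"
    by (rule AE_I[of _ _ "UNIV - K"]) (use K sb in \<open>auto simp: sp\<close>)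
  define W where "W = measure m (space m)"
  have W: "0 \<le> W" unfolding W_def by simp
  have ci: "continuous_on UNIV (\<lambda>g. X g i)" for i
    by (rule continuous_of_null[OF cont, of _ 1]) (use comp_le_nrm[OF ld] in simp)
  have int: "integrable m (\<lambda>g. X g i)" for i
  proof (rule integral_const_bound(1)[OF meas[OF ci], of _ M])
    show "AE g in m. norm (X g i) \<le> M"
      using ae by eventually_elim (use M comp_le_nrm[OF l] order_trans in blast)
  qed
  define z where "z i = (\<integral>g. X g i \<partial>m)" for i
  have fin: "(\<Sum>i\<in>F. z i * cnj (y i)) = (\<integral>g. (\<Sum>i\<in>F. X g i * cnj (y i)) \<partial>m)" for F y
    unfolding z_def using int by (subst Bochner_Integration.integral_sum) auto
  have fint: "integrable m (\<lambda>g. \<Sum>i\<in>F. X g i * cnj (y i))" for F y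
    using int by (intro Bochner_Integration.integrable_sum) auto
  \<comment> \<open>By duality: the section of \<open>z\<close> is paired with itself, the integral
    is taken outside, and one factor \<open>fnrm z F\<close> is cancelled.\<close>
  have zF: "fnrm z F \<le> W * M" if F: "finite F" for F
  proof -
    have "complex_of_real ((fnrm z F)\<^sup>2) = (\<Sum>i\<in>F. z i * cnj (z i))"
      unfolding fnrm_sq by (simp add: complex_norm_square del: of_real_power)
    then have "(fnrm z F)\<^sup>2 = norm (\<integral>g. (\<Sum>i\<in>F. X g i * cnj (z i)) \<partial>m)"
      unfolding fin[symmetric] by (metis abs_of_nonneg norm_of_real zero_le_power2)
    also have "\<dots> \<le> W * (M * fnrm z F)"
      unfolding W_def
    proof (rule integral_const_bound(2))
      show "AE g in m. norm (\<Sum>i\<in>F. X g i * cnj (z i)) \<le> M * fnrm z F"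
        using ae
      proof eventually_elim
        fix g assume g: "g \<in> K"
        have "norm (\<Sum>i\<in>F. X g i * cnj (z i)) \<le> (\<Sum>i\<in>F. \<bar>cmod (X g i)\<bar> * \<bar>cmod (z i)\<bar>)"
          by (rule order_trans[OF norm_sum]) (simp add: norm_mult)
        also have "\<dots> \<le> fnrm (X g) F * fnrm z F" by (rule L2_set_mult_ineq)
        also have "\<dots> \<le> M * fnrm z F"
          by (intro mult_right_mono order_trans[OF fnrm_le_nrm[OF l F] M[OF g]]) auto
        finally show "norm (\<Sum>i\<in>F. X g i * cnj (z i)) \<le> M * fnrm z F" .
      qed
    qed (use fint in auto)
    finally have "fnrm z F * fnrm z F \<le> (W * M) * fnrm z F" by (simp add: power2_eq_square mult.assoc)
    then show ?thesis using W M_nonneg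
      by (metis L2_set_nonneg mult_nonneg_nonneg mult_right_le_imp_le order_le_less)
  qed
  have lz: "l2 z" "nrm z \<le> W * M" by (rule nrm_leI[OF zF], assumption)+
  have "rel I u z" by (rule rel_integral[of I u X m]) (use X hvectorsD(2) int z_def in auto)
  moreover have "z i = 0" if "i \<notin> I" for i
    unfolding z_def using hvectorsD(3)[OF X that] by simp
  ultimately have zv: "z \<in> hvectors I u" using lz unfolding hvectors_def by blast
  then show "(\<lambda>i. \<integral>g. X g i \<partial>m) \<in> hvectors I u" unfolding z_def .
  have inner: "inn z y = (\<integral>g. inn (X g) y \<partial>m)" if y: "l2 y" for y
  proof -
    have ry: "l2 (restr A y)" for A by (rule l2_restr(1)[OF y])
    have cy: "continuous_on UNIV (\<lambda>g. inn (X g) w)" if w: "l2 w" for w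
    proof (rule continuous_of_null[OF cont])
      show "norm (inn (X h) w - inn (X g) w) \<le> nrm w * nrm (\<lambda>i. X h i - X g i)" for h g
        using inn_bound[OF ld w] unfolding inn_diff[OF l l w] by (simp add: mult.commute)
    qed
    have ib: "integrable m (\<lambda>g. inn (X g) w) \<and> norm (\<integral>g. inn (X g) w \<partial>m) \<le> W * (M * nrm w)" if w: "l2 w" for w
    proof -
      have "AE g in m. norm (inn (X g) w) \<le> M * nrm w"
        using ae
      proof eventually_elim
        fix g assume "g \<in> K"
        then have "nrm (X g) * nrm w \<le> M * nrm w" using M by (intro mult_right_mono) auto
        with inn_bound[OF l w, of g] show "norm (inn (X g) w) \<le> M * nrm w" by linarith
      qed
      from integral_const_bound[OF meas[OF cy[OF w]] this] show ?thesis unfolding W_def by blast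
    qed
    \<comment> \<open>Integral and infinite sum are exchanged by approximation: on a finite section
      of \<open>y\<close> the exchange is exact, and the two tails are small.\<close>
    have "norm (inn z y - (\<integral>g. inn (X g) y \<partial>m)) \<le> e * (2 * W * M)" if e: "e > 0" for e
    proof -
      obtain F where F: "finite F" "nrm (restr (- F) y) \<le> e" using tail_small[OF y e] by blast
      have dec: "inn w y = (\<Sum>i\<in>F. w i * cnj (y i)) + inn w (restr (- F) y)" if w: "l2 w" for w
        using inn_add_right[OF ry ry w, of F "- F"] inn_restr[OF F(1), of w y] restr_decomp[of y F] by simp
      have "(\<integral>g. inn (X g) y \<partial>m) = (\<integral>g. (\<Sum>i\<in>F. X g i * cnj (y i)) \<partial>m) + (\<integral>g. inn (X g) (restr (- F) y) \<partial>m)"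
        unfolding dec[OF l] by (rule Bochner_Integration.integral_add) (use fint ib[OF ry] in auto)
      then have "inn z y - (\<integral>g. inn (X g) y \<partial>m) = inn z (restr (- F) y) - (\<integral>g. inn (X g) (restr (- F) y) \<partial>m)"
        unfolding dec[OF lz(1)] fin by simp
      also have "norm \<dots> \<le> nrm z * nrm (restr (- F) y) + W * (M * nrm (restr (- F) y))"
        by (rule norm_triangle_le_diff) (intro add_mono inn_bound lz ry ib[THEN conjunct2])
      also have "\<dots> \<le> (W * M) * e + W * (M * e)"
        by (intro add_mono mult_mono mult_left_mono lz F) (use W M_nonneg in auto)
      finally show ?thesis by (simp add: algebra_simps)
    qed
    moreover have "a \<le> 0" if "\<And>e. e > 0 \<Longrightarrow> a \<le> e * C" "0 \<le> C" for a C :: real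
    proof (rule ccontr)
      assume "\<not> a \<le> 0"
      then have "a > 0" by simp
      with that(1)[of "a / (2 * (C + 1))"] that(2) have "a \<le> a / (2 * (C + 1)) * C" by simp
      also have "\<dots> \<le> a / (2 * (C + 1)) * (C + 1)" using \<open>a > 0\<close> that(2) by (intro mult_left_mono) auto
      also have "\<dots> = a / 2" using that(2) by (simp add: field_simps)
      finally show False using \<open>a > 0\<close> by simp
    qed
    ultimately have "norm (inn z y - (\<integral>g. inn (X g) y \<partial>m)) \<le> 0"
      using W M_nonneg by (metis mult_nonneg_nonneg zero_le_numeral)
    then show ?thesis by simp
  qed
  show "(THE z. z \<in> carrier (hspace I u) \<and> (\<forall>y\<in>carrier (hspace I u).
           inner_prod (hspace I u) z y = (\<integral>g. inner_prod (hspace I u) (X g) y \<partial>m))) = (\<lambda>i. \<integral>g. X g i \<partial>m)"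
    unfolding hspace_simps z_def[symmetric]
  proof (rule the_equality)
    show "z \<in> hvectors I u \<and> (\<forall>y\<in>hvectors I u. inn z y = (\<integral>g. inn (X g) y \<partial>m))"
      using zv inner hvectorsD(1) by blast
  next
    fix w assume w: "w \<in> hvectors I u \<and> (\<forall>y\<in>hvectors I u. inn w y = (\<integral>g. inn (X g) y \<partial>m))"
    define v where "v = (\<lambda>i. w i - z i)"
    have v: "v \<in> hvectors I u" unfolding v_def by (rule hvectors_closed(3)[OF conjunct1[OF w] zv])
    have lv: "l2 v" "l2 w" using hvectorsD(1) v w by blast+
    have "inn w v = inn z v" using w v inner[OF lv(1)] by simp
    then have "inn v v = 0"
      using inn_diff[OF lv(2) lz(1) lv(1)] unfolding v_def by simp
    then have "nrm v = 0" using inn_self[OF lv(1)] by simp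
    then have "w i - z i = 0" for i using nrm_eq_0[OF lv(1)] unfolding v_def by blast
    then show "w = z" by auto
  qed
qed


section \<open>Representations from coherent families\<close>

text \<open>The \<open>u i\<close> stand for weighted indicators of pieces, pulled back to the group
  along an orbit. \<open>R\<close> and \<open>\<rho>\<close> are the data of the Schur test;
  \<open>contr\<close> and \<open>loc_const\<close> yield strong continuity; \<open>i0\<close> is
  the total mass; \<open>pt\<close> makes the point mass at \<open>0\<close> square
  summable.\<close>

locale coherent_family =
  fixes I :: "'i set" and u :: "'i \<Rightarrow> 'g::topological_group_add \<Rightarrow> real"
    and c :: "'g \<Rightarrow> 'i \<Rightarrow> 'i \<Rightarrow> real" and R \<rho> :: "'g \<Rightarrow> real" and i0 :: 'i
  assumes row_fin: "i \<in> I \<Longrightarrow> finite {j\<in>I. c g i j \<noteq> 0}"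
    and row: "i \<in> I \<Longrightarrow> card {j\<in>I. c g i j \<noteq> 0} \<le> R g"
    and transl: "i \<in> I \<Longrightarrow> u i (g + k) = (\<Sum>j\<in>{j\<in>I. c g i j \<noteq> 0}. c g i j * u j k)"
    and col_fin: "j \<in> I \<Longrightarrow> finite {i\<in>I. c g i j \<noteq> 0}"
    and col: "j \<in> I \<Longrightarrow> card {i\<in>I. c g i j \<noteq> 0} \<le> R g"
    and coeff: "i \<in> I \<Longrightarrow> j \<in> I \<Longrightarrow> \<bar>c g i j\<bar> \<le> \<rho> g"
    and contr: "\<forall>\<^sub>F g in nhds 0. R g * \<rho> g \<le> 1"
    and loc_const: "i \<in> I \<Longrightarrow> \<forall>\<^sub>F g in nhds 0. \<forall>k. u i (g + k) = u i k"
    and i0: "i0 \<in> I" "u i0 = (\<lambda>_. 1)"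
    and pt: "finite {i\<in>I. u i 0 \<noteq> 0}"
begin

lemma R_nonneg: "0 \<le> R g" using row[OF i0(1), of g] of_nat_0_le_iff order_trans by blast
lemma \<rho>_nonneg: "0 \<le> \<rho> g" using coeff[OF i0(1) i0(1), of g] abs_ge_zero order_trans by blast

text \<open>As a functional, \<open>rp g \<phi>\<close> evaluates \<open>\<phi>\<close> at
  translates: by \<open>ev_rp\<close> its coordinate at \<open>i\<close> is the value of
  \<open>\<phi>\<close> at \<open>\<lambda>k. u i (g + k)\<close>.\<close>

definition rp :: "'g \<Rightarrow> ('i \<Rightarrow> complex) \<Rightarrow> 'i \<Rightarrow> complex" where
  "rp g \<phi> i = (if i \<in> I then \<Sum>j\<in>{j\<in>I. c g i j \<noteq> 0}. complex_of_real (c g i j) * \<phi> j else 0)"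

text \<open>Schur test: Cauchy-Schwarz in each row costs one factor \<open>R g\<close>, and counting
  the entries of each column after exchanging the sums costs the other.\<close>

lemma rp_fnrm:
  assumes "l2 \<phi>" "finite F" shows "fnrm (rp g \<phi>) F \<le> R g * \<rho> g * nrm \<phi>"
proof -
  define r where "r i = {j\<in>I. c g i j \<noteq> 0}" for i
  define J where "J = (\<Union>i\<in>F \<inter> I. r i)"
  have fJ: "finite J" "J \<subseteq> I" unfolding J_def r_def using assms(2) row_fin by auto
  have comp: "(cmod (rp g \<phi> i))\<^sup>2 \<le> R g * (\<rho> g)\<^sup>2 * (\<Sum>j\<in>J. if c g i j \<noteq> 0 then (cmod (\<phi> j))\<^sup>2 else 0)"
    if i: "i \<in> F \<inter> I" for i
  proof -
    have fr: "finite (r i)" "r i \<subseteq> J" "real (card (r i)) \<le> R g"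
      using row_fin row i unfolding r_def J_def by auto
    have "cmod (rp g \<phi> i) \<le> (\<Sum>j\<in>r i. \<rho> g * cmod (\<phi> j))"
      unfolding rp_def using i r_def
      by (auto simp: norm_mult intro!: sum_norm_le mult_right_mono coeff)
    then have "(cmod (rp g \<phi> i))\<^sup>2 \<le> (\<Sum>j\<in>r i. \<rho> g * cmod (\<phi> j))\<^sup>2" by (intro power_mono) auto
    also have "\<dots> \<le> (\<Sum>j\<in>r i. (\<rho> g * cmod (\<phi> j))\<^sup>2) * card (r i)" by (rule sum_squared_le_sum_of_squares)
    also have "\<dots> \<le> (\<Sum>j\<in>r i. (\<rho> g * cmod (\<phi> j))\<^sup>2) * R g"
      using fr(3) by (intro mult_left_mono sum_nonneg) auto
    also have "\<dots> = R g * (\<rho> g)\<^sup>2 * (\<Sum>j\<in>r i. (cmod (\<phi> j))\<^sup>2)"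
      by (simp add: power_mult_distrib sum_distrib_left[symmetric] mult.commute mult.left_commute)
    also have "(\<Sum>j\<in>r i. (cmod (\<phi> j))\<^sup>2) = (\<Sum>j\<in>J. if c g i j \<noteq> 0 then (cmod (\<phi> j))\<^sup>2 else 0)"
    proof -
      have "r i = {j \<in> J. c g i j \<noteq> 0}" using fr(2) fJ(2) unfolding r_def by blast
      then show ?thesis using sum.inter_filter[OF fJ(1), of "\<lambda>j. (cmod (\<phi> j))\<^sup>2" "\<lambda>j. c g i j \<noteq> 0"] by simp
    qed
    finally show ?thesis .
  qed
  have "(fnrm (rp g \<phi>) F)\<^sup>2 = (\<Sum>i\<in>F \<inter> I. (cmod (rp g \<phi> i))\<^sup>2)"
    unfolding fnrm_sq using assms(2) by (intro sum.mono_neutral_right) (auto simp: rp_def)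
  also have "\<dots> \<le> (\<Sum>i\<in>F \<inter> I. R g * (\<rho> g)\<^sup>2 * (\<Sum>j\<in>J. if c g i j \<noteq> 0 then (cmod (\<phi> j))\<^sup>2 else 0))"
    by (rule sum_mono) (rule comp)
  also have "\<dots> = R g * (\<rho> g)\<^sup>2 * (\<Sum>j\<in>J. \<Sum>i\<in>F \<inter> I. if c g i j \<noteq> 0 then (cmod (\<phi> j))\<^sup>2 else 0)"
    unfolding sum_distrib_left[symmetric] by (subst sum.swap) simp
  also have "\<dots> \<le> R g * (\<rho> g)\<^sup>2 * (\<Sum>j\<in>J. R g * (cmod (\<phi> j))\<^sup>2)"
  proof (intro mult_left_mono sum_mono)
    fix j assume "j \<in> J"
    then have j: "j \<in> I" using fJ by blast
    have "(\<Sum>i\<in>F \<inter> I. if c g i j \<noteq> 0 then (cmod (\<phi> j))\<^sup>2 else 0)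
        = card {i\<in>F \<inter> I. c g i j \<noteq> 0} * (cmod (\<phi> j))\<^sup>2"
      using assms(2) by (simp add: sum.inter_filter[symmetric])
    also have "\<dots> \<le> R g * (cmod (\<phi> j))\<^sup>2"
    proof (intro mult_right_mono)
      have "card {i\<in>F \<inter> I. c g i j \<noteq> 0} \<le> card {i\<in>I. c g i j \<noteq> 0}"
        by (rule card_mono[OF col_fin[OF j]]) auto
      then show "real (card {i\<in>F \<inter> I. c g i j \<noteq> 0}) \<le> R g" using col[OF j, of g] by linarith
    qed simp
    finally show "(\<Sum>i\<in>F \<inter> I. if c g i j \<noteq> 0 then (cmod (\<phi> j))\<^sup>2 else 0) \<le> R g * (cmod (\<phi> j))\<^sup>2" .
  qed (use R_nonneg in auto)
  also have "\<dots> = (R g * \<rho> g)\<^sup>2 * (fnrm \<phi> J)\<^sup>2"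
    unfolding fnrm_sq by (simp add: sum_distrib_left[symmetric] power2_eq_square mult.commute mult.left_commute)
  also have "\<dots> \<le> (R g * \<rho> g)\<^sup>2 * (nrm \<phi>)\<^sup>2"
    by (intro mult_left_mono power_mono fnrm_le_nrm[OF assms(1) fJ(1)]) auto
  finally have "(fnrm (rp g \<phi>) F)\<^sup>2 \<le> (R g * \<rho> g * nrm \<phi>)\<^sup>2" by (simp add: power_mult_distrib)
  then show ?thesis
    by (rule power2_le_imp_le) (simp add: R_nonneg \<rho>_nonneg)
qed

lemma rp_l2: assumes "l2 \<phi>" shows "l2 (rp g \<phi>)" "nrm (rp g \<phi>) \<le> R g * \<rho> g * nrm \<phi>"
  by (rule nrm_leI[OF rp_fnrm[OF assms]], assumption)+

lemma ev_rp: assumes "i \<in> I" shows "ev I u \<phi> (\<lambda>k. u i (g + k)) (rp g \<phi> i)"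
proof -
  have "ev I u \<phi> (\<lambda>k. \<Sum>j\<in>{j\<in>I. c g i j \<noteq> 0}. c g i j * u j k)
      (\<Sum>j\<in>{j\<in>I. c g i j \<noteq> 0}. complex_of_real (c g i j) * \<phi> j)"
    by (rule ev_sum) (use row_fin[OF assms] ev_single in auto)
  then show ?thesis using transl[OF assms] assms by (simp add: rp_def)
qed

lemma ev_rp_trans: "ev I u (rp g \<phi>) F z \<Longrightarrow> ev I u \<phi> (\<lambda>k. F (g + k)) z"
proof (induction rule: ev.induct)
  case zero
  then show ?case by (simp add: ev.zero)
next
  case (step F z i a)
  from ev_add[OF ev_scale[OF ev_rp[OF step.hyps(2)]] step.IH] show ?case .
qed

lemma rp_rel: "rel I u \<phi> \<Longrightarrow> rel I u (rp g \<phi>)"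
  unfolding rel_def using ev_rp_trans[of g \<phi> "\<lambda>_. 0"] by blast

lemma rp_hvec: "\<phi> \<in> hvectors I u \<Longrightarrow> rp g \<phi> \<in> hvectors I u"
  using rp_l2(1) rp_rel by (auto simp: hvectors_def rp_def)

lemma rp_lin: "rp g (\<lambda>i. a * \<phi> i + \<psi> i) = (\<lambda>i. a * rp g \<phi> i + rp g \<psi> i)"
  unfolding rp_def by (auto simp: sum.distrib sum_distrib_left algebra_simps)

lemma rp_add: "rp g (\<lambda>i. \<phi> i + \<psi> i) = (\<lambda>i. rp g \<phi> i + rp g \<psi> i)"
  using rp_lin[of g 1 \<phi> \<psi>] by simp

lemma rp_zero: "rp g (\<lambda>_. 0) = (\<lambda>_. 0)"
  unfolding rp_def by auto

lemma rp_scale: "rp g (\<lambda>i. a * \<phi> i) = (\<lambda>i. a * rp g \<phi> i)"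
  using rp_lin[of g a \<phi> "\<lambda>_. 0"] by (simp add: rp_zero)

lemma rp_diff: "rp g (\<lambda>i. \<phi> i - \<psi> i) = (\<lambda>i. rp g \<phi> i - rp g \<psi> i)"
  using rp_lin[of g "-1" \<psi> \<phi>] by simp

lemma rp_eqI:
  assumes "\<phi> \<in> hvectors I u" "i \<in> I" "ev I u \<phi> (\<lambda>k. u i (g + k)) z" shows "rp g \<phi> i = z"
  using ev_unique[OF hvectorsD(2)[OF assms(1)] ev_rp[OF assms(2)] assms(3)] .

text \<open>Both sides are values of the functional \<open>\<phi>\<close> at the same translate, so
  single-valuedness of \<open>ev\<close> replaces any computation with matrix products.\<close>

lemma rp_hom: assumes "\<phi> \<in> hvectors I u" shows "rp (g + h) \<phi> = rp g (rp h \<phi>)"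
proof
  fix i
  show "rp (g + h) \<phi> i = rp g (rp h \<phi>) i"
  proof (cases "i \<in> I")
    case True
    from ev_rp_trans[OF ev_rp[OF True, of "rp h \<phi>" g]]
    have "ev I u \<phi> (\<lambda>k. u i (g + h + k)) (rp g (rp h \<phi>) i)" by (simp add: add.assoc)
    then show ?thesis by (rule rp_eqI[OF assms True])
  qed (simp add: rp_def)
qed

lemma rp_0: assumes "\<phi> \<in> hvectors I u" shows "rp 0 \<phi> = \<phi>"
proof
  fix i
  show "rp 0 \<phi> i = \<phi> i"
  proof (cases "i \<in> I")
    case True
    then show ?thesis by (intro rp_eqI[OF assms]) (auto intro: ev_single)
  qed (simp add: rp_def hvectorsD(3)[OF assms])
qed

text \<open>For \<open>g\<close> near \<open>0\<close>, finitely many coordinates that carry almost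
  all of the norm stay fixed, and by \<open>contr\<close> the norm does not grow. Hence the
  remaining part of \<open>rp g \<phi>\<close> is as small as that of \<open>\<phi>\<close>.\<close>

lemma rp_near_0:
  assumes \<phi>: "\<phi> \<in> hvectors I u" and e: "e > 0"
  shows "\<forall>\<^sub>F g in nhds 0. nrm (\<lambda>i. rp g \<phi> i - \<phi> i) < e"
proof -
  note l = hvectorsD(1)[OF \<phi>]
  from tail_small[OF l, of "e / 3"] e obtain F where F: "finite F" "nrm (restr (- F) \<phi>) \<le> e / 3" by auto
  have "\<forall>\<^sub>F g in nhds 0. \<forall>i\<in>F \<inter> I. \<forall>k. u i (g + k) = u i k"
    by (rule eventually_ball_finite) (use F loc_const in auto)
  with contr show ?thesis
  proof eventually_elim
    case (elim g)
    have eq: "rp g \<phi> i = \<phi> i" if "i \<in> F" for i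
    proof (cases "i \<in> I")
      case True
      then show ?thesis using elim(2) that by (intro rp_eqI[OF \<phi>]) (auto intro: ev_single)
    qed (simp add: rp_def hvectorsD(3)[OF \<phi>])
    have lr: "l2 (rp g \<phi>)" by (rule rp_l2(1)[OF l])
    have "R g * \<rho> g * nrm \<phi> \<le> 1 * nrm \<phi>" by (rule mult_right_mono) (use elim in auto)
    then have "nrm (rp g \<phi>) \<le> nrm \<phi>" using rp_l2(2)[OF l, of g] by linarith
    then have "(nrm (rp g \<phi>))\<^sup>2 \<le> (nrm \<phi>)\<^sup>2" by (intro power_mono) auto
    moreover have "fnrm (rp g \<phi>) F = fnrm \<phi> F" by (rule L2_set_cong) (use eq in auto)
    ultimately have "(nrm (restr (- F) (rp g \<phi>)))\<^sup>2 \<le> (nrm (restr (- F) \<phi>))\<^sup>2"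
      using nrm_restr(2)[OF lr F(1)] nrm_restr(2)[OF l F(1)] by simp
    then have "nrm (restr (- F) (rp g \<phi>)) \<le> nrm (restr (- F) \<phi>)" by (rule power2_le_imp_le) simp
    moreover have "(\<lambda>i. rp g \<phi> i - \<phi> i) = (\<lambda>i. restr (- F) (rp g \<phi>) i + (-1) * restr (- F) \<phi> i)"
      using eq by (auto simp: restr_def)
    moreover have "nrm (\<lambda>i. restr (- F) (rp g \<phi>) i + (-1) * restr (- F) \<phi> i)
        \<le> nrm (restr (- F) (rp g \<phi>)) + nrm (\<lambda>i. (-1) * restr (- F) \<phi> i)"
      by (intro l2_add l2_scale l2_restr l lr)
    moreover have "nrm (\<lambda>i. (-1) * restr (- F) \<phi> i) \<le> nrm (restr (- F) \<phi>)"
      using l2_scale(2)[OF l2_restr(1)[OF l], of "-1" "- F"] by simp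
    ultimately show "nrm (\<lambda>i. rp g \<phi> i - \<phi> i) < e" using F(2) e by simp
  qed
qed

text \<open>\<open>rp_hom\<close> moves continuity from \<open>g\<close> to \<open>0\<close>, at the
  cost of the fixed factor \<open>R g * \<rho> g\<close>.\<close>

lemma rp_continuous:
  assumes \<phi>: "\<phi> \<in> hvectors I u"
  shows "((\<lambda>h. nrm (\<lambda>i. rp h \<phi> i - rp g \<phi> i)) \<longlongrightarrow> 0) (nhds g)"
proof -
  have "((\<lambda>h. - g + h) \<longlongrightarrow> - g + g) (nhds g)" by (intro tendsto_add tendsto_const filterlim_ident)
  then have lim: "filterlim (\<lambda>h. - g + h) (nhds 0) (nhds g)" by simp
  have "((\<lambda>h. nrm (\<lambda>i. rp h \<phi> i - \<phi> i)) \<longlongrightarrow> 0) (nhds 0)"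
    by (rule tendstoI) (use rp_near_0[OF \<phi>] in simp)
  from filterlim_compose[OF this lim]
  have 0: "((\<lambda>h. R g * \<rho> g * nrm (\<lambda>i. rp (- g + h) \<phi> i - \<phi> i)) \<longlongrightarrow> 0) (nhds g)"
    by (rule tendsto_mult_right_zero)
  have "nrm (\<lambda>i. rp h \<phi> i - rp g \<phi> i) \<le> R g * \<rho> g * nrm (\<lambda>i. rp (- g + h) \<phi> i - \<phi> i)" for h
  proof -
    have "rp h \<phi> = rp g (rp (- g + h) \<phi>)" using rp_hom[OF \<phi>, of g "- g + h"] by (simp add: add.assoc[symmetric])
    then have "(\<lambda>i. rp h \<phi> i - rp g \<phi> i) = rp g (\<lambda>i. rp (- g + h) \<phi> i - \<phi> i)" by (simp add: rp_diff)
    then show ?thesis using rp_l2(2)[OF l2_diff[OF rp_l2(1)[OF hvectorsD(1)[OF \<phi>]] hvectorsD(1)[OF \<phi>]]] by simp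
  qed
  then show ?thesis by (intro Lim_null_comparison[OF _ 0]) auto
qed

lemma rp_op_norm: "op_norm_le (hspace I u) (rp g) (R g * \<rho> g)"
  unfolding op_norm_le_def hspace_simps
  using rp_l2 hvectorsD(1) norm_in_hsp by metis

lemma rp_rep: "strongly_continuous_rep (hspace I u) rp"
  unfolding strongly_continuous_rep_def
proof (intro conjI allI ballI)
  fix g
  show "bounded_operator (hspace I u) (rp g)"
    unfolding bounded_operator_def linear_operator_def
    using rp_op_norm by (auto simp: rp_hvec rp_add rp_scale)
next
  fix \<phi> g assume "\<phi> \<in> carrier (hspace I u)"
  then have \<phi>: "\<phi> \<in> hvectors I u" by simp
  have "norm_in (hspace I u) (diff_in (hspace I u) (rp h \<phi>) (rp g \<phi>)) = nrm (\<lambda>i. rp h \<phi> i - rp g \<phi> i)" for h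
    using norm_in_hsp[OF l2_diff[OF rp_l2(1) rp_l2(1)]] hvectorsD(1)[OF \<phi>] by simp
  then show "((\<lambda>h. norm_in (hspace I u) (diff_in (hspace I u) (rp h \<phi>) (rp g \<phi>))) \<longlongrightarrow> 0) (nhds g)"
    using rp_continuous[OF \<phi>] by simp
qed (auto simp: rp_0 rp_hom)

text \<open>Evaluation at \<open>0\<close>, that is, the point mass at the base vertex: a vector of
  total mass 1 to which the averaging is applied.\<close>

definition dirac :: "'i \<Rightarrow> complex" where
  "dirac i = (if i \<in> I then complex_of_real (u i 0) else 0)"

lemma dirac: "dirac \<in> hvectors I u" "dirac i0 = 1"
proof -
  have "ev I u dirac F z \<Longrightarrow> z = complex_of_real (F 0)" for F z
    by (induction rule: ev.induct) (auto simp: dirac_def)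
  then have "rel I u dirac" unfolding rel_def by fastforce
  moreover have "l2 dirac"
  proof (rule nrm_leI(1))
    let ?S = "{i\<in>I. u i 0 \<noteq> 0}"
    fix F :: "'i set" assume F: "finite F"
    have "(fnrm dirac F)\<^sup>2 = (\<Sum>i\<in>F \<inter> ?S. (cmod (dirac i))\<^sup>2)"
      unfolding fnrm_sq using F by (intro sum.mono_neutral_right) (auto simp: dirac_def)
    also have "\<dots> \<le> (\<Sum>i\<in>?S. (cmod (dirac i))\<^sup>2)" using pt by (intro sum_mono2) auto
    finally have "(fnrm dirac F)\<^sup>2 \<le> (fnrm dirac ?S)\<^sup>2" unfolding fnrm_sq .
    then show "fnrm dirac F \<le> fnrm dirac ?S" by (rule power2_le_imp_le) simp
  qed
  ultimately show "dirac \<in> hvectors I u" unfolding hvectors_def dirac_def by auto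
  show "dirac i0 = 1" unfolding dirac_def using i0 by simp
qed

lemma rp_total: "\<phi> \<in> hvectors I u \<Longrightarrow> rp g \<phi> i0 = \<phi> i0"
  by (intro rp_eqI) (use i0 ev_single[of i0 I u \<phi>] in auto)

end

section \<open>Invariant vectors from strong Property (T)\<close>

lemma trivial_rep: "strongly_continuous_rep (hspace I u) (\<lambda>(_ :: 'g::topological_group_add) \<phi>. \<phi>)"
  unfolding strongly_continuous_rep_def
proof (intro conjI allI ballI)
  have "op_norm_le (hspace I u) (\<lambda>\<phi>. \<phi>) 1" unfolding op_norm_le_def by simp
  then show "bounded_operator (hspace I u) (\<lambda>\<phi>. \<phi>)"
    unfolding bounded_operator_def linear_operator_def by auto
next
  fix \<phi> and g :: 'g assume "\<phi> \<in> carrier (hspace I u)"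
  have "norm_in (hspace I u) (diff_in (hspace I u) \<phi> \<phi>) = 0" using norm_in_hsp[OF l2_zero(1), of I u] l2_zero(2) by simp
  then show "((\<lambda>h. norm_in (hspace I u) (diff_in (hspace I u) \<phi> \<phi>)) \<longlongrightarrow> 0) (nhds g)" by simp
qed auto

lemma norm_in_hvec: "\<phi> \<in> hvectors I u \<Longrightarrow> norm_in (hspace I u) \<phi> = nrm \<phi>"
  by (rule norm_in_hsp) (rule hvectorsD(1))

text \<open>\<open>P dirac\<close> is invariant, and its coordinate at \<open>i0\<close> is the
  limit of the total masses of the measures. The trivial representation on the same space has the
  same \<open>m\<close> and \<open>t\<close>, and its convergence forces this limit to be 1.\<close>

theorem invariant_vector:
  fixes I :: "('g::topological_group_add \<times> nat) set" and u :: "'g \<times> nat \<Rightarrow> 'g \<Rightarrow> real"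
    and l :: "'g \<Rightarrow> real"
  assumes cf: "coherent_family I u c R \<rho> i0"
    and T: "strong_property_T TYPE('g)" and l: "length_function l"
    and growth: "\<And>t. t > 0 \<Longrightarrow> \<exists>L\<ge>0. \<forall>g. R g * \<rho> g \<le> L * exp (t * l g)"
  shows "\<exists>\<phi>\<in>hvectors I u. \<phi> i0 = 1 \<and> (\<forall>g. coherent_family.rp I c g \<phi> = \<phi>)"
proof -
  interpret coherent_family I u c R \<rho> i0 by (rule cf)
  let ?H = "hspace I u"
  from T l obtain m where m: "\<And>n::nat. compactly_supported_symmetric_measure (m n)"
    and mH: "\<And>H :: ('g \<times> nat \<Rightarrow> complex) hilbert_struct. complex_hilbert_space H \<Longrightarrow>
           (\<exists>t>0. \<forall>\<pi> :: 'g \<Rightarrow> ('g \<times> nat \<Rightarrow> complex) \<Rightarrow> ('g \<times> nat \<Rightarrow> complex).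
             strongly_continuous_rep H \<pi> \<and> (\<exists>L\<ge>0. \<forall>g. op_norm_le H (\<pi> g) (L * exp (t * l g))) \<longrightarrow>
             (\<exists>P. projection_on H (invariant_vectors H \<pi>) P \<and>
                  norm_convergent_to H (\<lambda>n. rep_of_measure H \<pi> (m n)) P))"
    unfolding strong_property_T_def by blast
  from mH[OF hspace_hilbert[of I u]] obtain t where t: "t > 0"
    and tP: "\<And>\<pi>. strongly_continuous_rep ?H \<pi> \<Longrightarrow> (\<exists>L\<ge>0. \<forall>g. op_norm_le ?H (\<pi> g) (L * exp (t * l g))) \<Longrightarrow>
       \<exists>P. projection_on ?H (invariant_vectors ?H \<pi>) P \<and> norm_convergent_to ?H (\<lambda>n. rep_of_measure ?H \<pi> (m n)) P"
    by blast
  have lim: "(\<lambda>n. rep_of_measure ?H \<pi> (m n) dirac i0) \<longlonglongrightarrow> P dirac i0"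
    if P: "P dirac \<in> hvectors I u" and conv: "norm_convergent_to ?H (\<lambda>n. rep_of_measure ?H \<pi> (m n)) P"
      and v: "\<And>n. rep_of_measure ?H \<pi> (m n) dirac \<in> hvectors I u" for \<pi> P
  proof (rule tendstoI)
    fix e :: real assume e: "e > 0"
    \<comment> \<open>The added \<open>1\<close> keeps the denominator positive without a lower
      bound for \<open>nrm dirac\<close>.\<close>
    define e' where "e' = e / (nrm dirac + 1)"
    have e': "e' > 0" unfolding e'_def using e by (simp add: add_nonneg_pos)
    from conv e' have "\<forall>\<^sub>F n in sequentially. op_norm_le ?H (\<lambda>x. diff_in ?H (rep_of_measure ?H \<pi> (m n) x) (P x)) e'"
      unfolding norm_convergent_to_def by blast
    then show "\<forall>\<^sub>F n in sequentially. dist (rep_of_measure ?H \<pi> (m n) dirac i0) (P dirac i0) < e"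
    proof eventually_elim
      fix n assume *: "op_norm_le ?H (\<lambda>x. diff_in ?H (rep_of_measure ?H \<pi> (m n) x) (P x)) e'"
      define w where "w = (\<lambda>i. rep_of_measure ?H \<pi> (m n) dirac i - P dirac i)"
      have lw: "l2 w" unfolding w_def by (intro l2_diff) (use v P hvectorsD(1) in blast)+
      have "norm_in ?H w \<le> e' * norm_in ?H dirac"
        using * dirac(1) unfolding op_norm_le_def w_def by simp
      then have "nrm w \<le> e' * nrm dirac" using norm_in_hsp[OF lw] norm_in_hsp[OF hvectorsD(1)[OF dirac(1)]] by metis
      also have "\<dots> < e' * (nrm dirac + 1)" using e' by simp
      also have "\<dots> = e"
      proof -
        have "nrm dirac + 1 \<noteq> 0" using nrm_nonneg[of dirac] by linarith
        then show ?thesis unfolding e'_def by simp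
      qed
      finally have "nrm w < e" .
      then show "dist (rep_of_measure ?H \<pi> (m n) dirac i0) (P dirac i0) < e"
        using comp_le_nrm[OF lw, of i0] unfolding w_def dist_norm by linarith
    qed
  qed
  have rom: "rep_of_measure ?H \<pi> (m n) dirac = (\<lambda>i. \<integral>g. \<pi> g dirac i \<partial>m n)"
    if "\<And>g. \<pi> g dirac \<in> hvectors I u" "\<And>g. ((\<lambda>h. nrm (\<lambda>i. \<pi> h dirac i - \<pi> g dirac i)) \<longlongrightarrow> 0) (nhds g)" for \<pi> n
    unfolding rep_of_measure_def by (rule weak_integral[of "\<lambda>g. \<pi> g dirac", OF that m])
  have romv: "rep_of_measure ?H \<pi> (m n) dirac \<in> hvectors I u"
    if "\<And>g. \<pi> g dirac \<in> hvectors I u" "\<And>g. ((\<lambda>h. nrm (\<lambda>i. \<pi> h dirac i - \<pi> g dirac i)) \<longlongrightarrow> 0) (nhds g)" for \<pi> n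
    unfolding rom[of \<pi>, OF that] by (rule weak_integral_hvec[of "\<lambda>g. \<pi> g dirac", OF that m])
  have P_in: "P dirac \<in> invariant_vectors ?H \<pi>" if "projection_on ?H (invariant_vectors ?H \<pi>) P" for P \<pi>
    using that dirac(1) unfolding projection_on_def by auto
  have inv_sub: "invariant_vectors ?H \<pi> \<subseteq> hvectors I u" for \<pi>
    unfolding invariant_vectors_def by auto

  define idr :: "'g \<Rightarrow> ('g \<times> nat \<Rightarrow> complex) \<Rightarrow> 'g \<times> nat \<Rightarrow> complex" where "idr = (\<lambda>_ \<phi>. \<phi>)"
  have idr [simp]: "idr g \<phi> = \<phi>" for g \<phi> unfolding idr_def by simp
  have idr_rep: "strongly_continuous_rep ?H idr" unfolding idr_def by (rule trivial_rep)
  have ex1: "1 \<le> exp (t * l g)" for g using t l unfolding length_function_def by simp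
  have "\<exists>L\<ge>0. \<forall>g. op_norm_le ?H (idr g) (L * exp (t * l g))"
    unfolding op_norm_le_def
  proof (intro exI[of _ 1] conjI allI ballI)
    fix g \<phi> assume "\<phi> \<in> carrier ?H"
    then have "0 \<le> norm_in ?H \<phi>" by (simp add: norm_in_hvec)
    with ex1 show "norm_in ?H (idr g \<phi>) \<le> 1 * exp (t * l g) * norm_in ?H \<phi>"
      by (simp add: mult_le_cancel_right1)
  qed simp
  from tP[OF idr_rep this] obtain P0 where
    P0: "projection_on ?H (invariant_vectors ?H idr) P0"
      "norm_convergent_to ?H (\<lambda>n. rep_of_measure ?H idr (m n)) P0" by blast
  \<comment> \<open>Every vector is invariant under \<open>idr\<close>, so the idempotent
    \<open>P0\<close> maps onto the whole space and is the identity there.\<close>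
  have "P0 dirac = dirac"
  proof -
    have "dirac \<in> invariant_vectors ?H idr" unfolding invariant_vectors_def using dirac by simp
    then obtain w where "w \<in> carrier ?H" "dirac = P0 w" using P0(1) unfolding projection_on_def by blast
    then show ?thesis using P0(1) unfolding projection_on_def by metis
  qed
  have triv: "((\<lambda>h. nrm (\<lambda>i. idr h dirac i - idr g dirac i)) \<longlongrightarrow> 0) (nhds g)" for g by (simp add: l2_zero)
  have idv: "idr g dirac \<in> hvectors I u" for g using dirac(1) by simp
  have "(\<lambda>n. rep_of_measure ?H idr (m n) dirac i0) \<longlonglongrightarrow> P0 dirac i0"
    by (rule lim[OF _ P0(2) romv[of idr, OF idv triv]]) (use dirac \<open>P0 dirac = dirac\<close> in simp)
  then have mass: "(\<lambda>n. \<integral>g. (1::complex) \<partial>m n) \<longlonglongrightarrow> 1"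
    unfolding rom[of idr, OF idv triv] \<open>P0 dirac = dirac\<close> using dirac(2) by simp

  from growth[OF t] obtain L where L: "L \<ge> 0" "\<And>g. R g * \<rho> g \<le> L * exp (t * l g)" by blast
  have "op_norm_le ?H (rp g) (L * exp (t * l g))" for g
    unfolding op_norm_le_def
  proof
    fix \<phi> assume \<phi>: "\<phi> \<in> carrier ?H"
    have "norm_in ?H (rp g \<phi>) \<le> R g * \<rho> g * norm_in ?H \<phi>" using rp_op_norm \<phi> unfolding op_norm_le_def by blast
    also have "\<dots> \<le> L * exp (t * l g) * norm_in ?H \<phi>"
      by (rule mult_right_mono[OF L(2)]) (use \<phi> in \<open>simp add: norm_in_hvec\<close>)
    finally show "norm_in ?H (rp g \<phi>) \<le> L * exp (t * l g) * norm_in ?H \<phi>" .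
  qed
  then have "\<exists>L\<ge>0. \<forall>g. op_norm_le ?H (rp g) (L * exp (t * l g))" using L(1) by blast
  from tP[OF rp_rep this] obtain P where
    P: "projection_on ?H (invariant_vectors ?H rp) P"
      "norm_convergent_to ?H (\<lambda>n. rep_of_measure ?H rp (m n)) P" by blast
  have Pv: "P dirac \<in> hvectors I u" using P_in[OF P(1)] inv_sub by blast
  have "(\<lambda>n. rep_of_measure ?H rp (m n) dirac i0) \<longlonglongrightarrow> P dirac i0"
    by (rule lim[OF Pv P(2) romv[of rp, OF rp_hvec[OF dirac(1)] rp_continuous[OF dirac(1)]]])
  moreover have "rep_of_measure ?H rp (m n) dirac i0 = (\<integral>g. 1 \<partial>m n)" for n
    unfolding rom[of rp, OF rp_hvec[OF dirac(1)] rp_continuous[OF dirac(1)]] using rp_total[OF dirac(1)] dirac(2) by simp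
  ultimately have "P dirac i0 = 1" using mass LIMSEQ_unique by simp
  moreover have "rp g (P dirac) = P dirac" for g using P_in[OF P(1)] unfolding invariant_vectors_def by blast
  ultimately show ?thesis using Pv by blast
qed


section \<open>Actions on uniformly fine hyperbolic graphs\<close>

locale fine_hyperbolic_action = fine_hyperbolic E for E :: "'v set set" +
  fixes act :: "'g::topological_group_add \<Rightarrow> 'v \<Rightarrow> 'v" and x0 :: 'v
  assumes iso: "isometric_action E act"
begin

lemma act: "act 0 x = x" "act (g + h) x = act g (act h x)" "d (act g x) (act g y) = d x y"
  "open {g. act g x = y}"
  using iso unfolding isometric_action_def by blast+

lemma act_minus [simp]: "act g (act (- g) x) = x" "act (- g) (act g x) = x"
  using act(1,2) by (metis add.right_inverse, metis add.left_inverse)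

lemma hclass_act: "act g b \<in> hclass (act g x) n (act g a) \<longleftrightarrow> b \<in> hclass x n a"
proof -
  have 1: "act g b \<in> hclass (act g x) n (act g a)" if "b \<in> hclass x n a" for g a b x
    unfolding hclass_def
  proof (intro CollectI allI impI)
    fix u assume "d (act g x) u \<le> n"
    then have "d x (act (- g) u) \<le> n" using act(3)[of g x "act (- g) u"] by simp
    from hclassD[OF that this] show "d (act g a) u + d (act g b) (act g x) = d (act g b) u + d (act g a) (act g x)"
      using act(3)[of g _ "act (- g) u"] by (simp add: act(3))
  qed
  show ?thesis using 1[of b x a g] 1[of "act g b" "act g x" "act g a" "- g"] by auto
qed

definition orb :: "'g \<Rightarrow> 'v" where "orb g = act g x0"

text \<open>With \<open>- g\<close>, because \<open>rp g\<close> compares the base points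
  \<open>x0\<close> and \<open>act (- g) x0\<close>; the pieces of the latter are the sets
  \<open>tpiece g i\<close>.\<close>

definition disp :: "'g \<Rightarrow> nat" where "disp g = d x0 (act (- g) x0)"

lemma disp_eq: "disp g = d x0 (orb g)"
  unfolding disp_def orb_def using act(3)[of g x0 "act (- g) x0"] d_sym[of "act g x0" x0]
  unfolding act_minus by linarith

lemma orb_add: "orb (g + h) = act g (orb h)"
  unfolding orb_def by (rule act(2))

text \<open>Continuity is local constancy: the elements that move \<open>x0\<close> to a given
  vertex form an open set.\<close>

lemma length_disp: "length_function (\<lambda>g. real (disp g))"
  unfolding length_function_def
proof (intro conjI allI)
  show "continuous_on UNIV (\<lambda>g. real (disp g))"
    unfolding continuous_on_def
  proof
    fix g
    have "\<forall>\<^sub>F h in nhds g. h \<in> {h. act h x0 = act g x0}"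
      by (rule eventually_nhds_in_open) (use act(4) in auto)
    then have "\<forall>\<^sub>F h in nhds g. real (disp h) = real (disp g)"
      by eventually_elim (simp add: disp_eq orb_def)
    then have "((\<lambda>h. real (disp h)) \<longlongrightarrow> real (disp g)) (nhds g)" by (rule tendsto_eventually)
    then show "((\<lambda>h. real (disp h)) \<longlongrightarrow> real (disp g)) (at g within UNIV)"
      by (rule tendsto_mono[OF at_within_le_nhds])
  qed
next
  fix g
  have "disp (- g) = d x0 (act g x0)" unfolding disp_def by simp
  then show "real (disp (- g)) = real (disp g)" by (simp add: disp_eq[of g] orb_def)
next
  fix g h
  have "d x0 (orb (g + h)) \<le> d x0 (orb g) + d x0 (orb h)"
    using d_tri[of x0 "orb (g + h)" "orb g"] act(3)[of g x0 "orb h"] unfolding orb_add by (simp add: orb_def)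
  then show "real (disp (g + h)) \<le> real (disp g) + real (disp h)" unfolding disp_eq by linarith
qed simp

text \<open>Indexing by a group element and a level places the Hilbert space on functions of
  \<open>'g \<times> nat\<close>, as \<open>strong_property_T\<close> demands; only classes that
  meet the orbit receive an index.\<close>

definition piece :: "'g \<times> nat \<Rightarrow> nat \<times> 'v set" where
  "piece i = (snd i, hclass x0 (snd i) (orb (fst i)))"

definition tpiece :: "'g \<Rightarrow> 'g \<times> nat \<Rightarrow> nat \<times> 'v set" where
  "tpiece g i = (snd i, hclass (act (- g) x0) (snd i) (act (- g) (orb (fst i))))"

definition adm :: "('g \<times> nat) set" where "adm = {i. snd i \<le> d x0 (orb (fst i))}"

lemma tpiece_mem: "b \<in> snd (tpiece g i) \<longleftrightarrow> act g b \<in> snd (piece i)"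
  using hclass_act[of g b "act (- g) x0" "snd i" "act (- g) (orb (fst i))"] unfolding tpiece_def piece_def by simp

lemma tpiece_eq_iff: "tpiece g i = tpiece g j \<longleftrightarrow> piece i = piece j"
proof -
  have "snd (tpiece g i) = act g -` snd (piece i)" for i using tpiece_mem by blast
  moreover have "surj (act g)" using act_minus(1) by (metis surjI)
  ultimately have "snd (tpiece g i) = snd (tpiece g j) \<longleftrightarrow> snd (piece i) = snd (piece j)"
    by (metis surj_image_vimage_eq)
  moreover have "fst (tpiece g i) = fst (piece i)" for i unfolding tpiece_def piece_def by simp
  ultimately show ?thesis by (simp add: prod_eq_iff)
qed

lemma piece_pcs: "i \<in> adm \<Longrightarrow> piece i \<in> pieces x0"
  unfolding piece_def adm_def pieces_def by auto

lemma tpiece_pcs: "i \<in> adm \<Longrightarrow> tpiece g i \<in> pieces (act (- g) x0)"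
  unfolding tpiece_def adm_def pieces_def using act(3)[of "- g" x0] by auto

lemma pieces_orb: assumes "B \<in> pieces x0" "orb k \<in> snd B" shows "\<exists>i\<in>adm. B = piece i"
proof -
  have "(fst B, snd B) \<in> pieces x0" using assms by simp
  from pieces_mem[OF this assms(2)] show ?thesis
    by (intro bexI[of _ "(k, fst B)"]) (auto simp: piece_def adm_def prod_eq_iff)
qed

lemma pieces_orb_translate: assumes "B \<in> pieces (act (- g) x0)" "orb k \<in> snd B" shows "\<exists>i\<in>adm. B = tpiece g i"
proof -
  have "(fst B, snd B) \<in> pieces (act (- g) x0)" using assms by simp
  from pieces_mem[OF this assms(2)] show ?thesis
    using act(3)[of g "act (- g) x0" "orb k"]
    by (intro bexI[of _ "(g + k, fst B)"]) (auto simp: tpiece_def adm_def prod_eq_iff orb_add)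
qed

text \<open>Polynomial, so that the representation grows subexponentially, but large enough to beat the
  linear number of terms in \<open>two_sided\<close>.\<close>

definition weight :: "nat \<Rightarrow> real" where "weight n = (1 + real n)\<^sup>2"

text \<open>Short for weighted indicator; this is the family \<open>u\<close> of
  \<open>coherent_family\<close>.\<close>

definition wind :: "'g \<times> nat \<Rightarrow> 'g \<Rightarrow> real" where
  "wind i k = weight (snd i) * indicator (snd (piece i)) (orb k)"

lemma weight_pos [simp]: "0 < weight n" unfolding weight_def by (simp add: add_pos_nonneg)

lemma weight_nz [simp]: "weight n \<noteq> 0" using weight_pos[of n] by linarith

lemma wind_translate: "wind i (g + k) = weight (snd i) * indicator (snd (tpiece g i)) (orb k)"
  unfolding wind_def orb_add by (simp add: tpiece_mem indicator_def)

text \<open>Many indices can name one piece. Keeping one for each transfers the row and column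
  counts from pieces to indices.\<close>

definition reps :: "('g \<times> nat) set" where
  "reps = (SOME I. I \<subseteq> adm \<and> inj_on piece I \<and> piece ` adm = piece ` I)"

lemma reps: "reps \<subseteq> adm" "inj_on piece reps" "piece ` adm = piece ` reps"
proof -
  have "\<exists>I. I \<subseteq> adm \<and> inj_on piece I \<and> piece ` adm = piece ` I"
    using subset_image_inj[of "piece ` adm" piece adm] by simp
  from someI_ex[OF this] show "reps \<subseteq> adm" "inj_on piece reps" "piece ` adm = piece ` reps"
    unfolding reps_def by blast+
qed

lemma reps_tpiece: "inj_on (tpiece g) reps" "i \<in> adm \<Longrightarrow> \<exists>j\<in>reps. tpiece g i = tpiece g j"
proof -
  show "inj_on (tpiece g) reps" using reps(2) by (simp add: inj_on_def tpiece_eq_iff)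
  assume "i \<in> adm"
  then have "piece i \<in> piece ` reps" using reps(3) by blast
  then show "\<exists>j\<in>reps. tpiece g i = tpiece g j" unfolding tpiece_eq_iff by blast
qed

text \<open>The matrix is the base change between \<open>x0\<close> and \<open>act (- g) x0\<close>,
  conjugated by the weights. As a nonzero entry has \<open>snd i \<le> snd j + disp g\<close>, the
  conjugation costs at most the factor \<open>weight (disp g)\<close>.\<close>

lemma coherent:
  "\<exists>Q::nat. \<exists>c i0. coherent_family reps wind c (\<lambda>g. 1 + real Q * real (disp g)) (\<lambda>g. weight (disp g)) i0"
proof -
  obtain Q cc where cc: "\<And>x x'. base_change_coeffs Q x x' (cc x x')"
    using base_change by metis
  have row: "A \<in> pieces x' \<Longrightarrow> finite {B\<in>pieces x. cc x x' A B \<noteq> 0}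
        \<and> card {B\<in>pieces x. cc x x' A B \<noteq> 0} \<le> 1 + Q * d x x' \<and>
        (\<forall>a. indicator (snd A) a = (\<Sum>B\<in>{B\<in>pieces x. cc x x' A B \<noteq> 0}. cc x x' A B * indicator (snd B) a :: real))"
    and col: "B \<in> pieces x \<Longrightarrow> finite {A\<in>pieces x'. cc x x' A B \<noteq> 0} \<and> card {A\<in>pieces x'. cc x x' A B \<noteq> 0} \<le> 1 + Q * d x x'"
    and bd: "A \<in> pieces x' \<Longrightarrow> B \<in> pieces x \<Longrightarrow> \<bar>cc x x' A B\<bar> \<le> 1 \<and> (cc x x' A B \<noteq> 0 \<longrightarrow> fst A \<le> fst B + d x x')"
    for x x' A B
    using cc[of x x'] unfolding base_change_coeffs_def by blast+
  define b where "b g i j = cc x0 (act (- g) x0) (tpiece g i) (piece j)" for g i j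
  define c where "c g i j = b g i j * (weight (snd i) / weight (snd j))" for g i j
  have nz: "c g i j \<noteq> 0 \<longleftrightarrow> b g i j \<noteq> 0" for g i j unfolding c_def by simp
  obtain i0 where i0: "i0 \<in> reps" "piece i0 = (0, UNIV)"
  proof -
    have "(0, 0) \<in> adm" unfolding adm_def by simp
    then have "piece (0, 0) \<in> piece ` reps" using reps(3) by blast
    then show ?thesis using that unfolding piece_def by (auto simp: hclass_0 image_iff)
  qed
  have si0: "snd i0 = 0" using i0(2) unfolding piece_def by simp
  have R: "{j\<in>reps. c g i j \<noteq> 0} \<subseteq> reps"
    "piece ` {j\<in>reps. c g i j \<noteq> 0} \<subseteq> {B\<in>pieces x0. cc x0 (act (- g) x0) (tpiece g i) B \<noteq> 0}" for g i
    using piece_pcs reps(1) unfolding nz b_def by auto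
  have C: "tpiece g ` {i\<in>reps. c g i j \<noteq> 0} \<subseteq> {A\<in>pieces (act (- g) x0). cc x0 (act (- g) x0) A (piece j) \<noteq> 0}" for g j
    using tpiece_pcs reps(1) unfolding nz b_def by auto
  have injR: "inj_on piece {j\<in>reps. c g i j \<noteq> 0}" for g i by (rule inj_on_subset[OF reps(2)]) auto
  have injC: "inj_on (tpiece g) {i\<in>reps. c g i j \<noteq> 0}" for g j by (rule inj_on_subset[OF reps_tpiece(1)]) auto
  have bound: "finite X \<and> real (card X) \<le> 1 + real Q * real (disp g)"
    if "f ` X \<subseteq> Y" "inj_on f X" "finite Y" "card Y \<le> 1 + Q * d x0 (act (- g) x0)"
    for X Y g and f :: "'g \<times> nat \<Rightarrow> nat \<times> 'v set"
  proof
    show "finite X" using that finite_imageD finite_subset by blast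
    have "card X \<le> 1 + Q * d x0 (act (- g) x0)"
      using card_image[OF that(2)] card_mono[OF that(3,1)] that(4) by simp
    then have "real (card X) \<le> real (1 + Q * d x0 (act (- g) x0))" by (rule of_nat_mono)
    then show "real (card X) \<le> 1 + real Q * real (disp g)" unfolding disp_def by simp
  qed
  have rowb: "finite {j\<in>reps. c g i j \<noteq> 0} \<and> real (card {j\<in>reps. c g i j \<noteq> 0}) \<le> 1 + real Q * real (disp g)"
    if "i \<in> reps" for g i
  proof (rule bound[OF R(2) injR])
    have "tpiece g i \<in> pieces (act (- g) x0)" using tpiece_pcs reps(1) that by blast
    from row[OF this] show "finite {B\<in>pieces x0. cc x0 (act (- g) x0) (tpiece g i) B \<noteq> 0}"
      "card {B\<in>pieces x0. cc x0 (act (- g) x0) (tpiece g i) B \<noteq> 0} \<le> 1 + Q * d x0 (act (- g) x0)" by blast+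
  qed
  have colb: "finite {i\<in>reps. c g i j \<noteq> 0} \<and> real (card {i\<in>reps. c g i j \<noteq> 0}) \<le> 1 + real Q * real (disp g)"
    if "j \<in> reps" for g j
  proof (rule bound[OF C injC])
    have "piece j \<in> pieces x0" using piece_pcs reps(1) that by blast
    from col[OF this] show "finite {A\<in>pieces (act (- g) x0). cc x0 (act (- g) x0) A (piece j) \<noteq> 0}"
      "card {A\<in>pieces (act (- g) x0). cc x0 (act (- g) x0) A (piece j) \<noteq> 0} \<le> 1 + Q * d x0 (act (- g) x0)" by blast+
  qed
  have "coherent_family reps wind c (\<lambda>g. 1 + real Q * real (disp g)) (\<lambda>g. weight (disp g)) i0"
  proof
    fix i g k assume i: "i \<in> reps"
    have tp: "tpiece g i \<in> pieces (act (- g) x0)" using tpiece_pcs reps(1) i by blast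
    let ?S = "{B\<in>pieces x0. cc x0 (act (- g) x0) (tpiece g i) B \<noteq> 0}"
    let ?J = "{j\<in>reps. c g i j \<noteq> 0}"
    have fS: "finite ?S" using row[OF tp] by blast
    have "indicator (snd (tpiece g i)) (orb k) = (\<Sum>B\<in>?S. cc x0 (act (- g) x0) (tpiece g i) B * indicator (snd B) (orb k))"
      using row[OF tp] by blast
    \<comment> \<open>Pieces that miss the orbit vanish at \<open>orb k\<close> and can be left
      out.\<close>
    also have "\<dots> = (\<Sum>B\<in>piece ` ?J. cc x0 (act (- g) x0) (tpiece g i) B * indicator (snd B) (orb k))"
    proof (rule sum.mono_neutral_right[OF fS R(2)])
      show "\<forall>B\<in>?S - piece ` ?J. cc x0 (act (- g) x0) (tpiece g i) B * indicator (snd B) (orb k) = 0"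
      proof
        fix B assume B: "B \<in> ?S - piece ` ?J"
        have "orb k \<notin> snd B"
        proof
          assume "orb k \<in> snd B"
          then have "B \<in> piece ` adm" using pieces_orb B by blast
          then obtain j where "j \<in> reps" "B = piece j" using reps(3) by auto
          with B show False unfolding nz b_def by auto
        qed
        then show "cc x0 (act (- g) x0) (tpiece g i) B * indicator (snd B) (orb k) = 0" by simp
      qed
    qed
    also have "\<dots> = (\<Sum>j\<in>?J. b g i j * indicator (snd (piece j)) (orb k))"
      unfolding b_def by (subst sum.reindex[OF injR]) simp
    finally have "wind i (g + k) = (\<Sum>j\<in>?J. weight (snd i) * (b g i j * indicator (snd (piece j)) (orb k)))"
      unfolding wind_translate by (simp add: sum_distrib_left)
    then show "wind i (g + k) = (\<Sum>j\<in>?J. c g i j * wind j k)"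
      by (simp add: c_def wind_def mult.assoc mult.left_commute)
  next
    fix i j g assume ij: "i \<in> reps" "j \<in> reps"
    have bb: "\<bar>b g i j\<bar> \<le> 1" "b g i j \<noteq> 0 \<Longrightarrow> snd i \<le> snd j + disp g"
      using bd[OF tpiece_pcs piece_pcs, of i j g] ij reps(1) unfolding b_def disp_def
      by (auto simp: tpiece_def piece_def)
    show "\<bar>c g i j\<bar> \<le> weight (disp g)"
    proof (cases "b g i j = 0")
      case False
      then have "real (snd i) \<le> real (snd j) + real (disp g)" using bb(2) by linarith
      moreover have "0 \<le> real (disp g) * real (snd j)" by simp
      \<comment> \<open>Powers of \<open>1 + n\<close> are submultiplicative in this sense, which is
        what makes such weights suitable.\<close>
      ultimately have "1 + real (snd i) \<le> (1 + real (disp g)) * (1 + real (snd j))"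
        unfolding distrib_left distrib_right by linarith
      then have "weight (snd i) \<le> weight (disp g) * weight (snd j)"
        unfolding weight_def power_mult_distrib[symmetric] by (intro power_mono) auto
      then have "weight (snd i) / weight (snd j) \<le> weight (disp g)" by (simp add: pos_divide_le_eq)
      moreover have "\<bar>c g i j\<bar> \<le> 1 * (weight (snd i) / weight (snd j))"
        unfolding c_def abs_mult using bb(1) weight_pos[of "snd i"] weight_pos[of "snd j"]
        by (intro mult_mono) (auto simp: less_imp_le)
      ultimately show ?thesis by linarith
    qed (simp add: c_def less_imp_le)
  next
    \<comment> \<open>On the stabiliser of \<open>x0\<close>, an open neighbourhood of
      \<open>0\<close>, \<open>disp\<close> vanishes and both factors equal 1.\<close>
    have "\<forall>\<^sub>F g in nhds 0. g \<in> {g. act g x0 = x0}"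
      by (rule eventually_nhds_in_open) (use act(1,4) in auto)
    then show "\<forall>\<^sub>F g in nhds 0. (1 + real Q * real (disp g)) * weight (disp g) \<le> 1"
      by eventually_elim (simp add: disp_eq orb_def weight_def)
  next
    fix i assume "i \<in> reps"
    have "\<forall>\<^sub>F g in nhds 0. g \<in> {g. act g x0 = x0}" "\<forall>\<^sub>F g in nhds 0. g \<in> {g. act g (orb (fst i)) = orb (fst i)}"
      by (rule eventually_nhds_in_open; use act(1,4) in auto)+
    then show "\<forall>\<^sub>F g in nhds 0. \<forall>k. wind i (g + k) = wind i k"
    proof eventually_elim
      case (elim g)
      then have "act (- g) x0 = x0" "act (- g) (orb (fst i)) = orb (fst i)"
        using act_minus(2)[of g x0] act_minus(2)[of g "orb (fst i)"] by simp_all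
      then have "tpiece g i = piece i" unfolding tpiece_def piece_def by simp
      then show ?case unfolding wind_translate by (simp add: wind_def)
    qed
  next
    show "wind i0 = (\<lambda>_. 1)" unfolding wind_def using i0(2) si0 by (auto simp: weight_def)
  next
    \<comment> \<open>A piece that contains \<open>x0\<close> has level 0, and there is only one
      class of level 0.\<close>
    have "i = i0" if "i \<in> reps" "wind i 0 \<noteq> 0" for i
    proof -
      have "x0 \<in> snd (piece i)" using that(2) unfolding wind_def orb_def act(1) by (auto simp: indicator_def)
      moreover have "(fst (piece i), snd (piece i)) \<in> pieces x0" using piece_pcs[of i] reps(1) that(1) by auto
      ultimately have "fst (piece i) = 0" using pieces_mem by fastforce
      then have "piece i = (0, UNIV)" unfolding piece_def by (simp add: hclass_0)
      then have "piece i = piece i0" using i0(2) by simp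
      then show ?thesis using reps(2) that(1) i0(1) unfolding inj_on_def by blast
    qed
    then have "{i \<in> reps. wind i 0 \<noteq> 0} \<subseteq> {i0}" by blast
    then show "finite {i \<in> reps. wind i 0 \<noteq> 0}" using finite_subset by blast
  qed (use rowb colb i0 in auto)
  then show ?thesis by blast
qed

text \<open>A linear count times a quadratic weight is cubic; \<open>3 / t\<close> comes from cubing
  \<open>1 + s \<le> exp s\<close> at \<open>s = t * real n / 3\<close>.\<close>

lemma cubic_growth:
  fixes Q t :: real assumes "Q \<ge> 0" "t > 0"
  shows "\<exists>L\<ge>0. \<forall>n::nat. (1 + Q * real n) * weight n \<le> L * exp (t * real n)"
proof -
  define a where "a = max 1 (3 / t)"
  have a: "a \<ge> 1" "a * t \<ge> 3" unfolding a_def using assms(2) by (auto simp: max_def field_simps)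
  have "(1 + Q * real n) * weight n \<le> (1 + Q) * a ^ 3 * exp (t * real n)" for n
  proof -
    have "real n * 3 \<le> real n * (a * t)" using a(2) by (intro mult_left_mono) auto
    then have "1 + real n \<le> a * (1 + t * real n / 3)" using a(1) by (simp add: algebra_simps)
    also have "\<dots> \<le> a * exp (t * real n / 3)" using a(1) by (intro mult_left_mono exp_ge_add_one_self) auto
    finally have "(1 + real n) ^ 3 \<le> (a * exp (t * real n / 3)) ^ 3" by (intro power_mono) auto
    also have "\<dots> = a ^ 3 * exp (t * real n)" by (simp add: power_mult_distrib exp_of_nat_mult[symmetric])
    finally have 1: "(1 + real n) ^ 3 \<le> a ^ 3 * exp (t * real n)" .
    have "1 + Q * real n \<le> (1 + Q) * (1 + real n)" using assms(1) by (simp add: algebra_simps)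
    then have "(1 + Q * real n) * weight n \<le> (1 + Q) * (1 + real n) * weight n"
      by (intro mult_right_mono) (auto simp: less_imp_le)
    also have "\<dots> = (1 + Q) * (1 + real n) ^ 3" unfolding weight_def by (simp add: power2_eq_square power3_eq_cube)
    also have "\<dots> \<le> (1 + Q) * (a ^ 3 * exp (t * real n))" using 1 assms(1) by (intro mult_left_mono) auto
    finally show ?thesis by (simp add: mult.assoc)
  qed
  then show ?thesis using a(1) assms(1) by (intro exI[of _ "(1 + Q) * a ^ 3"]) auto
qed

text \<open>An invariant vector has value 1 at the constant function 1, but \<open>two_sided\<close>
  bounds this value by at most \<open>3 * P * (1 + k)\<close> terms, each at most
  \<open>nrm \<phi> / weight k\<close>, for arbitrarily large \<open>k\<close>.\<close>

theorem bounded_displacement: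
  assumes T: "strong_property_T TYPE('g)"
  shows "\<exists>C. \<forall>g. disp g \<le> C"
proof (rule ccontr)
  assume unb: "\<not> ?thesis"
  obtain Q :: nat and c i0 where
    cf: "coherent_family reps wind c (\<lambda>g. 1 + real Q * real (disp g)) (\<lambda>g. weight (disp g)) i0"
    using coherent by blast
  interpret coherent_family reps wind c "\<lambda>g. 1 + real Q * real (disp g)" "\<lambda>g. weight (disp g)" i0 by (rule cf)
  obtain \<phi> where \<phi>: "\<phi> \<in> hvectors reps wind" "\<phi> i0 = 1" "\<And>g. rp g \<phi> = \<phi>"
    using invariant_vector[OF cf T length_disp] cubic_growth[of "real Q"]
    by (metis of_nat_0_le_iff)
  note l = hvectorsD(1)[OF \<phi>(1)]
  obtain P :: nat where P: "\<And>x x' k. 1 \<le> k \<and> 2 * k < d x x' \<Longrightarrow> (\<exists>S T \<alpha>.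
     finite S \<and> S \<subseteq> {B\<in>pieces x. k \<le> fst B} \<and> finite T \<and> T \<subseteq> {A\<in>pieces x'. k \<le> fst A} \<and>
     card S + card T \<le> P * (1 + d x x') \<and> (\<forall>B. \<bar>\<alpha> B\<bar> \<le> (1::real)) \<and>
     (\<forall>a. 1 = (\<Sum>B\<in>S. \<alpha> B * indicator (snd B) a) + (\<Sum>A\<in>T. indicator (snd A) a)))"
    using two_sided by blast
  obtain N :: nat where N: "3 * real P * nrm \<phi> < real N" using reals_Archimedean2 by blast
  obtain g where g: "disp g > 3 * N + 3" using unb not_le by blast
  \<comment> \<open>A third satisfies \<open>2 * k < disp g\<close>, as \<open>two_sided\<close>
    requires, and keeps the number of terms linear in \<open>k\<close>.\<close>
  define k where "k = disp g div 3"
  have k: "1 \<le> k" "2 * k < disp g" "N \<le> k" "disp g \<le> 3 * k + 2" unfolding k_def using g by auto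
  obtain S T \<alpha> where S: "finite S" "S \<subseteq> {B\<in>pieces x0. k \<le> fst B}"
    and Tf: "finite T" "T \<subseteq> {A\<in>pieces (act (- g) x0). k \<le> fst A}"
    and card: "card S + card T \<le> P * (1 + disp g)" and \<alpha>: "\<And>B. \<bar>\<alpha> B\<bar> \<le> (1::real)"
    and one: "\<And>a. 1 = (\<Sum>B\<in>S. \<alpha> B * indicator (snd B) a) + (\<Sum>A\<in>T. indicator (snd A) a)"
    using P[of k x0 "act (- g) x0"] k unfolding disp_def by blast
  define S' where "S' = {j\<in>reps. piece j \<in> S}"
  define T' where "T' = {i\<in>reps. tpiece g i \<in> T}"
  have injS: "inj_on piece S'" "piece ` S' \<subseteq> S"
    unfolding S'_def by (rule inj_on_subset[OF reps(2)]) auto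
  have injT: "inj_on (tpiece g) T'" "tpiece g ` T' \<subseteq> T"
    unfolding T'_def by (rule inj_on_subset[OF reps_tpiece(1)]) auto
  have fin: "finite S'" "finite T'" using injS injT S(1) Tf(1) finite_imageD finite_subset by blast+
  have cards: "card S' + card T' \<le> P * (1 + disp g)"
    using card_mono[OF S(1) injS(2)] card_mono[OF Tf(1) injT(2)] card_image[OF injS(1)] card_image[OF injT(1)] card
    by linarith
  have eq: "(\<Sum>j\<in>S'. \<alpha> (piece j) / weight (snd j) * wind j h) + (\<Sum>i\<in>T'. 1 / weight (snd i) * wind i (g + h)) = 1" for h
  proof -
    have "(\<Sum>B\<in>S. \<alpha> B * indicator (snd B) (orb h)) = (\<Sum>B\<in>piece ` S'. \<alpha> B * indicator (snd B) (orb h))"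
    proof (rule sum.mono_neutral_right[OF S(1) injS(2)])
      show "\<forall>B\<in>S - piece ` S'. \<alpha> B * indicator (snd B) (orb h) = 0"
      proof
        fix B assume B: "B \<in> S - piece ` S'"
        have "orb h \<notin> snd B"
        proof
          assume "orb h \<in> snd B"
          then have "B \<in> piece ` reps" using pieces_orb B S(2) reps(3) by blast
          with B show False unfolding S'_def by blast
        qed
        then show "\<alpha> B * indicator (snd B) (orb h) = 0" by simp
      qed
    qed
    also have "\<dots> = (\<Sum>j\<in>S'. \<alpha> (piece j) / weight (snd j) * wind j h)"
      unfolding wind_def by (subst sum.reindex[OF injS(1)]) simp
    finally have 1: "(\<Sum>B\<in>S. \<alpha> B * indicator (snd B) (orb h)) = (\<Sum>j\<in>S'. \<alpha> (piece j) / weight (snd j) * wind j h)" .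
    have "(\<Sum>A\<in>T. indicator (snd A) (orb h) :: real) = (\<Sum>A\<in>tpiece g ` T'. indicator (snd A) (orb h))"
    proof (rule sum.mono_neutral_right[OF Tf(1) injT(2)])
      show "\<forall>A\<in>T - tpiece g ` T'. (indicator (snd A) (orb h) :: real) = 0"
      proof
        fix A assume A: "A \<in> T - tpiece g ` T'"
        have "orb h \<notin> snd A"
        proof
          assume "orb h \<in> snd A"
          then obtain i where "i \<in> adm" "A = tpiece g i" using pieces_orb_translate A Tf(2) by blast
          then obtain j where "j \<in> reps" "A = tpiece g j" using reps_tpiece(2) by blast
          with A show False unfolding T'_def by blast
        qed
        then show "(indicator (snd A) (orb h) :: real) = 0" by simp
      qed
    qed
    also have "\<dots> = (\<Sum>i\<in>T'. 1 / weight (snd i) * wind i (g + h))"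
      unfolding wind_translate by (subst sum.reindex[OF injT(1)]) simp
    finally show ?thesis using one[of "orb h"] 1 by simp
  qed
  have "ev reps wind \<phi> (\<lambda>h. (\<Sum>j\<in>S'. \<alpha> (piece j) / weight (snd j) * wind j h) + (\<Sum>i\<in>T'. 1 / weight (snd i) * wind i (g + h)))
     ((\<Sum>j\<in>S'. complex_of_real (\<alpha> (piece j) / weight (snd j)) * \<phi> j) + (\<Sum>i\<in>T'. complex_of_real (1 / weight (snd i)) * \<phi> i))"
  proof (intro ev_add ev_sum fin)
    show "ev reps wind \<phi> (wind j) (\<phi> j)" if "j \<in> S'" for j using that ev_single unfolding S'_def by fastforce
    \<comment> \<open>The value of \<open>\<phi>\<close> at a translate is a coordinate of
      \<open>rp g \<phi>\<close>, which invariance identifies with that of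
      \<open>\<phi>\<close>.\<close>
    show "ev reps wind \<phi> (\<lambda>h. wind i (g + h)) (\<phi> i)" if "i \<in> T'" for i
      using that ev_rp[of i \<phi> g] \<phi>(3) unfolding T'_def by simp
  qed
  moreover have "ev reps wind \<phi> (\<lambda>_. 1) (\<phi> i0)" using ev_single[OF i0(1), of wind \<phi>] i0(2) by simp
  ultimately have one': "1 = (\<Sum>j\<in>S'. complex_of_real (\<alpha> (piece j) / weight (snd j)) * \<phi> j) + (\<Sum>i\<in>T'. complex_of_real (1 / weight (snd i)) * \<phi> i)"
    unfolding eq \<phi>(2) by (rule ev_unique[OF hvectorsD(2)[OF \<phi>(1)], symmetric])
  have "1 \<le> cmod (\<Sum>j\<in>S'. complex_of_real (\<alpha> (piece j) / weight (snd j)) * \<phi> j) + cmod (\<Sum>i\<in>T'. complex_of_real (1 / weight (snd i)) * \<phi> i)"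
    using norm_triangle_ineq[of "\<Sum>j\<in>S'. complex_of_real (\<alpha> (piece j) / weight (snd j)) * \<phi> j"
        "\<Sum>i\<in>T'. complex_of_real (1 / weight (snd i)) * \<phi> i"] unfolding one'[symmetric] by simp
  also have "\<dots> \<le> (\<Sum>j\<in>S'. nrm \<phi> / weight k) + (\<Sum>i\<in>T'. nrm \<phi> / weight k)"
  proof -
    have *: "cmod (complex_of_real (x / weight m) * \<phi> j) \<le> nrm \<phi> / weight k" if "\<bar>x\<bar> \<le> 1" "k \<le> m" for x m j
    proof -
      have "weight k \<le> weight m" unfolding weight_def using that(2) by (intro power_mono) auto
      then have "\<bar>x\<bar> / weight m \<le> 1 / weight k" using that(1) by (intro frac_le) auto
      then have "\<bar>x\<bar> / weight m * cmod (\<phi> j) \<le> 1 / weight k * nrm \<phi>"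
        using comp_le_nrm[OF l] by (intro mult_mono) (auto simp: less_imp_le)
      then show ?thesis by (simp add: norm_mult norm_divide less_imp_le abs_of_pos)
    qed
    have "k \<le> snd j" if "j \<in> S'" for j using that S(2) unfolding S'_def piece_def by auto
    moreover have "k \<le> snd i" if "i \<in> T'" for i using that Tf(2) unfolding T'_def tpiece_def by auto
    ultimately show ?thesis
      by (intro add_mono sum_norm_le *) (auto simp: \<alpha>)
  qed
  also have "\<dots> = real (card S' + card T') * (nrm \<phi> / weight k)" by (simp add: distrib_right add_divide_distrib)
  also have "\<dots> \<le> (real P * (3 * (1 + real k))) * (nrm \<phi> / weight k)"
  proof (rule mult_right_mono)
    have "real (card S' + card T') \<le> real (P * (1 + disp g))" using cards by (rule of_nat_mono)
    also have "\<dots> \<le> real (P * (3 * (1 + k)))" by (intro of_nat_mono mult_left_mono) (use k(4) in auto)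
    also have "\<dots> = real P * (3 * (1 + real k))" by simp
    finally show "real (card S' + card T') \<le> real P * (3 * (1 + real k))" .
  qed (simp add: less_imp_le)
  also have "\<dots> = 3 * real P * nrm \<phi> / (1 + real k)"
  proof -
    have "(p * (3 * x)) * (y / x\<^sup>2) = 3 * p * y / x" if "x > 0" for p x y :: real
      using that by (simp add: field_simps power2_eq_square)
    from this[of "1 + real k"] show ?thesis unfolding weight_def by (simp del: distrib_left_numeral)
  qed
  finally have "1 + real k \<le> 3 * real P * nrm \<phi>" by (simp add: pos_le_divide_eq)
  with N k(3) show False by linarith
qed

end

theorem theorem1p3:
  fixes E :: "'v set set"
    and act :: "'g::{topological_group_add, t2_space} \<Rightarrow> 'v \<Rightarrow> 'v"
  assumes "locally_compact_space (euclidean :: 'g topology)"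
    and "strong_property_T TYPE('g)"
    and "simple_graph E"
    and "uniformly_fine_graph E"
    and "hyperbolic_graph E"
    and "isometric_action E act"
  shows "\<forall>x. graph_bounded E (orbit act x)"
proof
  fix x
  interpret fine_hyperbolic_action E act x
    by unfold_locales (use assms in auto)
  obtain C where C: "\<And>g. disp g \<le> C" using bounded_displacement[OF assms(2)] by blast
  \<comment> \<open>Translating by the inverse of \<open>g\<close> turns the distance of two orbit
    points into the displacement of \<open>- g + h\<close>.\<close>
  have "d (act g x) (act h x) \<le> C" for g h
    using C[of "- g + h"] act(3)[of g x "act (- g + h) x"] act(2)[of g "- g + h" x]
    unfolding disp_eq orb_def by (simp add: add.assoc[symmetric])
  then show "graph_bounded E (orbit act x)" unfolding graph_bounded_def orbit_def by blast
qed

end
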